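(* Let $\phi:(\mathbb{P}^1)^3\dashrightarrow\mathbb{P}^3$ be a general trilinear birational map of type $(1,2,2)$. Then $\phi$ is scaffold. Moreover, $$T_0\cap T_1=s\cup r_0\cup r_1\cup y,\qquad Y_0\cap Y_1=s\cup r_0\cup r_1\cup z,$$ where: 1. $s=\Sigma_0\cap\Sigma_1$ is a line; 2. $r_0,r_1$ are the unique two lines in $\mathbb{P}^3$ that meet $s_{jk}$ for every $0\le j,k\le1$; 3. $y$ is the line through the points $u_{00}\cap u_{01}$ and $u_{10}\cap u_{11}$; 4. $z$ is the line through the points $t_{00}\cap t_{01}$ and $t_{10}\cap t_{11}$.
   Context: Setting. $\mathbb{P}^n$ is complex projective $n$-space. A trilinear rational map $\phi:\mathbb{P}^1\times\mathbb{P}^1\times\mathbb{P}^1\dashrightarrow\mathbb{P}^3$ is one given by $$\mathbf{f}=(f_0,f_1,f_2,f_3)=\sum_{0\le i,j,k\le 1} w_{ijk}\,\mathbf{P}_{ijk}\,s_it_ju_k,$$ with control points $\mathbf{P}_{ijk}=(1,x_{ijk},y_{ijk},z_{ijk})\in\mathbb{R}^4$ (identified with points of $\mathbb{P}^3$) and weights $w_{ijk}\in\mathbb{R}$. Boundary surfaces. $\Sigma_0$ (resp. $\Sigma_1$) is the closure of the image of $\phi$ restricted to $(s_0:s_1)=(1:0)$ (resp. $(0:1)$). $T_0,T_1$ and $Y_0,Y_1$ are defined in the same way using $(t_0:t_1)$ and $(u_0:u_1)$. Boundary lines: $s_{jk}$ joins $\mathbf{P}_{0jk},\mathbf{P}_{1jk}$;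 $t_{ik}$ joins $\mathbf{P}_{i0k},\mathbf{P}_{i1k}$; $u_{ij}$ joins $\mathbf{P}_{ij0},\mathbf{P}_{ij1}$ (images of the corresponding coordinate lines). The boundary surfaces and lines of the parameter $s$ (resp. $t$, $u$) are $\Sigma_i$ and $s_{jk}$ (resp. $T_j$ and $t_{ik}$; $Y_k$ and $u_{ij}$). $\phi$ is scaffold if all the boundary surfaces are quadrics except for one of the three parameters, for which (1) the two boundary surfaces are planes, that intersect at a line $\ell$, and (2) the four boundary lines intersect two lines $r_0,r_1$, and these two intersect $\ell$. Type. If $\phi$ is birational, its inverse is $\mathbf{x}\mapsto(A_0:A_1)\times(B_0:B_1)\times(C_0:C_1)$ with $A_0,A_1$ (resp. $B_0,B_1$; $C_0,C_1$) homogeneous of the same degree in $\mathbf{x}=(x_0,\dots,x_3)$ without common factor; the type of $\phi$ is $(\deg A_i,\deg B_j,\deg C_k)$. The trilinear birational maps of a fixed type form an irreducible locus in the projective space $\mathbb{P}^{31}$ of trilinear rational maps (quadruples of trilinear forms up to scalar). "General" means belonging to a suitable nonempty Zariski-open subset of that locus; a general such map satisfies the nondegeneracy property that $\Sigma_i,T_j,Y_k$ are smooth surfaces, pairwise distinct, and $s_{jk},t_{ik},u_{ij}$ are lines, pairwise distinct. *)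

theory Defs
  imports
    "HOL-Analysis.Analysis"
    "HOL-Library.Poly_Mapping"
    "HOL-Computational_Algebra.Squarefree"
begin

section \<open>Complex polynomials in several variables\<close>

text \<open>Monomials are finitely supported exponent vectors, so that \<open>+\<close>, \<open>*\<close> and \<open>dvd\<close> are those of
  the convolution ring on \<open>'v \<Rightarrow>\<^sub>0 nat\<close>.\<close>

type_synonym 'v mpoly = "('v \<Rightarrow>\<^sub>0 nat) \<Rightarrow>\<^sub>0 complex"

definition mpoly_eval :: "'v mpoly \<Rightarrow> ('v \<Rightarrow> complex) \<Rightarrow> complex" where
  "mpoly_eval p v =
     (\<Sum>m\<in>Poly_Mapping.keys p.
        Poly_Mapping.lookup p m * (\<Prod>i\<in>Poly_Mapping.keys m. v i ^ Poly_Mapping.lookup m i))"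

definition homogeneous :: "nat \<Rightarrow> 'v mpoly \<Rightarrow> bool" where
  "homogeneous d p \<longleftrightarrow>
     (\<forall>m\<in>Poly_Mapping.keys p. (\<Sum>i\<in>Poly_Mapping.keys m. Poly_Mapping.lookup m i) = d)"

definition partial_deriv :: "'v \<Rightarrow> 'v mpoly \<Rightarrow> 'v mpoly" where
  "partial_deriv i p =
     (\<Sum>m\<in>Poly_Mapping.keys p. Poly_Mapping.single (m - Poly_Mapping.single i 1)
                     (of_nat (Poly_Mapping.lookup m i) * Poly_Mapping.lookup p m))"

definition no_common_factor :: "'v mpoly \<Rightarrow> 'v mpoly \<Rightarrow> bool" where
  "no_common_factor p q \<longleftrightarrow> (\<forall>h. h dvd p \<and> h dvd q \<longrightarrow> h dvd 1)"


section \<open>Projective three-space\<close>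

text \<open>A point of projective space is given by a nonzero vector of homogeneous coordinates, and a
  subset of projective space is represented by the set of all nonzero vectors of homogeneous
  coordinates of its points.  The index types \<open>2\<close> and \<open>4\<close> have the elements \<open>0, 1\<close> and
  \<open>0, 1, 2, 3\<close>, so \<open>x $ 0, \<dots>, x $ 3\<close> are the coordinates \<open>x\<^sub>0, \<dots>, x\<^sub>3\<close>.\<close>

type_synonym pvec = "complex ^ 4"

definition zero_locus :: "4 mpoly \<Rightarrow> pvec set" where
  "zero_locus F = {x. x \<noteq> 0 \<and> mpoly_eval F (($) x) = 0}"

definition zariski_closure :: "pvec set \<Rightarrow> pvec set" where
  "zariski_closure X =
     {x. x \<noteq> 0 \<and> (\<forall>F d. homogeneous d F \<and> X \<subseteq> zero_locus F \<longrightarrow> x \<in> zero_locus F)}"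

definition proj_point :: "pvec \<Rightarrow> pvec set" where
  "proj_point p = vec.span {p} - {0}"

definition line_through :: "pvec \<Rightarrow> pvec \<Rightarrow> pvec set" where
  "line_through p q = vec.span {p, q} - {0}"

definition is_line :: "pvec set \<Rightarrow> bool" where
  "is_line L \<longleftrightarrow> (\<exists>W. vec.subspace W \<and> vec.dim W = 2 \<and> L = W - {0})"

text \<open>Squarefreeness of the equation makes the degree an invariant of the point set; in particular
  a plane, which is also the zero locus of the square of a linear form, is not a quadric.\<close>

definition surface_of_degree :: "nat \<Rightarrow> pvec set \<Rightarrow> bool" where
  "surface_of_degree d X \<longleftrightarrow>
     d > 0 \<and> (\<exists>F. homogeneous d F \<and> squarefree F \<and> X = zero_locus F)"

abbreviation is_plane :: "pvec set \<Rightarrow> bool" where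
  "is_plane \<equiv> surface_of_degree 1"

abbreviation is_quadric :: "pvec set \<Rightarrow> bool" where
  "is_quadric \<equiv> surface_of_degree 2"

definition smooth_surface :: "pvec set \<Rightarrow> bool" where
  "smooth_surface X \<longleftrightarrow>
     (\<exists>d F. d > 0 \<and> homogeneous d F \<and> squarefree F \<and> X = zero_locus F \<and>
        (\<forall>x\<in>X. \<exists>i. mpoly_eval (partial_deriv i F) (($) x) \<noteq> 0))"


section \<open>Trilinear rational maps\<close>

text \<open>A quadruple of trilinear forms is given by its coefficient tensor: \<open>c $ i $ j $ k\<close> is the
  vector of coefficients of \<open>s\<^sub>i t\<^sub>j u\<^sub>k\<close>, that is, \<open>w\<^sub>i\<^sub>j\<^sub>k P\<^sub>i\<^sub>j\<^sub>k\<close>.  When the weight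
  is nonzero this is the control point \<open>P\<^sub>i\<^sub>j\<^sub>k\<close> as a point of projective space.  The tensors up to
  scalar form the 31-dimensional projective space of trilinear rational maps.\<close>

type_synonym trilinear = "pvec ^ 2 ^ 2 ^ 2"

definition tri_eval :: "trilinear \<Rightarrow> complex ^ 2 \<Rightarrow> complex ^ 2 \<Rightarrow> complex ^ 2 \<Rightarrow> pvec" where
  "tri_eval c s t u = (\<Sum>i\<in>UNIV. \<Sum>j\<in>UNIV. \<Sum>k\<in>UNIV. (s $ i * t $ j * u $ k) *s c $ i $ j $ k)"

definition control_point :: "real \<Rightarrow> real \<Rightarrow> real \<Rightarrow> pvec" where
  "control_point x y z =
     (\<chi> l. if l = 0 then 1 else if l = 1 then of_real x else if l = 2 then of_real y else of_real z)"

definition trilinear_of_control ::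
  "(2 \<Rightarrow> 2 \<Rightarrow> 2 \<Rightarrow> real) \<Rightarrow> (2 \<Rightarrow> 2 \<Rightarrow> 2 \<Rightarrow> real) \<Rightarrow> (2 \<Rightarrow> 2 \<Rightarrow> 2 \<Rightarrow> real) \<Rightarrow> (2 \<Rightarrow> 2 \<Rightarrow> 2 \<Rightarrow> real) \<Rightarrow> trilinear"
where
  "trilinear_of_control w x y z =
     (\<chi> i j k. of_real (w i j k) *s control_point (x i j k) (y i j k) (z i j k))"

text \<open>The openness is in the Zariski topology of the 31-dimensional projective space; a set of maps is
  again represented by all its nonzero tensors.\<close>

definition zariski_open :: "trilinear set \<Rightarrow> bool" where
  "zariski_open U \<longleftrightarrow>
     (\<exists>S :: (2 \<times> 2 \<times> 2 \<times> 4) mpoly set. (\<forall>p\<in>S. \<exists>d. homogeneous d p) \<and>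
        U = {c. c \<noteq> 0 \<and> (\<exists>p\<in>S. mpoly_eval p (\<lambda>(i, j, k, l). c $ i $ j $ k $ l) \<noteq> 0)})"


subsection \<open>Birationality and type\<close>

text \<open>Two tuples of polynomial functions on an affine space define the same rational map iff neither
  vanishes identically and they are proportional at every point.\<close>

definition same_rational_map :: "('a \<Rightarrow> complex ^ 'n) \<Rightarrow> ('a \<Rightarrow> complex ^ 'n) \<Rightarrow> bool" where
  "same_rational_map g h \<longleftrightarrow>
     (\<exists>x. g x \<noteq> 0) \<and> (\<exists>x. h x \<noteq> 0) \<and> (\<forall>x i j. g x $ i * h x $ j = g x $ j * h x $ i)"

definition pair_eval :: "(2 \<Rightarrow> 4 mpoly) \<Rightarrow> pvec \<Rightarrow> complex ^ 2" where
  "pair_eval A x = (\<chi> i. mpoly_eval (A i) (($) x))"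

definition is_inverse ::
  "trilinear \<Rightarrow> (2 \<Rightarrow> 4 mpoly) \<Rightarrow> (2 \<Rightarrow> 4 mpoly) \<Rightarrow> (2 \<Rightarrow> 4 mpoly) \<Rightarrow> bool" where
  "is_inverse c A B C \<longleftrightarrow>
     same_rational_map (\<lambda>(s, t, u). pair_eval A (tri_eval c s t u)) (\<lambda>(s, t, u). s) \<and>
     same_rational_map (\<lambda>(s, t, u). pair_eval B (tri_eval c s t u)) (\<lambda>(s, t, u). t) \<and>
     same_rational_map (\<lambda>(s, t, u). pair_eval C (tri_eval c s t u)) (\<lambda>(s, t, u). u) \<and>
     same_rational_map (\<lambda>x. tri_eval c (pair_eval A x) (pair_eval B x) (pair_eval C x)) (\<lambda>x. x)"

definition birational_of_type :: "nat \<Rightarrow> nat \<Rightarrow> nat \<Rightarrow> trilinear \<Rightarrow> bool" where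
  "birational_of_type a b d c \<longleftrightarrow>
     (\<exists>A B C. is_inverse c A B C \<and>
        (\<forall>i. homogeneous a (A i)) \<and> no_common_factor (A 0) (A 1) \<and>
        (\<forall>i. homogeneous b (B i)) \<and> no_common_factor (B 0) (B 1) \<and>
        (\<forall>i. homogeneous d (C i)) \<and> no_common_factor (C 0) (C 1))"


subsection \<open>Boundary surfaces and boundary lines\<close>

datatype parameter = Par_s | Par_t | Par_u

text \<open>\<open>axis 0 1\<close> and \<open>axis 1 1\<close> are \<open>(1:0)\<close> and \<open>(0:1)\<close>; the indeterminacy points of the map are
  removed before taking the closure.\<close>

fun boundary_surface :: "trilinear \<Rightarrow> parameter \<Rightarrow> 2 \<Rightarrow> pvec set" where
  "boundary_surface c Par_s i = zariski_closure ({tri_eval c (axis i 1) t u | t u. True} - {0})"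
| "boundary_surface c Par_t j = zariski_closure ({tri_eval c s (axis j 1) u | s u. True} - {0})"
| "boundary_surface c Par_u k = zariski_closure ({tri_eval c s t (axis k 1) | s t. True} - {0})"

abbreviation Sigma_surf :: "trilinear \<Rightarrow> 2 \<Rightarrow> pvec set" where
  "Sigma_surf c i \<equiv> boundary_surface c Par_s i"
abbreviation T_surf :: "trilinear \<Rightarrow> 2 \<Rightarrow> pvec set" where
  "T_surf c j \<equiv> boundary_surface c Par_t j"
abbreviation Y_surf :: "trilinear \<Rightarrow> 2 \<Rightarrow> pvec set" where
  "Y_surf c k \<equiv> boundary_surface c Par_u k"

fun boundary_line :: "trilinear \<Rightarrow> parameter \<Rightarrow> 2 \<Rightarrow> 2 \<Rightarrow> pvec set" where
  "boundary_line c Par_s j k = line_through (c $ 0 $ j $ k) (c $ 1 $ j $ k)"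
| "boundary_line c Par_t i k = line_through (c $ i $ 0 $ k) (c $ i $ 1 $ k)"
| "boundary_line c Par_u i j = line_through (c $ i $ j $ 0) (c $ i $ j $ 1)"

abbreviation s_line :: "trilinear \<Rightarrow> 2 \<Rightarrow> 2 \<Rightarrow> pvec set" where
  "s_line c j k \<equiv> boundary_line c Par_s j k"
abbreviation t_line :: "trilinear \<Rightarrow> 2 \<Rightarrow> 2 \<Rightarrow> pvec set" where
  "t_line c i k \<equiv> boundary_line c Par_t i k"
abbreviation u_line :: "trilinear \<Rightarrow> 2 \<Rightarrow> 2 \<Rightarrow> pvec set" where
  "u_line c i j \<equiv> boundary_line c Par_u i j"

definition nondegenerate :: "trilinear \<Rightarrow> bool" where
  "nondegenerate c \<longleftrightarrow>
     (\<forall>p i. smooth_surface (boundary_surface c p i)) \<and>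
     inj (\<lambda>(p, i). boundary_surface c p i) \<and>
     (\<forall>p a b. is_line (boundary_line c p a b)) \<and>
     inj (\<lambda>(p, a, b). boundary_line c p a b)"

definition scaffold :: "trilinear \<Rightarrow> bool" where
  "scaffold c \<longleftrightarrow>
     (\<exists>p. (\<forall>q i. q \<noteq> p \<longrightarrow> is_quadric (boundary_surface c q i)) \<and>
        (\<forall>i. is_plane (boundary_surface c p i)) \<and>
        (\<exists>l r0 r1. boundary_surface c p 0 \<inter> boundary_surface c p 1 = l \<and> is_line l \<and>
           is_line r0 \<and> is_line r1 \<and> r0 \<noteq> r1 \<and>
           (\<forall>a b. boundary_line c p a b \<inter> r0 \<noteq> {} \<and> boundary_line c p a b \<inter> r1 \<noteq> {}) \<and>
           r0 \<inter> l \<noteq> {} \<and> r1 \<inter> l \<noteq> {}))"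

end

theory Submission
  imports Defs "HOL-Computational_Algebra.Fundamental_Theorem_Algebra"
begin

text \<open>The linear component \<open>(A\<^sub>0 : A\<^sub>1)\<close> of the inverse puts the image of every surface \<open>s = const\<close> into
  a plane of the pencil through a line. The restricted map \<open>(t, u) \<mapsto> \<phi> (s, t, u)\<close> is a birational
  projection of a Segre quadric to this plane, so its centre lies on the quadric and is a base point
  \<open>(t(s), u(s))\<close>. For general \<open>\<phi>\<close> the vectors \<open>s \<otimes> u(s)\<close> and \<open>s \<otimes> t(s)\<close> are eigenvectors of two
  \<open>4 \<times> 4\<close> matrices with eigenvalues \<open>t(s)\<close> and \<open>u(s)\<close>, so \<open>t(s)\<close> and \<open>u(s)\<close> take finitely many values
  and the base point is constant. After normalizing it, the four lines \<open>s\<^sub>j\<^sub>k\<close> are the images of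
  \<open>s \<mapsto> (h\<^sub>j\<^sub>k s, K\<^sub>j\<^sub>k s)\<close> with \<open>K\<^sub>j\<^sub>k\<close> one of \<open>I, -I, K, -K\<close> for a single \<open>2 \<times> 2\<close> matrix \<open>K\<close>. The
  eigenvectors of \<open>K\<close> give the transversals \<open>r\<^sub>0\<close> and \<open>r\<^sub>1\<close>, and in eigencoordinates all boundary
  surfaces have explicit equations.\<close>

section \<open>Polynomial functions\<close>

text \<open>The base point and the linear forms of the inverse are available only once birationality
  is assumed, whereas the open set has to be cut out beforehand by polynomials in the coefficients.
  So every genericity condition is built from determinants of control points: \<open>bracket\<close>
  for pairs of lines, \<open>face_det\<close> as a multiple of the value of a linear form of the
  inverse, \<open>gram\<close> for the transversals. These conditions survive the rescaling of the
  control points by the coordinates of the base point, which turns the base point into the relation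
  that the four vertices of a face sum to zero. Two degeneracies, a double eigenvalue of K and
  further transversals, are excluded by the single condition \<open>gram\<close>: in normal form it
  is, up to a nonzero factor, the discriminant of K times the square of the expression in
  \<open>cross\<close>. Generality also demands that the open set meet the locus, so one explicit
  map is constructed. Zariski closures need no elimination theory: the four quadrics equal their
  images, and every missing point of a plane lies on a line whose other points are in the
  image.\<close>

definition mono_eval :: "('v \<Rightarrow>\<^sub>0 nat) \<Rightarrow> ('v \<Rightarrow> complex) \<Rightarrow> complex" where
  "mono_eval m v = (\<Prod>i\<in>Poly_Mapping.keys m. v i ^ Poly_Mapping.lookup m i)"

definition mono_deg :: "('v \<Rightarrow>\<^sub>0 nat) \<Rightarrow> nat" where
  "mono_deg m = (\<Sum>i\<in>Poly_Mapping.keys m. Poly_Mapping.lookup m i)"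

lemma mono_eval_superset:
  assumes "finite S" "Poly_Mapping.keys m \<subseteq> S"
  shows "mono_eval m v = (\<Prod>i\<in>S. v i ^ Poly_Mapping.lookup m i)"
  unfolding mono_eval_def
  by (rule prod.mono_neutral_left) (use assms in \<open>auto simp: in_keys_iff\<close>)

lemma mono_deg_superset:
  assumes "finite S" "Poly_Mapping.keys m \<subseteq> S"
  shows "mono_deg m = (\<Sum>i\<in>S. Poly_Mapping.lookup m i)"
  unfolding mono_deg_def
  by (rule sum.mono_neutral_left) (use assms in \<open>auto simp: in_keys_iff\<close>)

lemma mono_eval_UNIV: "mono_eval m v = (\<Prod>i\<in>UNIV. v i ^ Poly_Mapping.lookup m (i::'v::finite))"
  by (rule mono_eval_superset) auto

lemma mono_deg_UNIV: "mono_deg m = (\<Sum>i\<in>UNIV. Poly_Mapping.lookup m (i::'v::finite))"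
  by (rule mono_deg_superset) auto

lemma mono_eval_add: "mono_eval (m + n) v = mono_eval m v * mono_eval n v"
proof -
  let ?S = "Poly_Mapping.keys m \<union> Poly_Mapping.keys n"
  have "mono_eval (m + n) v = (\<Prod>i\<in>?S. v i ^ Poly_Mapping.lookup (m + n) i)"
    by (rule mono_eval_superset) (auto simp: Poly_Mapping.keys_add)
  also have "\<dots> = (\<Prod>i\<in>?S. v i ^ Poly_Mapping.lookup m i) * (\<Prod>i\<in>?S. v i ^ Poly_Mapping.lookup n i)"
    by (simp add: lookup_add power_add prod.distrib)
  also have "\<dots> = mono_eval m v * mono_eval n v"
    by (subst (1 2) mono_eval_superset[where S = ?S]) auto
  finally show ?thesis .
qed

lemma mono_deg_add: "mono_deg (m + n) = mono_deg m + mono_deg n"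
proof -
  let ?S = "Poly_Mapping.keys m \<union> Poly_Mapping.keys n"
  have "mono_deg (m + n) = (\<Sum>i\<in>?S. Poly_Mapping.lookup (m + n) i)"
    by (rule mono_deg_superset) (auto simp: Poly_Mapping.keys_add)
  also have "\<dots> = (\<Sum>i\<in>?S. Poly_Mapping.lookup m i) + (\<Sum>i\<in>?S. Poly_Mapping.lookup n i)"
    by (simp add: lookup_add sum.distrib)
  also have "\<dots> = mono_deg m + mono_deg n"
    by (subst (1 2) mono_deg_superset[where S = ?S]) auto
  finally show ?thesis .
qed

lemma mono_0 [simp]: "mono_eval 0 v = 1" "mono_deg 0 = 0"
  by (simp_all add: mono_eval_def mono_deg_def)

lemma mono_single [simp]: "mono_eval (Poly_Mapping.single i 1) v = v i" "mono_deg (Poly_Mapping.single i 1) = 1"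
  by (simp_all add: mono_eval_def mono_deg_def)

lemma homogeneous_iff: "homogeneous d p \<longleftrightarrow> (\<forall>m\<in>Poly_Mapping.keys p. mono_deg m = d)"
  by (simp add: homogeneous_def mono_deg_def)

lemma mpoly_eval_superset:
  assumes "finite S" "Poly_Mapping.keys p \<subseteq> S"
  shows "mpoly_eval p v = (\<Sum>m\<in>S. Poly_Mapping.lookup p m * mono_eval m v)"
  unfolding mpoly_eval_def mono_eval_def[symmetric]
  by (rule sum.mono_neutral_left) (use assms in \<open>auto simp: in_keys_iff\<close>)

lemma mpoly_eval_mono: "mpoly_eval p v = (\<Sum>m\<in>Poly_Mapping.keys p. Poly_Mapping.lookup p m * mono_eval m v)"
  by (rule mpoly_eval_superset) auto

lemma mpoly_eval_0 [simp]: "mpoly_eval 0 v = 0"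
  by (simp add: mpoly_eval_mono)

lemma mpoly_eval_single: "mpoly_eval (Poly_Mapping.single m c) v = c * mono_eval m v"
  by (subst mpoly_eval_superset[where S = "{m}"]) (auto)

lemma mpoly_eval_1 [simp]: "mpoly_eval 1 v = 1"
  using mpoly_eval_single[of 0 1 v] by simp

lemma mpoly_eval_add [simp]: "mpoly_eval (p + q) v = mpoly_eval p v + mpoly_eval q v"
proof -
  let ?S = "Poly_Mapping.keys p \<union> Poly_Mapping.keys q"
  show ?thesis
    by (subst (1 2 3) mpoly_eval_superset[where S = ?S])
      (auto simp: lookup_add sum.distrib algebra_simps dest: subsetD[OF Poly_Mapping.keys_add])
qed

lemma mpoly_eval_uminus [simp]: "mpoly_eval (- p) v = - mpoly_eval p v"
  using mpoly_eval_add[of p "- p" v] by (simp add: eq_neg_iff_add_eq_0 add.commute del: mpoly_eval_add)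

lemma mpoly_eval_minus [simp]: "mpoly_eval (p - q) v = mpoly_eval p v - mpoly_eval q v"
  using mpoly_eval_add[of p "- q" v] by simp

lemma mpoly_eval_sum [simp]: "mpoly_eval (sum f S) v = (\<Sum>x\<in>S. mpoly_eval (f x) v)"
  by (induction S rule: infinite_finite_induct) auto

lemma poly_mapping_as_sum:
  "p = (\<Sum>m\<in>Poly_Mapping.keys p. Poly_Mapping.single m (Poly_Mapping.lookup p m))"
  by (rule poly_mapping_eqI)
    (auto simp: lookup_sum lookup_single when_def in_keys_iff sum.delta)

lemma mpoly_eval_mult [simp]: "mpoly_eval (p * q) v = mpoly_eval p v * mpoly_eval q v"
proof -
  have "p * q = (\<Sum>m\<in>Poly_Mapping.keys p. \<Sum>n\<in>Poly_Mapping.keys q.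
      Poly_Mapping.single (m + n) (Poly_Mapping.lookup p m * Poly_Mapping.lookup q n))"
    by (subst poly_mapping_as_sum[of p], subst poly_mapping_as_sum[of q])
      (simp add: sum_product mult_single)
  then have "mpoly_eval (p * q) v = (\<Sum>m\<in>Poly_Mapping.keys p. \<Sum>n\<in>Poly_Mapping.keys q.
      Poly_Mapping.lookup p m * Poly_Mapping.lookup q n * (mono_eval m v * mono_eval n v))"
    by (simp only: mpoly_eval_sum mpoly_eval_single mono_eval_add)
  then show ?thesis
    by (simp add: mpoly_eval_mono sum_product mult_ac)
qed

lemma mpoly_eval_power [simp]: "mpoly_eval (p ^ n) v = mpoly_eval p v ^ n"
  by (induction n) auto

abbreviation cst :: "complex \<Rightarrow> 'v mpoly" where "cst c \<equiv> Poly_Mapping.single 0 c"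
definition var :: "'v \<Rightarrow> 'v mpoly" where "var i = Poly_Mapping.single (Poly_Mapping.single i 1) 1"

lemma mpoly_eval_cst [simp]: "mpoly_eval (cst c) v = c"
  by (simp add: mpoly_eval_single)

lemma mpoly_eval_var [simp]: "mpoly_eval (var i) v = v i"
  by (simp add: var_def mpoly_eval_single del: One_nat_def)

lemma homogeneous_0 [simp]: "homogeneous d 0"
  by (simp add: homogeneous_iff)

lemma homogeneous_cst: "homogeneous 0 (cst c)"
  by (auto simp: homogeneous_iff)

lemma homogeneous_var: "homogeneous 1 (var i)"
  by (auto simp: homogeneous_iff var_def simp del: One_nat_def)

lemma homogeneous_add: "homogeneous d p \<Longrightarrow> homogeneous d q \<Longrightarrow> homogeneous d (p + q)"
  using Poly_Mapping.keys_add[of p q] by (auto simp: homogeneous_iff)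

lemma homogeneous_uminus: "homogeneous d p \<Longrightarrow> homogeneous d (- p)"
  by (auto simp: homogeneous_iff in_keys_iff)

lemma homogeneous_minus: "homogeneous d p \<Longrightarrow> homogeneous d q \<Longrightarrow> homogeneous d (p - q)"
  using homogeneous_add[of d p "- q"] homogeneous_uminus[of d q] by simp

lemma homogeneous_mult: "homogeneous d p \<Longrightarrow> homogeneous e q \<Longrightarrow> homogeneous (d + e) (p * q)"
  using Poly_Mapping.keys_mult[of p q] by (fastforce simp: homogeneous_iff mono_deg_add)

lemma homogeneous_cst_mult: "homogeneous d p \<Longrightarrow> homogeneous d (cst c * p)"
  using homogeneous_mult[OF homogeneous_cst[of c], of d p] by simp

lemma homogeneous_sum: "(\<And>x. x \<in> S \<Longrightarrow> homogeneous d (f x)) \<Longrightarrow> homogeneous d (sum f S)"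
  by (induction S rule: infinite_finite_induct) (auto intro: homogeneous_add)

subsection \<open>Polynomial functions of one variable\<close>

definition polyfun :: "(complex \<Rightarrow> complex) \<Rightarrow> bool" where
  "polyfun f \<longleftrightarrow> (\<exists>P. \<forall>z. f z = poly P z)"

lemma polyfun_const [intro, simp]: "polyfun (\<lambda>z. c)"
  unfolding polyfun_def by (rule exI[of _ "[:c:]"]) simp

lemma polyfun_id [intro, simp]: "polyfun (\<lambda>z. z)"
  unfolding polyfun_def by (rule exI[of _ "[:0, 1:]"]) simp

lemma polyfun_add [intro]: "polyfun f \<Longrightarrow> polyfun g \<Longrightarrow> polyfun (\<lambda>z. f z + g z)"
  unfolding polyfun_def by (metis poly_add)

lemma polyfun_minus [intro]: "polyfun f \<Longrightarrow> polyfun g \<Longrightarrow> polyfun (\<lambda>z. f z - g z)"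
  unfolding polyfun_def by (metis poly_diff)

lemma polyfun_mult [intro]: "polyfun f \<Longrightarrow> polyfun g \<Longrightarrow> polyfun (\<lambda>z. f z * g z)"
  unfolding polyfun_def by (metis poly_mult)

lemma polyfun_power [intro]: "polyfun f \<Longrightarrow> polyfun (\<lambda>z. f z ^ n)"
  unfolding polyfun_def by (metis poly_power)

lemma polyfun_sum [intro]: "(\<And>x. x \<in> S \<Longrightarrow> polyfun (f x)) \<Longrightarrow> polyfun (\<lambda>z. \<Sum>x\<in>S. f x z)"
  by (induction S rule: infinite_finite_induct) auto

lemma polyfun_prod [intro]: "(\<And>x. x \<in> S \<Longrightarrow> polyfun (f x)) \<Longrightarrow> polyfun (\<lambda>z. \<Prod>x\<in>S. f x z)"
  by (induction S rule: infinite_finite_induct) auto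

lemma polyfun_mpoly_eval [intro]:
  "(\<And>i. polyfun (\<lambda>z. v z i)) \<Longrightarrow> polyfun (\<lambda>z. mpoly_eval p (v z))"
  unfolding mpoly_eval_def by (intro polyfun_sum polyfun_mult polyfun_prod polyfun_power polyfun_const)

lemma polyfun_finite_zeros:
  assumes "polyfun f" "f a \<noteq> 0"
  shows "finite {z. f z = 0}"
proof -
  obtain P where P: "\<And>z. f z = poly P z" using assms(1) by (auto simp: polyfun_def)
  then have "P \<noteq> 0" using assms(2) by auto
  then show ?thesis using poly_roots_finite[of P] by (simp add: P)
qed

text \<open>A nonzero polynomial has finitely many zeros. This replaces a limit argument: an
  equation valid on a punctured line passes to the missing point.\<close>

lemma polyfun_continuous: "polyfun f \<Longrightarrow> f a = 0" if "\<And>z. z \<noteq> a \<Longrightarrow> f z = 0"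
proof (rule ccontr)
  assume "polyfun f" "f a \<noteq> 0"
  then have "finite {z. f z = 0}" by (rule polyfun_finite_zeros)
  moreover have "UNIV - {a} \<subseteq> {z. f z = 0}" using that by auto
  ultimately have "finite (UNIV - {a} :: complex set)" by (rule finite_subset[rotated])
  then show False by (simp add: infinite_UNIV_char_0)
qed

text \<open>Each function has only finitely many zeros. Applied on the line joining two points, each
  good for one open condition, it yields a point that is good for both.\<close>

lemma polyfun_no_zero_divisors:
  assumes "polyfun f" "polyfun g" "f a \<noteq> 0" "g b \<noteq> 0"
  shows "\<exists>z. f z \<noteq> 0 \<and> g z \<noteq> 0"
proof (rule ccontr)
  assume "\<not> ?thesis"
  then have "UNIV \<subseteq> {z. f z = 0} \<union> {z. g z = 0}" by auto
  with polyfun_finite_zeros[of f a] polyfun_finite_zeros[of g b] assms show False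
    by (metis finite_Un finite_subset infinite_UNIV_char_0)
qed

text \<open>The fundamental theorem of algebra. It is the means by which common or repeated factors
  are shown to be units: a factor without zeros on a line is constant there.\<close>

lemma polyfun_zero_free_const:
  assumes "polyfun f" "\<And>z. f z \<noteq> 0"
  shows "f z = f w"
proof -
  obtain P where P: "\<And>z. f z = poly P z" using assms(1) by (auto simp: polyfun_def)
  have "constant (poly P)"
    using fundamental_theorem_of_algebra[of P] assms(2) P by metis
  then show ?thesis by (auto simp: P constant_def)
qed

subsection \<open>Partial derivatives\<close>

lemma mpoly_eval_partial_deriv:
  "mpoly_eval (partial_deriv i p) v =
    (\<Sum>m\<in>Poly_Mapping.keys p. of_nat (Poly_Mapping.lookup m i) * Poly_Mapping.lookup p m *
       mono_eval (m - Poly_Mapping.single i 1) v)"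
  by (simp add: partial_deriv_def mpoly_eval_single)

lemma mono_eval_shift:
  fixes i :: "'v::finite"
  shows "mono_eval (m - Poly_Mapping.single i 1) v =
    v i ^ (Poly_Mapping.lookup m i - 1) * (\<Prod>j\<in>UNIV - {i}. v j ^ Poly_Mapping.lookup m j)"
  by (simp add: mono_eval_UNIV prod.remove[of UNIV i] lookup_minus lookup_single when_def)

lemma mpoly_eval_deriv:
  fixes p :: "'v::finite mpoly"
  shows "((\<lambda>z. mpoly_eval p (\<lambda>i. v i + z * w i)) has_field_derivative
      (\<Sum>i\<in>UNIV. w i * mpoly_eval (partial_deriv i p) v)) (at 0)"
proof -
  have mono: "((\<lambda>z. mono_eval m (\<lambda>i. v i + z * w i)) has_field_derivative
      (\<Sum>i\<in>UNIV. w i * (of_nat (Poly_Mapping.lookup m i) * mono_eval (m - Poly_Mapping.single i 1) v))) (at 0)" for m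
  proof -
    have "((\<lambda>z. (v i + z * w i) ^ Poly_Mapping.lookup m i) has_field_derivative
        of_nat (Poly_Mapping.lookup m i) * w i * v i ^ (Poly_Mapping.lookup m i - 1)) (at 0)" for i
      by (rule derivative_eq_intros refl)+ simp
    from has_field_derivative_prod[where A = UNIV, OF this]
    show ?thesis
      unfolding mono_eval_UNIV[of m] mono_eval_shift by (simp add: mult_ac)
  qed
  have "((\<lambda>z. \<Sum>m\<in>Poly_Mapping.keys p. Poly_Mapping.lookup p m * mono_eval m (\<lambda>i. v i + z * w i)) has_field_derivative
      (\<Sum>m\<in>Poly_Mapping.keys p. Poly_Mapping.lookup p m *
        (\<Sum>i\<in>UNIV. w i * (of_nat (Poly_Mapping.lookup m i) * mono_eval (m - Poly_Mapping.single i 1) v)))) (at 0)"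
    by (intro DERIV_sum DERIV_cmult mono)
  moreover have "(\<Sum>m\<in>Poly_Mapping.keys p. Poly_Mapping.lookup p m *
        (\<Sum>i\<in>UNIV. w i * (of_nat (Poly_Mapping.lookup m i) * mono_eval (m - Poly_Mapping.single i 1) v)))
      = (\<Sum>i\<in>UNIV. w i * mpoly_eval (partial_deriv i p) v)"
    unfolding mpoly_eval_partial_deriv sum_distrib_left
    by (subst sum.swap) (simp add: mult_ac)
  ultimately show ?thesis by (simp add: mpoly_eval_mono[of p])
qed

text \<open>Exponent subtraction in \<open>partial_deriv\<close> is truncated, so a monomial without
  the variable \<open>i\<close> is left unchanged and may collide with a genuine derivative; its
  coefficient carries the factor 0, so the formula is not affected.\<close>

lemma lookup_partial_deriv:
  "Poly_Mapping.lookup (partial_deriv i p) m =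
    of_nat (Poly_Mapping.lookup m i + 1) * Poly_Mapping.lookup p (m + Poly_Mapping.single i 1)"
proof -
  let ?e = "Poly_Mapping.single i (1::nat)"
  have eq: "(of_nat (Poly_Mapping.lookup n i) * Poly_Mapping.lookup p n when n - ?e = m)
      = (if n = m + ?e then of_nat (Poly_Mapping.lookup m i + 1) * Poly_Mapping.lookup p n else 0)" for n
  proof (cases "n = m + ?e")
    case True
    then show ?thesis by (simp add: lookup_add)
  next
    case False
    show ?thesis
    proof (cases "Poly_Mapping.lookup n i = 0")
      case False
      then have "n = (n - ?e) + ?e"
        by (intro poly_mapping_eqI) (auto simp: lookup_add lookup_minus lookup_single when_def)
      with \<open>n \<noteq> m + ?e\<close> show ?thesis by (auto simp: when_def)
    qed (use False in simp)
  qed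
  have "Poly_Mapping.lookup (partial_deriv i p) m =
    (\<Sum>n\<in>Poly_Mapping.keys p. of_nat (Poly_Mapping.lookup n i) * Poly_Mapping.lookup p n when n - ?e = m)"
    by (simp add: partial_deriv_def lookup_sum lookup_single)
  also have "\<dots> = of_nat (Poly_Mapping.lookup m i + 1) * Poly_Mapping.lookup p (m + ?e)"
    unfolding eq by (simp add: in_keys_iff)
  finally show ?thesis .
qed

text \<open>Induction on the degree of the monomial, for all polynomials at once: a function that
  vanishes identically has vanishing partial derivatives, and the coefficient of \<open>m\<close> is
  a nonzero fraction of a coefficient of lower degree in one of them. In degree 0 evaluation at the
  origin isolates the constant term.\<close>

lemma mpoly_eval_eq_0_imp:
  fixes p :: "'v::finite mpoly"
  assumes "\<And>v. mpoly_eval p v = 0"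
  shows "p = 0"
proof (rule poly_mapping_eqI)
  have "\<forall>p :: 'v mpoly. (\<forall>v. mpoly_eval p v = 0) \<longrightarrow> Poly_Mapping.lookup p m = 0" if "mono_deg m = n" for m n
    using that
  proof (induction n arbitrary: m)
    case 0
    then have m0: "m = 0"
      by (intro poly_mapping_eqI) (auto simp: mono_deg_UNIV)
    have "mono_eval k (\<lambda>_. 0) = (if k = 0 then 1 else 0)" for k :: "'v \<Rightarrow>\<^sub>0 nat"
      by (auto simp: mono_eval_UNIV poly_mapping_eq_iff fun_eq_iff)
    then have "mpoly_eval p (\<lambda>_. 0) = Poly_Mapping.lookup p 0" for p :: "'v mpoly"
      by (subst mpoly_eval_superset[where S = "insert 0 (Poly_Mapping.keys p)"])
        (auto simp: if_distrib[of "\<lambda>x. _ * x"] sum.delta cong: if_cong)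
    then show ?case by (metis m0)
  next
    case (Suc n)
    then obtain i where i: "Poly_Mapping.lookup m i > 0"
      by (metis mono_deg_UNIV nat.distinct(1) neq0_conv sum.neutral)
    define m' where "m' = m - Poly_Mapping.single i 1"
    have m: "m = m' + Poly_Mapping.single i 1"
      unfolding m'_def
      by (intro poly_mapping_eqI) (use i in \<open>auto simp: lookup_add lookup_minus lookup_single when_def\<close>)
    have "mono_deg m' = n" using Suc.prems by (simp add: m mono_deg_add del: One_nat_def)
    show ?case
    proof (intro allI impI)
      fix p :: "'v mpoly" assume p: "\<forall>v. mpoly_eval p v = 0"
      have "mpoly_eval (partial_deriv i p) v = 0" for v
      proof -
        have "((\<lambda>z. 0) has_field_derivative
          (\<Sum>j\<in>UNIV. (if j = i then 1 else 0) * mpoly_eval (partial_deriv j p) v)) (at 0)"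
          using mpoly_eval_deriv[of p v "\<lambda>j. if j = i then 1 else 0"] p by simp
        then have "(\<Sum>j\<in>UNIV. (if j = i then 1 else 0) * mpoly_eval (partial_deriv j p) v) = 0"
          by (rule DERIV_unique) auto
        then show ?thesis by (simp add: if_distrib[of "\<lambda>x. x * _"] sum.delta cong: if_cong)
      qed
      then have "Poly_Mapping.lookup (partial_deriv i p) m' = 0"
        using Suc.IH[OF \<open>mono_deg m' = n\<close>] by blast
      then show "Poly_Mapping.lookup p m = 0"
        unfolding lookup_partial_deriv m[symmetric] by (simp del: of_nat_add of_nat_Suc)
    qed
  qed
  then show "Poly_Mapping.lookup p m = Poly_Mapping.lookup 0 m" for m using assms by simp
qed

lemma mpoly_const_unit:
  fixes h :: "'v::finite mpoly"
  assumes "\<And>v. mpoly_eval h v = c" "c \<noteq> 0"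
  shows "h dvd 1"
proof -
  have "h - cst c = 0" by (rule mpoly_eval_eq_0_imp) (simp add: assms)
  then have "h * cst (1 / c) = 1" using assms by (simp add: mult_single)
  then show ?thesis by (metis dvd_triv_left)
qed

section \<open>Coordinates in four-space\<close>

text \<open>The library lists the elements of \<open>2\<close> and \<open>4\<close> as 1, 2 and 1,
  ..., 4. These types are the integers modulo 2 and 4, so the last element is the index 0 used
  here.\<close>

lemma two_eq_0: "(2::2) = 0" by simp

lemma four_eq_0: "(4::4) = 0" by simp

lemma exhaust_2': "(i::2) = 0 \<or> i = 1"
  using exhaust_2[of i] unfolding two_eq_0 by blast

lemma UNIV_2': "(UNIV::2 set) = {0, 1}"
  using exhaust_2' by blast

lemma sum_2': "sum f (UNIV::2 set) = f 0 + f 1"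
  by (simp add: UNIV_2')

lemma all_2': "(\<forall>i::2. P i) \<longleftrightarrow> P 0 \<and> P 1"
  using forall_2[of P] unfolding two_eq_0 by blast

lemma UNIV_4': "(UNIV::4 set) = {0, 1, 2, 3}"
  using UNIV_4 unfolding four_eq_0 by blast

lemma sum_4': "sum f (UNIV::4 set) = f 0 + f 1 + f 2 + f 3"
  using sum_4[of f] unfolding four_eq_0 by (simp only: ac_simps)

lemma all_4': "(\<forall>i::4. P i) \<longleftrightarrow> P 0 \<and> P 1 \<and> P 2 \<and> P 3"
  using forall_4[of P] unfolding four_eq_0 by blast

lemma vec4_eq_iff: "x = (y :: 'a ^ 4) \<longleftrightarrow> x $ 0 = y $ 0 \<and> x $ 1 = y $ 1 \<and> x $ 2 = y $ 2 \<and> x $ 3 = y $ 3"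
  unfolding vec_eq_iff all_4' ..

definition vec2 :: "complex \<Rightarrow> complex \<Rightarrow> complex ^ 2" where
  "vec2 a b = (\<chi> i. if i = 0 then a else b)"

lemma vec2_nth [simp]: "vec2 a b $ 0 = a" "vec2 a b $ 1 = b"
  by (simp_all add: vec2_def)

lemma axis2_nth [simp]: "(axis 0 1 :: complex ^ 2) $ 0 = 1" "(axis 0 1 :: complex ^ 2) $ 1 = 0"
   "(axis 1 1 :: complex ^ 2) $ 0 = 0" "(axis 1 1 :: complex ^ 2) $ 1 = 1"
  by (simp_all add: axis_def)

definition vec4 :: "'a \<Rightarrow> 'a \<Rightarrow> 'a \<Rightarrow> 'a \<Rightarrow> 'a ^ 4" where
  "vec4 a b c d = (\<chi> i. if i = 0 then a else if i = 1 then b else if i = 2 then c else d)"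

lemma vec4_nth [simp]:
  "vec4 a b c d $ 0 = a" "vec4 a b c d $ 1 = b" "vec4 a b c d $ 2 = c" "vec4 a b c d $ 3 = d"
  by (simp_all add: vec4_def)

definition det4 :: "pvec \<Rightarrow> pvec \<Rightarrow> pvec \<Rightarrow> pvec \<Rightarrow> complex" where
  "det4 a b c d = det (vec4 a b c d)"

text \<open>Laplace expansion along the first two rows. Each summand is a product of two 2 by 2
  minors, which later makes the homogeneity of degree 4 immediate.\<close>

lemma det_4:
  "det (A::'a::comm_ring_1^4^4) =
    (A$0$0 * A$1$1 - A$0$1 * A$1$0) * (A$2$2 * A$3$3 - A$2$3 * A$3$2)
  - (A$0$0 * A$1$2 - A$0$2 * A$1$0) * (A$2$1 * A$3$3 - A$2$3 * A$3$1)
  + (A$0$0 * A$1$3 - A$0$3 * A$1$0) * (A$2$1 * A$3$2 - A$2$2 * A$3$1)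
  + (A$0$1 * A$1$2 - A$0$2 * A$1$1) * (A$2$0 * A$3$3 - A$2$3 * A$3$0)
  - (A$0$1 * A$1$3 - A$0$3 * A$1$1) * (A$2$0 * A$3$2 - A$2$2 * A$3$0)
  + (A$0$2 * A$1$3 - A$0$3 * A$1$2) * (A$2$0 * A$3$1 - A$2$1 * A$3$0)"
proof -
  have f1: "finite {1::4, 2, 3}" "0 \<notin> {1::4, 2, 3}" and f2: "finite {2::4, 3}" "1 \<notin> {2::4, 3}"
    and f3: "finite {3::4}" "2 \<notin> {3::4}"
    by auto
  show ?thesis
    unfolding det_def UNIV_4'
    unfolding sum_over_permutations_insert[OF f1]
    unfolding sum_over_permutations_insert[OF f2]
    unfolding sum_over_permutations_insert[OF f3]
    unfolding permutes_sing
    by (simp add: sign_swap_id permutation_swap_id sign_compose sign_id swap_id_eq permutation_compose transpose_def algebra_simps)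
qed

lemmas det4_expand = det4_def[unfolded det_4 vec4_nth]

lemma det4_combination:
  "det4 (a0 *s w + a1 *s x + a2 *s y + a3 *s z) (b0 *s w + b1 *s x + b2 *s y + b3 *s z)
        (c0 *s w + c1 *s x + c2 *s y + c3 *s z) (d0 *s w + d1 *s x + d2 *s y + d3 *s z) =
   det4 (vec4 a0 a1 a2 a3) (vec4 b0 b1 b2 b3) (vec4 c0 c1 c2 c3) (vec4 d0 d1 d2 d3) * det4 w x y z"
proof -
  have "vec4 (a0 *s w + a1 *s x + a2 *s y + a3 *s z) (b0 *s w + b1 *s x + b2 *s y + b3 *s z)
        (c0 *s w + c1 *s x + c2 *s y + c3 *s z) (d0 *s w + d1 *s x + d2 *s y + d3 *s z)
     = vec4 (vec4 a0 a1 a2 a3) (vec4 b0 b1 b2 b3) (vec4 c0 c1 c2 c3) (vec4 d0 d1 d2 d3) ** vec4 w x y z"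
    by (simp add: vec4_eq_iff matrix_matrix_mult_def sum_4')
  then show ?thesis by (simp add: det4_def det_mul)
qed

text \<open>The vector \<open>w\<close> is the equation of a plane that contains all four
  points.\<close>

lemma det4_left_kernel:
  assumes "\<And>x. x \<in> {a, b, c, d} \<Longrightarrow> (\<Sum>l\<in>UNIV. w $ l * x $ l) = 0" "w \<noteq> 0"
  shows "det4 a b c d = 0"
proof (rule ccontr)
  assume "det4 a b c d \<noteq> 0"
  then obtain B where "B ** vec4 a b c d = mat 1"
    using invertible_left_inverse invertible_det_nz unfolding det4_def by blast
  moreover have "vec4 a b c d *v w = 0"
    using assms(1) by (simp add: vec4_eq_iff matrix_vector_mult_def mult.commute)
  ultimately show False using assms(2) matrix_left_invertible_ker by blast
qed

lemma det4_eq_0_imp_relation: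
  assumes "det4 a b c d = 0"
  shows "\<exists>r0 r1 r2 r3. r0 *s a + r1 *s b + r2 *s c + r3 *s d = 0 \<and> \<not> (r0 = 0 \<and> r1 = 0 \<and> r2 = 0 \<and> r3 = 0)"
proof -
  have "\<not> invertible (transpose (vec4 a b c d))"
    using assms invertible_det_nz[of "transpose (vec4 a b c d)"] by (simp add: det4_def)
  then obtain r where r: "transpose (vec4 a b c d) *v r = 0" "r \<noteq> 0"
    using invertible_left_inverse matrix_left_invertible_ker by blast
  have "r $ 0 *s a + r $ 1 *s b + r $ 2 *s c + r $ 3 *s d = 0"
    using r(1) by (simp add: vec4_eq_iff matrix_vector_mult_def transpose_def sum_4' mult.commute)
  then show ?thesis using r(2) by (metis vec4_eq_iff zero_index)
qed

lemma det4_relation_imp_0: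
  assumes "r0 *s a + r1 *s b + r2 *s c + r3 *s d = 0" "\<not> (r0 = 0 \<and> r1 = 0 \<and> r2 = 0 \<and> r3 = 0)"
  shows "det4 a b c d = 0"
proof (rule ccontr)
  assume "det4 a b c d \<noteq> 0"
  then have "invertible (transpose (vec4 a b c d))"
    by (simp add: det4_def invertible_det_nz)
  moreover have "transpose (vec4 a b c d) *v vec4 r0 r1 r2 r3 = 0"
    using assms(1) by (simp add: vec4_eq_iff matrix_vector_mult_def transpose_def sum_4' mult.commute)
  ultimately have "vec4 r0 r1 r2 r3 = 0"
    using invertible_left_inverse matrix_left_invertible_ker by blast
  then show False using assms(2) by (simp add: vec4_eq_iff)
qed

lemma det4_coordinates:
  assumes "det4 e0 e1 e2 e3 \<noteq> 0"
  obtains M :: "complex ^ 4 ^ 4" where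
    "\<And>x. x = (M *v x) $ 0 *s e0 + (M *v x) $ 1 *s e1 + (M *v x) $ 2 *s e2 + (M *v x) $ 3 *s e3"
    "\<And>a b c d. M *v (a *s e0 + b *s e1 + c *s e2 + d *s e3) = vec4 a b c d"
proof -
  let ?E = "transpose (vec4 e0 e1 e2 e3)"
  have E: "?E *v v = v $ 0 *s e0 + v $ 1 *s e1 + v $ 2 *s e2 + v $ 3 *s e3" for v
    by (simp add: vec4_eq_iff matrix_vector_mult_def transpose_def sum_4' mult.commute)
  have "invertible ?E" using assms by (simp add: det4_def invertible_det_nz)
  then obtain M where M: "?E ** M = mat 1" "M ** ?E = mat 1"
    by (auto simp: invertible_def)
  show thesis
  proof (rule that)
    show "x = (M *v x) $ 0 *s e0 + (M *v x) $ 1 *s e1 + (M *v x) $ 2 *s e2 + (M *v x) $ 3 *s e3" for x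
      by (simp only: E[symmetric] matrix_vector_mul_assoc M matrix_vector_mul_lid)
    show "M *v (a *s e0 + b *s e1 + c *s e2 + d *s e3) = vec4 a b c d" for a b c d
    proof -
      have "M *v (?E *v vec4 a b c d) = vec4 a b c d"
        by (simp only: matrix_vector_mul_assoc M matrix_vector_mul_lid)
      then show ?thesis by (simp only: E vec4_nth)
    qed
  qed
qed

lemma det4_expansion:
  assumes "det4 e0 e1 e2 e3 \<noteq> 0"
  obtains a b c d where "x = a *s e0 + b *s e1 + c *s e2 + d *s e3"
proof (rule det4_coordinates[OF assms])
  fix M :: "complex ^ 4 ^ 4"
  assume M: "\<And>x. x = (M *v x) $ 0 *s e0 + (M *v x) $ 1 *s e1 + (M *v x) $ 2 *s e2 + (M *v x) $ 3 *s e3"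
  show thesis by (rule that[OF M[of x]])
qed

section \<open>Lines, surfaces and closures\<close>

lemma line_through_iff: "x \<in> line_through p q \<longleftrightarrow> x \<noteq> 0 \<and> (\<exists>a b. x = a *s p + b *s q)"
  by (auto simp: line_through_def vec.span_insert vec.span_singleton algebra_simps)

lemma proj_point_iff: "x \<in> proj_point p \<longleftrightarrow> x \<noteq> 0 \<and> (\<exists>a. x = a *s p)"
  by (auto simp: proj_point_def vec.span_singleton)

lemma is_line_line_through:
  assumes "\<And>a b. a *s p + b *s q = 0 \<Longrightarrow> a = 0 \<and> b = 0"
  shows "is_line (line_through p q)"
proof -
  have "p \<noteq> q" using assms[of 1 "-1"] by auto
  have "q \<noteq> 0" using assms[of 0 1] by auto
  have "vec.independent {p, q}"
  proof -
    have "p \<notin> vec.span {q}"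
      using assms[of 1 "- k" for k] by (auto simp: vec.span_singleton)
    then show ?thesis using \<open>p \<noteq> q\<close> \<open>q \<noteq> 0\<close> by (simp add: vec.independent_insert)
  qed
  then have "vec.dim (vec.span {p, q}) = 2"
    using \<open>p \<noteq> q\<close> by (simp add: vec.dim_eq_card_independent)
  then show ?thesis
    unfolding is_line_def line_through_def by (intro exI[of _ "vec.span {p, q}"]) auto
qed

lemma is_line_eq_line_through:
  assumes "is_line L" "p \<in> L" "q \<in> L" "\<And>a b. a *s p + b *s q = 0 \<Longrightarrow> a = 0 \<and> b = 0"
  shows "L = line_through p q"
proof -
  obtain W where W: "vec.subspace W" "vec.dim W = 2" "L = W - {0}"
    using assms(1) by (auto simp: is_line_def)
  have "p \<noteq> q" using assms(4)[of 1 "-1"] by auto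
  have "q \<noteq> 0" using assms(4)[of 0 1] by auto
  have ind: "vec.independent {p, q}"
  proof -
    have "p \<notin> vec.span {q}"
      using assms(4)[of 1 "- k" for k] by (auto simp: vec.span_singleton)
    then show ?thesis using \<open>p \<noteq> q\<close> \<open>q \<noteq> 0\<close> by (simp add: vec.independent_insert)
  qed
  have "{p, q} \<subseteq> W" using assms W by auto
  then have "W \<subseteq> vec.span {p, q}"
    by (rule vec.card_ge_dim_independent) (use ind W \<open>p \<noteq> q\<close> in auto)
  moreover have "vec.span {p, q} \<subseteq> W"
    using \<open>{p, q} \<subseteq> W\<close> W(1) by (rule vec.span_minimal)
  ultimately show ?thesis by (auto simp: line_through_def W(3))
qed

lemma mpoly_eval_line_deriv:
  "((\<lambda>z. mpoly_eval F (($) (x + z *s y))) has_field_derivative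
     (\<Sum>i\<in>UNIV. y $ i * mpoly_eval (partial_deriv i F) (($) x))) (at 0)"
  for x y :: "complex ^ 'n::finite"
proof -
  have "($) (x + z *s y) = (\<lambda>i. x $ i + z * y $ i)" for z
    by (simp add: fun_eq_iff)
  then show ?thesis using mpoly_eval_deriv[of F "($) x" "($) y"] by simp
qed

lemma polyfun_line [intro]: "polyfun (\<lambda>z. mpoly_eval F (($) (x + z *s y)))"
  by (rule polyfun_mpoly_eval) (simp, intro polyfun_add polyfun_mult polyfun_const polyfun_id)

text \<open>If \<open>h\<^sup>2\<close> divides \<open>F\<close>, then \<open>F\<close> is singular at the zeros of \<open>h\<close>, so \<open>h\<close> has no zeros outside the
  origin and hence is constant on every line that misses the origin.\<close>

lemma smooth_imp_squarefree:
  fixes F :: "4 mpoly"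
  assumes "\<And>x. x \<noteq> 0 \<Longrightarrow> mpoly_eval F (($) x) = 0 \<Longrightarrow>
     \<exists>i. mpoly_eval (partial_deriv i F) (($) x) \<noteq> 0"
  shows "squarefree F"
  unfolding squarefree_def
proof (intro allI impI)
  fix h assume "h\<^sup>2 dvd F"
  then obtain k where F: "F = h\<^sup>2 * k" by (auto elim: dvdE)
  define H where "H x = mpoly_eval h (($) x)" for x :: pvec
  have nz: "H x \<noteq> 0" if "x \<noteq> 0" for x
  proof
    assume "H x = 0"
    then have "mpoly_eval F (($) x) = 0" by (simp add: F H_def)
    from assms[OF that this] obtain i where i: "mpoly_eval (partial_deriv i F) (($) x) \<noteq> 0" ..
    let ?y = "axis i 1 :: pvec"
    define D where "D = (\<Sum>j\<in>UNIV. ?y $ j * mpoly_eval (partial_deriv j h) (($) x))"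
    have D: "((\<lambda>z. H (x + z *s ?y)) has_field_derivative D) (at 0)"
      unfolding H_def D_def by (rule mpoly_eval_line_deriv)
    have "((\<lambda>z. H (x + z *s ?y) * H (x + z *s ?y) * mpoly_eval k (($) (x + z *s ?y))) has_field_derivative 0) (at 0)"
      by (rule derivative_eq_intros D mpoly_eval_line_deriv refl)+ (simp add: \<open>H x = 0\<close>)
    also have "(\<lambda>z. H (x + z *s ?y) * H (x + z *s ?y) * mpoly_eval k (($) (x + z *s ?y)))
        = (\<lambda>z. mpoly_eval F (($) (x + z *s ?y)))"
      by (simp add: F H_def power2_eq_square)
    finally have "(\<Sum>j\<in>UNIV. ?y $ j * mpoly_eval (partial_deriv j F) (($) x)) = 0"
      by (rule DERIV_unique[OF mpoly_eval_line_deriv])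
    moreover have "(\<Sum>j\<in>UNIV. ?y $ j * mpoly_eval (partial_deriv j F) (($) x))
        = mpoly_eval (partial_deriv i F) (($) x)"
      by (simp add: axis_def if_distrib[of "\<lambda>x. x * _"] cong: if_cong)
    ultimately show False using i by simp
  qed
  have line: "H x = H y" if "\<And>z. x + z *s (y - x) \<noteq> 0" for x y
  proof -
    have "polyfun (\<lambda>z. H (x + z *s (y - x)))" unfolding H_def by (rule polyfun_line)
    from polyfun_zero_free_const[OF this, of 0 1] nz[OF that] show ?thesis by simp
  qed
  let ?e0 = "axis 0 1 :: pvec" and ?e1 = "axis 1 1 :: pvec"
  \<comment> \<open>The line through two linearly independent vectors misses the origin. Vectors
    proportional to the first axis are compared with the second axis instead.\<close>
  have indep: "H x = H y" if "x $ i * y $ j \<noteq> x $ j * y $ i" for x y i j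
  proof (rule line)
    fix z
    show "x + z *s (y - x) \<noteq> 0"
    proof
      assume *: "x + z *s (y - x) = 0"
      have "(1 - z) * x $ l = - z * y $ l" for l
        using arg_cong[OF *, of "\<lambda>v. v $ l"] by (simp add: algebra_simps)
      from this[of i] this[of j] that show False by algebra
    qed
  qed
  have e01: "H ?e0 = H ?e1" by (rule indep[of _ 0 _ 1]) (simp add: axis_def)
  have "H x = H ?e0" if "x \<noteq> 0" for x
  proof (cases "\<exists>i. i \<noteq> 0 \<and> x $ i \<noteq> 0")
    case True
    then obtain i where "i \<noteq> 0" "x $ i \<noteq> 0" by auto
    then show ?thesis by (intro indep[of _ i _ 0]) (simp add: axis_def)
  next
    case False
    then have "x $ 0 \<noteq> 0" using that by (metis vec_eq_iff zero_index)
    then have "H x = H ?e1" by (intro indep[of _ 0 _ 1]) (simp add: axis_def)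
    then show ?thesis using e01 by simp
  qed
  note nonzero_const = this
  have "H 0 = H ?e0"
  proof -
    have "polyfun (\<lambda>z. mpoly_eval h (($) (0 + z *s ?e0)) - H ?e0)"
      by (rule polyfun_minus[OF polyfun_line polyfun_const])
    then have "mpoly_eval h (($) (0 + 0 *s ?e0)) - H ?e0 = 0"
    proof (rule polyfun_continuous[rotated])
      fix z :: complex assume "z \<noteq> 0"
      then have "z *s ?e0 \<noteq> 0" by (auto simp: vec_eq_iff axis_def)
      then show "mpoly_eval h (($) (0 + z *s ?e0)) - H ?e0 = 0"
        using nonzero_const[of "z *s ?e0"] by (simp add: H_def)
    qed
    then show ?thesis by (simp add: H_def)
  qed
  then have const: "H x = H ?e0" for x
    using nonzero_const[of x] by (cases "x = 0") simp_all
  have "mpoly_eval h v = H ?e0" for v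
  proof -
    have "(($) (\<chi> i. v i)) = v" by (simp add: fun_eq_iff)
    then show ?thesis using const[of "\<chi> i. v i"] unfolding H_def by simp
  qed
  moreover have "H ?e0 \<noteq> 0" by (rule nz) (simp add: axis_eq_0_iff)
  ultimately show "h dvd 1" by (rule mpoly_const_unit)
qed

text \<open>Smoothness is tested by one nonzero directional derivative, so equations written in
  other linear coordinates need no partial derivatives in the standard ones.\<close>

lemma smooth_zero_locus:
  assumes "homogeneous d F" "d > 0"
    and smooth: "\<And>x. x \<noteq> 0 \<Longrightarrow> mpoly_eval F (($) x) = 0 \<Longrightarrow>
      \<exists>y D. ((\<lambda>z. mpoly_eval F (($) (x + z *s y))) has_field_derivative D) (at 0) \<and> D \<noteq> 0"
  shows "smooth_surface (zero_locus F)" "surface_of_degree d (zero_locus F)"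
proof -
  have *: "\<exists>i. mpoly_eval (partial_deriv i F) (($) x) \<noteq> 0"
    if x: "x \<noteq> 0" "mpoly_eval F (($) x) = 0" for x
  proof (rule ccontr)
    assume "\<not> ?thesis"
    then have 0: "(\<Sum>i\<in>UNIV. y $ i * mpoly_eval (partial_deriv i F) (($) x)) = 0" for y :: pvec
      by simp
    obtain y D where D: "((\<lambda>z. mpoly_eval F (($) (x + z *s y))) has_field_derivative D) (at 0)" "D \<noteq> 0"
      using smooth[OF x] by (elim exE conjE)
    show False using DERIV_unique[OF D(1) mpoly_eval_line_deriv] D(2) 0 by simp
  qed
  have "squarefree F" using * by (rule smooth_imp_squarefree)
  with assms * show "smooth_surface (zero_locus F)" "surface_of_degree d (zero_locus F)"
    unfolding smooth_surface_def surface_of_degree_def zero_locus_def by blast+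
qed

text \<open>A polynomial vanishing on a punctured line also vanishes at the removed point. The
  choice \<open>y = 0\<close> covers the points already in \<open>X\<close>.\<close>

lemma zariski_closure_eq_zero_locus:
  assumes "homogeneous d F" "X \<subseteq> zero_locus F"
    and dense: "\<And>x. x \<in> zero_locus F \<Longrightarrow> \<exists>y. \<forall>z. z \<noteq> 0 \<longrightarrow> x + z *s y \<in> X"
  shows "zariski_closure X = zero_locus F"
proof
  show "zariski_closure X \<subseteq> zero_locus F"
    using assms(1,2) by (auto simp: zariski_closure_def)
  show "zero_locus F \<subseteq> zariski_closure X"
  proof
    fix x assume x: "x \<in> zero_locus F"
    then obtain y where y: "\<And>z. z \<noteq> 0 \<Longrightarrow> x + z *s y \<in> X" using dense by blast
    have "mpoly_eval G (($) (x + 0 *s y)) = 0" if "X \<subseteq> zero_locus G" for G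
      by (rule polyfun_continuous[OF _ polyfun_line]) (use y that in \<open>auto simp: zero_locus_def\<close>)
    then show "x \<in> zariski_closure X"
      using x by (auto simp: zariski_closure_def zero_locus_def)
  qed
qed

section \<open>Quadrics and planes in adapted linear coordinates\<close>

definition lin :: "pvec \<Rightarrow> 4 mpoly" where
  "lin w = (\<Sum>l\<in>UNIV. cst (w $ l) * var l)"

lemma mpoly_eval_lin: "mpoly_eval (lin w) v = (\<Sum>l\<in>UNIV. w $ l * v l)"
  by (simp add: lin_def)

lemma homogeneous_lin: "homogeneous 1 (lin w)"
  unfolding lin_def by (intro homogeneous_sum homogeneous_cst_mult homogeneous_var)

text \<open>\<open>M\<close> is the inverse of the matrix with columns \<open>f0\<close>,
  \<open>f1\<close>, \<open>g0\<close>, \<open>g1\<close>. The digit in the names of the coordinates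
  belongs to one of the two eigenvectors of K, so that \<open>X0\<close>, \<open>Z0\<close> are
  coordinates on one transversal and \<open>X1\<close>, \<open>Z1\<close> on the other.\<close>

locale coords =
  fixes M :: "complex ^ 4 ^ 4" and f0 f1 g0 g1 :: pvec
  assumes expand: "x = (M *v x) $ 0 *s f0 + (M *v x) $ 1 *s f1 + (M *v x) $ 2 *s g0 + (M *v x) $ 3 *s g1"
    and coord: "M *v (a *s f0 + b *s f1 + c *s g0 + d *s g1) = vec4 a b c d"
begin

definition "X0 x = (M *v x) $ 0"
definition "X1 x = (M *v x) $ 1"
definition "Z0 x = (M *v x) $ 2"
definition "Z1 x = (M *v x) $ 3"

definition mk :: "complex \<Rightarrow> complex \<Rightarrow> complex \<Rightarrow> complex \<Rightarrow> pvec" where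
  "mk a b c d = a *s f0 + b *s f1 + c *s g0 + d *s g1"

lemmas coord_defs = X0_def X1_def Z0_def Z1_def

lemma coord_mk [simp]: "X0 (mk a b c d) = a" "X1 (mk a b c d) = b" "Z0 (mk a b c d) = c" "Z1 (mk a b c d) = d"
  unfolding coord_defs mk_def coord by simp_all

lemma coord_lin [simp]:
  "X0 (x + y) = X0 x + X0 y" "X1 (x + y) = X1 x + X1 y" "Z0 (x + y) = Z0 x + Z0 y" "Z1 (x + y) = Z1 x + Z1 y"
  "X0 (k *s x) = k * X0 x" "X1 (k *s x) = k * X1 x" "Z0 (k *s x) = k * Z0 x" "Z1 (k *s x) = k * Z1 x"
  "X0 0 = 0" "X1 0 = 0" "Z0 0 = 0" "Z1 0 = 0"
  unfolding coord_defs by (simp_all add: matrix_vector_right_distrib vector_scalar_commute)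

lemma mk_coord: "mk (X0 x) (X1 x) (Z0 x) (Z1 x) = x"
  unfolding mk_def coord_defs by (rule expand[symmetric])

lemma coord_eq_iff: "x = y \<longleftrightarrow> X0 x = X0 y \<and> X1 x = X1 y \<and> Z0 x = Z0 y \<and> Z1 x = Z1 y"
  by (metis mk_coord)

lemma eval_coord [simp]:
  "mpoly_eval (lin (M $ 0)) (($) x) = X0 x" "mpoly_eval (lin (M $ 1)) (($) x) = X1 x"
  "mpoly_eval (lin (M $ 2)) (($) x) = Z0 x" "mpoly_eval (lin (M $ 3)) (($) x) = Z1 x"
  by (simp_all add: mpoly_eval_lin coord_defs matrix_vector_mult_def)

text \<open>These are the quadratic forms vanishing on the lines \<open>X1 = Z1 = 0\<close>,
  \<open>X0 = Z0 = 0\<close> and \<open>X0 = X1 = 0\<close>: the first two lines leave only products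
  of mixed index, and the third one excludes \<open>Z0 * Z1\<close>.\<close>

definition quad_mpoly :: "complex \<Rightarrow> complex \<Rightarrow> complex \<Rightarrow> 4 mpoly" where
  "quad_mpoly a b c = cst a * (lin (M $ 0) * lin (M $ 3)) + cst b * (lin (M $ 1) * lin (M $ 2))
     + cst c * (lin (M $ 0) * lin (M $ 1))"

definition quad :: "complex \<Rightarrow> complex \<Rightarrow> complex \<Rightarrow> pvec set" where
  "quad a b c = {x. x \<noteq> 0 \<and> a * (X0 x * Z1 x) + b * (X1 x * Z0 x) + c * (X0 x * X1 x) = 0}"

definition plane_mpoly :: "complex \<Rightarrow> complex \<Rightarrow> 4 mpoly" where
  "plane_mpoly a b = cst a * lin (M $ 0) + cst b * lin (M $ 1)"

definition plane :: "complex \<Rightarrow> complex \<Rightarrow> pvec set" where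
  "plane a b = {x. x \<noteq> 0 \<and> a * X0 x + b * X1 x = 0}"

lemma zero_locus_quad: "zero_locus (quad_mpoly a b c) = quad a b c"
  by (simp add: zero_locus_def quad_def quad_mpoly_def)

lemma zero_locus_plane: "zero_locus (plane_mpoly a b) = plane a b"
  by (simp add: zero_locus_def plane_def plane_mpoly_def)

lemma homogeneous_quad: "homogeneous 2 (quad_mpoly a b c)"
proof -
  have "homogeneous 2 (lin v * lin w)" for v w
    using homogeneous_mult[OF homogeneous_lin homogeneous_lin] by (simp add: numeral_2_eq_2)
  then show ?thesis
    unfolding quad_mpoly_def by (intro homogeneous_add homogeneous_cst_mult)
qed

lemma homogeneous_plane: "homogeneous 1 (plane_mpoly a b)"
  unfolding plane_mpoly_def by (intro homogeneous_add homogeneous_cst_mult homogeneous_lin)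

lemma smooth_quad:
  assumes "a \<noteq> 0" "b \<noteq> 0"
  shows "smooth_surface (quad a b c)" "is_quadric (quad a b c)"
proof -
  have "\<exists>y D. ((\<lambda>z. mpoly_eval (quad_mpoly a b c) (($) (x + z *s y))) has_field_derivative D) (at 0) \<and> D \<noteq> 0"
    if "x \<noteq> 0" for x
  proof -
    \<comment> \<open>The polar form of the quadric at \<open>x\<close>. Evaluating it on the four
      basis vectors shows that it vanishes identically only for \<open>x = 0\<close>.\<close>
    define D where "D y = a * (X0 x * Z1 y + X0 y * Z1 x) + b * (X1 x * Z0 y + X1 y * Z0 x)
        + c * (X0 x * X1 y + X0 y * X1 x)" for y
    have D: "((\<lambda>z. mpoly_eval (quad_mpoly a b c) (($) (x + z *s y))) has_field_derivative D y) (at 0)" for y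
    proof -
      have "((\<lambda>z. a * ((X0 x + z * X0 y) * (Z1 x + z * Z1 y)) + b * ((X1 x + z * X1 y) * (Z0 x + z * Z0 y))
        + c * ((X0 x + z * X0 y) * (X1 x + z * X1 y))) has_field_derivative D y) (at 0)"
        unfolding D_def by (rule derivative_eq_intros refl)+ (simp add: algebra_simps)
      then show ?thesis by (simp add: quad_mpoly_def)
    qed
    have "\<exists>y. D y \<noteq> 0"
    proof (rule ccontr)
      assume "\<not> ?thesis"
      then have 0: "D y = 0" for y by blast
      have "X0 x = 0" "X1 x = 0" "Z0 x = 0" "Z1 x = 0"
        using 0[of "mk 0 0 0 1"] 0[of "mk 0 0 1 0"] 0[of "mk 0 1 0 0"] 0[of "mk 1 0 0 0"] assms
        by (auto simp: D_def)
      then show False using that coord_eq_iff[of x 0] by simp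
    qed
    then show ?thesis using D by blast
  qed
  from smooth_zero_locus[OF homogeneous_quad _ this]
  show "smooth_surface (quad a b c)" "is_quadric (quad a b c)"
    by (simp_all add: zero_locus_quad)
qed

lemma smooth_plane:
  assumes "a \<noteq> 0 \<or> b \<noteq> 0"
  shows "smooth_surface (plane a b)" "is_plane (plane a b)"
proof -
  have "\<exists>y D. ((\<lambda>z. mpoly_eval (plane_mpoly a b) (($) (x + z *s y))) has_field_derivative D) (at 0) \<and> D \<noteq> 0" for x
  proof -
    have D: "((\<lambda>z. mpoly_eval (plane_mpoly a b) (($) (x + z *s y))) has_field_derivative a * X0 y + b * X1 y) (at 0)" for y
    proof -
      have "((\<lambda>z. a * (X0 x + z * X0 y) + b * (X1 x + z * X1 y)) has_field_derivative a * X0 y + b * X1 y) (at 0)"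
        by (rule derivative_eq_intros refl)+ simp
      then show ?thesis by (simp add: plane_mpoly_def)
    qed
    show ?thesis
      using D[of "mk 1 0 0 0"] D[of "mk 0 1 0 0"] assms by auto
  qed
  from smooth_zero_locus[OF homogeneous_plane _ this]
  show "smooth_surface (plane a b)" "is_plane (plane a b)"
    by (simp_all add: zero_locus_plane)
qed

lemma closure_quad: "zariski_closure (quad a b c) = quad a b c"
  using zariski_closure_eq_zero_locus[OF homogeneous_quad, of "quad a b c" a b c]
  by (simp add: zero_locus_quad) (metis add.right_neutral vector_smult_rzero)

text \<open>For each index, \<open>(X, Z)\<close> is an invertible matrix applied to a multiple of
  \<open>(u, v)\<close>. Undoing both matrices gives two pairs \<open>(p0, q0)\<close> and
  \<open>(p1, q1)\<close>, and the condition becomes their proportionality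
  \<open>p0 * q1 = p1 * q0\<close>. Every solution is attained, also when one pair is zero, so the
  image of this parameterization is already closed.\<close>

lemma segre_image:
  assumes "a0 * d0 - b0 * c0 \<noteq> 0" "a1 * d1 - b1 * c1 \<noteq> 0"
  shows "(\<exists>s0 s1 u v. x = mk (s0 * (a0 * u + b0 * v)) (s1 * (a1 * u + b1 * v))
            (s0 * (c0 * u + d0 * v)) (s1 * (c1 * u + d1 * v))) \<longleftrightarrow>
     (d0 * X0 x - b0 * Z0 x) * (a1 * Z1 x - c1 * X1 x) = (d1 * X1 x - b1 * Z1 x) * (a0 * Z0 x - c0 * X0 x)"
    (is "?L \<longleftrightarrow> ?R")
proof
  assume ?L
  then show ?R by (elim exE) (simp add: algebra_simps)
next
  assume R: ?R
  define p0 q0 where "p0 = (d0 * X0 x - b0 * Z0 x) / (a0 * d0 - b0 * c0)" and "q0 = (a0 * Z0 x - c0 * X0 x) / (a0 * d0 - b0 * c0)"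
  define p1 q1 where "p1 = (d1 * X1 x - b1 * Z1 x) / (a1 * d1 - b1 * c1)" and "q1 = (a1 * Z1 x - c1 * X1 x) / (a1 * d1 - b1 * c1)"
  have pq: "p0 * q1 = p1 * q0"
    using R by (simp add: p0_def q0_def p1_def q1_def mult.commute)
  have X: "X0 x = a0 * p0 + b0 * q0" "Z0 x = c0 * p0 + d0 * q0" "X1 x = a1 * p1 + b1 * q1" "Z1 x = c1 * p1 + d1 * q1"
    using assms by (simp_all add: p0_def q0_def p1_def q1_def divide_simps) (simp_all add: algebra_simps)
  have "\<exists>s0 s1 u v. p0 = s0 * u \<and> q0 = s0 * v \<and> p1 = s1 * u \<and> q1 = s1 * v"
  proof (cases "p0 = 0 \<and> q0 = 0")
    case True
    then show ?thesis by (intro exI[of _ 0] exI[of _ 1] exI[of _ p1] exI[of _ q1]) simp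
  next
    case False
    define k where "k = (if p0 \<noteq> 0 then p1 / p0 else q1 / q0)"
    have "p1 = k * p0" "q1 = k * q0"
      using False pq by (auto simp: k_def field_simps)
    then show ?thesis by (intro exI[of _ 1] exI[of _ k] exI[of _ p0] exI[of _ q0]) simp
  qed
  then obtain s0 s1 u v where "p0 = s0 * u" "q0 = s0 * v" "p1 = s1 * u" "q1 = s1 * v" by blast
  then have "x = mk (s0 * (a0 * u + b0 * v)) (s1 * (a1 * u + b1 * v))
            (s0 * (c0 * u + d0 * v)) (s1 * (c1 * u + d1 * v))"
    by (simp add: coord_eq_iff X algebra_simps)
  then show ?L by blast
qed

end

section \<open>The normal form of a general map of type (1,2,2)\<close>

text \<open>The linear forms \<open>S0\<close> and \<open>S1\<close> vanish at the two parameters \<open>s\<close> whose planes contain the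
  transversals \<open>r\<^sub>1\<close> and \<open>r\<^sub>0\<close>, which are spanned by \<open>f1, g1\<close> and by \<open>f0, g0\<close>. The base point
  common to all \<open>s\<close> is \<open>T0 = T1\<close>, \<open>U0 = U1\<close>.\<close>

locale normal_form = coords M f0 f1 g0 g1 for M f0 f1 g0 g1 +
  fixes c :: trilinear and \<tau>0 \<tau>1 \<upsilon>0 \<upsilon>1 \<sigma>00 \<sigma>01 \<sigma>10 \<sigma>11 h g \<kappa>0 \<kappa>1 :: complex
  assumes tri: "tri_eval c s t u =
      (let S0 = s $ 0 * \<sigma>00 + s $ 1 * \<sigma>10; S1 = s $ 0 * \<sigma>01 + s $ 1 * \<sigma>11;
           T0 = t $ 0 * \<tau>0; T1 = t $ 1 * \<tau>1; U0 = u $ 0 * \<upsilon>0; U1 = u $ 1 * \<upsilon>1;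
           H = T0 * (h * U0 + (1 - h) * U1) + T1 * (g * U0 - (1 + g) * U1)
       in mk (S0 * H) (S1 * H) (S0 * ((U0 - U1) * (T0 + \<kappa>0 * T1))) (S1 * ((U0 - U1) * (T0 + \<kappa>1 * T1))))"
    and base_nz: "\<tau>0 \<noteq> 0" "\<tau>1 \<noteq> 0" "\<upsilon>0 \<noteq> 0" "\<upsilon>1 \<noteq> 0"
    and \<sigma>_nz: "\<sigma>00 \<noteq> 0" "\<sigma>01 \<noteq> 0" "\<sigma>10 \<noteq> 0" "\<sigma>11 \<noteq> 0" "\<sigma>00 * \<sigma>11 - \<sigma>01 * \<sigma>10 \<noteq> 0"
    and \<kappa>_nz: "\<kappa>0 \<noteq> 0" "\<kappa>1 \<noteq> 0" "\<kappa>0 \<noteq> \<kappa>1"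
    and h_nz: "h \<noteq> 0" "h \<noteq> 1" "g \<noteq> 0" "1 + g \<noteq> 0" "h + g \<noteq> 0"
    and Y_nz: "\<kappa>0 * h - g \<noteq> 0" "\<kappa>1 * h - g \<noteq> 0" "\<kappa>0 * (1 - h) + 1 + g \<noteq> 0" "\<kappa>1 * (1 - h) + 1 + g \<noteq> 0"
    and cross: "g * (1 + g) + h * (1 - h) * \<kappa>0 * \<kappa>1 \<noteq> 0"
begin

lemma \<sigma>_surj: "\<exists>s :: complex ^ 2. s $ 0 * \<sigma>00 + s $ 1 * \<sigma>10 = S0 \<and> s $ 0 * \<sigma>01 + s $ 1 * \<sigma>11 = S1"
  using \<sigma>_nz(5)
  by (intro exI[of _ "vec2 ((S0 * \<sigma>11 - S1 * \<sigma>10) / (\<sigma>00 * \<sigma>11 - \<sigma>01 * \<sigma>10))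
      ((S1 * \<sigma>00 - S0 * \<sigma>01) / (\<sigma>00 * \<sigma>11 - \<sigma>01 * \<sigma>10))"])
    (simp add: divide_simps, simp add: algebra_simps)

lemma weight_surj:
  assumes "\<omega>0 \<noteq> 0" "\<omega>1 \<noteq> 0"
  shows "\<exists>u :: complex ^ 2. u $ 0 * \<omega>0 = U0 \<and> u $ 1 * \<omega>1 = U1"
  by (rule exI[of _ "vec2 (U0 / \<omega>0) (U1 / \<omega>1)"]) (simp add: assms)

text \<open>The forms in \<open>s\<close> and the scaled coordinates of \<open>u\<close> take
  arbitrary values, so this is \<open>segre_image\<close> after a change of parameters. The factor
  \<open>k\<close> is the weight of the parameter that has been fixed, and is absorbed into the
  forms in \<open>s\<close>.\<close>

lemma bilinear_image:
  assumes \<phi>: "\<And>s u. \<phi> s u =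
      mk (k * (s $ 0 * \<sigma>00 + s $ 1 * \<sigma>10) * (a0 * (u $ 0 * \<omega>0) + b0 * (u $ 1 * \<omega>1)))
         (k * (s $ 0 * \<sigma>01 + s $ 1 * \<sigma>11) * (a1 * (u $ 0 * \<omega>0) + b1 * (u $ 1 * \<omega>1)))
         (k * (s $ 0 * \<sigma>00 + s $ 1 * \<sigma>10) * (c0 * (u $ 0 * \<omega>0) + d0 * (u $ 1 * \<omega>1)))
         (k * (s $ 0 * \<sigma>01 + s $ 1 * \<sigma>11) * (c1 * (u $ 0 * \<omega>0) + d1 * (u $ 1 * \<omega>1)))"
    and nz: "k \<noteq> 0" "\<omega>0 \<noteq> 0" "\<omega>1 \<noteq> 0" "a0 * d0 - b0 * c0 \<noteq> 0" "a1 * d1 - b1 * c1 \<noteq> 0"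
  shows "{\<phi> s u | (s :: complex ^ 2) (u :: complex ^ 2). True} - {0} = {x. x \<noteq> 0 \<and>
     (d0 * X0 x - b0 * Z0 x) * (a1 * Z1 x - c1 * X1 x) = (d1 * X1 x - b1 * Z1 x) * (a0 * Z0 x - c0 * X0 x)}"
proof -
  have "(\<exists>s u. x = \<phi> s u) \<longleftrightarrow> (\<exists>s0 s1 u v. x = mk (s0 * (a0 * u + b0 * v)) (s1 * (a1 * u + b1 * v))
            (s0 * (c0 * u + d0 * v)) (s1 * (c1 * u + d1 * v)))" (is "?L \<longleftrightarrow> ?R") for x
  proof
    show "?L \<Longrightarrow> ?R" unfolding \<phi> by blast
  next
    assume ?R
    then obtain s0 s1 U V where x: "x = mk (s0 * (a0 * U + b0 * V)) (s1 * (a1 * U + b1 * V))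
            (s0 * (c0 * U + d0 * V)) (s1 * (c1 * U + d1 * V))" by blast
    obtain s :: "complex ^ 2" where s: "s $ 0 * \<sigma>00 + s $ 1 * \<sigma>10 = s0 / k" "s $ 0 * \<sigma>01 + s $ 1 * \<sigma>11 = s1 / k"
      using \<sigma>_surj by blast
    obtain u :: "complex ^ 2" where u: "u $ 0 * \<omega>0 = U" "u $ 1 * \<omega>1 = V"
      using weight_surj[OF nz(2,3)] by blast
    have "x = \<phi> s u"
      unfolding \<phi> x s u using nz by simp
    then show ?L by blast
  qed
  then show ?thesis unfolding segre_image[OF nz(4,5)] by blast
qed

text \<open>The determinants that \<open>bilinear_image\<close> requires to be nonzero are, for both
  indices i: -1 for the first T surface, \<open>\<kappa>i\<close> for the second,
  \<open>\<kappa>i * h - g\<close> for the first Y surface and the negative of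
  \<open>\<kappa>i * (1 - h) + 1 + g\<close> for the second. This is the origin of the conditions
  \<open>Y_nz\<close>.\<close>

lemma T_surf_0: "T_surf c 0 = quad 1 (- 1) 0"
proof -
  have "{tri_eval c s (axis 0 1) u | s u. True} - {0} = quad 1 (- 1) 0"
    by (subst bilinear_image[where k = \<tau>0 and ?\<omega>0.0 = \<upsilon>0 and ?\<omega>1.0 = \<upsilon>1
          and ?a0.0 = "h" and ?a1.0 = "h" and ?b0.0 = "1 - h" and ?b1.0 = "1 - h"
          and ?c0.0 = "1" and ?c1.0 = "1" and ?d0.0 = "- 1" and ?d1.0 = "- 1"])
      (use base_nz \<kappa>_nz Y_nz in \<open>auto simp: tri Let_def quad_def algebra_simps add_eq_0_iff\<close>)
  then show ?thesis by (simp add: closure_quad)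
qed

lemma T_surf_1: "T_surf c 1 = quad \<kappa>0 (- \<kappa>1) 0"
proof -
  have "{tri_eval c s (axis 1 1) u | s u. True} - {0} = quad \<kappa>0 (- \<kappa>1) 0"
    by (subst bilinear_image[where k = \<tau>1 and ?\<omega>0.0 = \<upsilon>0 and ?\<omega>1.0 = \<upsilon>1
          and ?a0.0 = "g" and ?a1.0 = "g" and ?b0.0 = "- (1 + g)" and ?b1.0 = "- (1 + g)"
          and ?c0.0 = "\<kappa>0" and ?c1.0 = "\<kappa>1" and ?d0.0 = "- \<kappa>0" and ?d1.0 = "- \<kappa>1"])
      (use base_nz \<kappa>_nz Y_nz in \<open>auto simp: tri Let_def quad_def algebra_simps add_eq_0_iff\<close>)
  then show ?thesis by (simp add: closure_quad)
qed

lemma Y_surf_0: "Y_surf c 0 = quad (\<kappa>0 * h - g) (- (\<kappa>1 * h - g)) (\<kappa>1 - \<kappa>0)"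
proof -
  have "{tri_eval c s t (axis 0 1) | s t. True} - {0} = quad (\<kappa>0 * h - g) (- (\<kappa>1 * h - g)) (\<kappa>1 - \<kappa>0)"
    by (subst bilinear_image[where k = \<upsilon>0 and ?\<omega>0.0 = \<tau>0 and ?\<omega>1.0 = \<tau>1
          and ?a0.0 = "h" and ?a1.0 = "h" and ?b0.0 = "g" and ?b1.0 = "g"
          and ?c0.0 = "1" and ?c1.0 = "1" and ?d0.0 = "\<kappa>0" and ?d1.0 = "\<kappa>1"])
      (use base_nz \<kappa>_nz Y_nz in \<open>auto simp: tri Let_def quad_def algebra_simps add_eq_0_iff\<close>)
  then show ?thesis by (simp add: closure_quad)
qed

lemma Y_surf_1: "Y_surf c 1 = quad (\<kappa>0 * (1 - h) + 1 + g) (- (\<kappa>1 * (1 - h) + 1 + g)) (\<kappa>0 - \<kappa>1)"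
proof -
  have "{tri_eval c s t (axis 1 1) | s t. True} - {0} = quad (\<kappa>0 * (1 - h) + 1 + g) (- (\<kappa>1 * (1 - h) + 1 + g)) (\<kappa>0 - \<kappa>1)"
    by (subst bilinear_image[where k = \<upsilon>1 and ?\<omega>0.0 = \<tau>0 and ?\<omega>1.0 = \<tau>1
          and ?a0.0 = "1 - h" and ?a1.0 = "1 - h" and ?b0.0 = "- (1 + g)" and ?b1.0 = "- (1 + g)"
          and ?c0.0 = "- 1" and ?c1.0 = "- 1" and ?d0.0 = "- \<kappa>0" and ?d1.0 = "- \<kappa>1"])
      (use base_nz \<kappa>_nz Y_nz in \<open>auto simp: tri Let_def quad_def algebra_simps add_eq_0_iff\<close>)
  then show ?thesis by (simp add: closure_quad)
qed

text \<open>The parameterization of \<open>\<Sigma>\<^sub>i\<close> misses most of the line to which its base point is blown up.\<close>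

lemma plane_image:
  assumes param: "\<And>t u. tri_eval c (axis i 1) t u =
      (let T0 = t $ 0 * \<tau>0; T1 = t $ 1 * \<tau>1; U0 = u $ 0 * \<upsilon>0; U1 = u $ 1 * \<upsilon>1;
           H = T0 * (h * U0 + (1 - h) * U1) + T1 * (g * U0 - (1 + g) * U1)
       in mk (p * H) (q * H) (p * ((U0 - U1) * (T0 + \<kappa>0 * T1))) (q * ((U0 - U1) * (T0 + \<kappa>1 * T1))))"
    and pq: "p \<noteq> 0" "q \<noteq> 0"
  shows "Sigma_surf c i = plane q (- p)"
proof -
  let ?X = "{tri_eval c (axis i 1) t u | t u. True} - {0}"
  \<comment> \<open>Normalize \<open>U0 - U1 = 1\<close>. The Z coordinates then determine
    \<open>T0 = a\<close> and \<open>T1 = b\<close>, and the X coordinates leave a linear equation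
    for \<open>U1\<close> with leading coefficient \<open>a - b\<close>, which is
    \<open>\<delta> x\<close>.\<close>
  define \<delta> where "\<delta> x = ((1 + \<kappa>0) * (Z1 x / q) - (1 + \<kappa>1) * (Z0 x / p)) / (\<kappa>0 - \<kappa>1)" for x
  have image: "x \<in> ?X" if x: "q * X0 x = p * X1 x" and \<delta>: "\<delta> x \<noteq> 0" for x
  proof -
    define a where "a = (\<kappa>0 * (Z1 x / q) - \<kappa>1 * (Z0 x / p)) / (\<kappa>0 - \<kappa>1)"
    define b where "b = (Z0 x / p - Z1 x / q) / (\<kappa>0 - \<kappa>1)"
    define \<xi> where "\<xi> = X0 x / p"
    have "a - b = \<delta> x"
      unfolding a_def b_def \<delta>_def diff_divide_distrib[symmetric]
      by (rule arg_cong[where f = "\<lambda>y. y / (\<kappa>0 - \<kappa>1)"]) algebra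
    then have ab: "a - b \<noteq> 0" using \<delta> by simp
    define V where "V = (\<xi> - a * h - b * g) / (a - b)"
    have H: "a * (h * (V + 1) + (1 - h) * V) + b * (g * (V + 1) - (1 + g) * V) = \<xi>"
    proof -
      have "a * (h * (V + 1) + (1 - h) * V) + b * (g * (V + 1) - (1 + g) * V) = (a - b) * V + a * h + b * g"
        by (simp add: algebra_simps)
      then show ?thesis using ab by (simp add: V_def)
    qed
    have Z: "a + \<kappa>0 * b = Z0 x / p" "a + \<kappa>1 * b = Z1 x / q"
      using \<kappa>_nz pq by (simp_all add: a_def b_def divide_simps) (simp_all add: algebra_simps)
    obtain t :: "complex ^ 2" where t: "t $ 0 * \<tau>0 = a" "t $ 1 * \<tau>1 = b" using weight_surj[OF base_nz(1,2)] by blast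
    obtain u :: "complex ^ 2" where u: "u $ 0 * \<upsilon>0 = V + 1" "u $ 1 * \<upsilon>1 = V" using weight_surj[OF base_nz(3,4)] by blast
    have "x = tri_eval c (axis i 1) t u"
      unfolding param t u Let_def H using pq x by (simp add: coord_eq_iff Z \<xi>_def field_simps)
    moreover have "x \<noteq> 0" using \<delta> by (auto simp: \<delta>_def)
    ultimately show ?thesis by blast
  qed
  have "zariski_closure ?X = zero_locus (plane_mpoly q (- p))"
  proof (rule zariski_closure_eq_zero_locus[OF homogeneous_plane])
    show "?X \<subseteq> zero_locus (plane_mpoly q (- p))"
      unfolding zero_locus_plane plane_def by (auto simp: param Let_def)
  next
    fix x assume "x \<in> zero_locus (plane_mpoly q (- p))"
    then have x: "q * X0 x = p * X1 x" by (simp add: zero_locus_plane plane_def)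
    show "\<exists>y. \<forall>z. z \<noteq> 0 \<longrightarrow> x + z *s y \<in> ?X"
    proof (cases "\<delta> x = 0")
      case False
      then show ?thesis using image[OF x] by (intro exI[of _ 0]) simp
    next
      case True
      \<comment> \<open>The direction \<open>mk 0 0 p q\<close> stays in the plane and leaves the
        exceptional locus, since \<delta> has slope 1 along it.\<close>
      have "\<delta> (x + z *s mk 0 0 p q) = z" for z
      proof -
        have "\<delta> (x + z *s mk 0 0 p q) = \<delta> x + z * ((\<kappa>0 - \<kappa>1) / (\<kappa>0 - \<kappa>1))"
          using pq by (simp add: \<delta>_def add_divide_distrib[symmetric] diff_divide_distrib[symmetric])
            (simp add: field_simps)
        then show ?thesis using True \<kappa>_nz by simp
      qed
      then show ?thesis using x by (intro exI[of _ "mk 0 0 p q"] allI impI image) simp_all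
    qed
  qed
  then show ?thesis by (simp add: zero_locus_plane)
qed

lemma Sigma_surf_0: "Sigma_surf c 0 = plane \<sigma>01 (- \<sigma>00)"
  by (rule plane_image) (simp_all add: tri \<sigma>_nz)

lemma Sigma_surf_1: "Sigma_surf c 1 = plane \<sigma>11 (- \<sigma>10)"
  by (rule plane_image) (simp_all add: tri \<sigma>_nz)

lemmas surfs = Sigma_surf_0 Sigma_surf_1 T_surf_0 T_surf_1 Y_surf_0 Y_surf_1

end

section \<open>Vertices, boundary lines and nondegeneracy of the normal form\<close>

lemma line_through_scale:
  assumes "a \<noteq> 0" "b \<noteq> 0"
  shows "line_through (a *s p) (b *s q) = line_through p q"
proof -
  have "x = k *s p + l *s q \<longleftrightarrow> x = (k / a) *s (a *s p) + (l / b) *s (b *s q)" for x k l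
    using assms by (simp add: vector_smult_assoc)
  then show ?thesis
    unfolding set_eq_iff line_through_iff by (metis vector_smult_assoc)
qed

text \<open>The vanishing sum puts \<open>a + b = - (c + d)\<close> on both lines, and the
  independence of \<open>a\<close>, \<open>b\<close>, \<open>c\<close> makes it the only common
  point.\<close>

lemma meet_of_dependent:
  assumes "a + b + c + d = 0" "\<And>x y z. x *s a + y *s b + z *s c = 0 \<Longrightarrow> x = 0 \<and> y = 0 \<and> z = 0"
  shows "line_through a b \<inter> line_through c d = proj_point (a + b :: pvec)"
proof -
  have d: "d = - (a + b + c)" using assms(1) by (rule minus_unique[symmetric])
  show ?thesis
  proof (rule set_eqI)
    fix x
    show "x \<in> line_through a b \<inter> line_through c d \<longleftrightarrow> x \<in> proj_point (a + b)"
    proof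
      assume "x \<in> line_through a b \<inter> line_through c d"
      then obtain k l m n where x: "x \<noteq> 0" "x = k *s a + l *s b" "x = m *s c + n *s d"
        unfolding Int_iff line_through_iff by blast
      then have "(k + n) *s a + (l + n) *s b + (n - m) *s c = 0"
        unfolding d by (simp add: vec_eq_iff) (simp add: algebra_simps)
      from assms(2)[OF this] have "k = - n" "l = - n" by (auto simp: add_eq_0_iff2)
      then have "x = (- n) *s (a + b)" using x(2) by (simp add: vec_eq_iff algebra_simps)
      then show "x \<in> proj_point (a + b)" using x(1) unfolding proj_point_iff by blast
    next
      assume "x \<in> proj_point (a + b)"
      then obtain k where x: "x \<noteq> 0" "x = k *s (a + b)" by (auto simp: proj_point_iff)
      have "x = k *s a + k *s b" "x = (- k) *s c + (- k) *s d"
        unfolding x(2) d by (simp_all add: vec_eq_iff algebra_simps)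
      then show "x \<in> line_through a b \<inter> line_through c d"
        using x(1) unfolding Int_iff line_through_iff by blast
    qed
  qed
qed

context normal_form
begin

declare boundary_surface.simps [simp del]

lemma coord_minus [simp]:
  "X0 (x - y) = X0 x - X0 y" "X1 (x - y) = X1 x - X1 y" "Z0 (x - y) = Z0 x - Z0 y" "Z1 (x - y) = Z1 x - Z1 y"
  using coord_lin(1-4)[of "x - y" y] by (simp_all add: eq_diff_eq del: coord_lin)

text \<open>For fixed \<open>a\<close>, \<open>b0\<close>, \<open>b1\<close> and varying
  \<open>(p, q)\<close> these points run through the image of a coordinate line of the parameter s.
  The values \<open>q = 0\<close> and \<open>p = 0\<close> give its points on the two
  transversals.\<close>

definition pt :: "complex \<Rightarrow> complex \<Rightarrow> complex \<Rightarrow> complex \<Rightarrow> complex \<Rightarrow> pvec" where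
  "pt p q a b0 b1 = mk (p * a) (q * a) (p * b0) (q * b1)"

lemma coord_pt [simp]: "X0 (pt p q a b0 b1) = p * a" "X1 (pt p q a b0 b1) = q * a"
  "Z0 (pt p q a b0 b1) = p * b0" "Z1 (pt p q a b0 b1) = q * b1"
  by (simp_all add: pt_def)

definition sg0 :: "2 \<Rightarrow> complex" where "sg0 i = (if i = 0 then \<sigma>00 else \<sigma>10)"
definition sg1 :: "2 \<Rightarrow> complex" where "sg1 i = (if i = 0 then \<sigma>01 else \<sigma>11)"
definition hh :: "2 \<Rightarrow> 2 \<Rightarrow> complex" where
  "hh j k = (if j = 0 then if k = 0 then h else 1 - h else if k = 0 then g else - (1 + g))"
text \<open>\<open>m0 j k\<close> and \<open>m1 j k\<close> are the two eigenvalues of that matrix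
  among I, -I, K, -K which belongs to \<open>(j, k)\<close>.\<close>

definition m0 :: "2 \<Rightarrow> 2 \<Rightarrow> complex" where
  "m0 j k = (if k = 0 then 1 else - 1) * (if j = 0 then 1 else \<kappa>0)"
definition m1 :: "2 \<Rightarrow> 2 \<Rightarrow> complex" where
  "m1 j k = (if k = 0 then 1 else - 1) * (if j = 0 then 1 else \<kappa>1)"

text \<open>The control points freed from the weights \<open>wt\<close>; in this scaling the four
  vertices with the same \<open>i\<close> sum to zero, which expresses the base point.\<close>

definition dd :: "2 \<Rightarrow> 2 \<Rightarrow> 2 \<Rightarrow> pvec" where
  "dd i j k = pt (sg0 i) (sg1 i) (hh j k) (m0 j k) (m1 j k)"

definition wt :: "2 \<Rightarrow> 2 \<Rightarrow> complex" where
  "wt j k = (if j = 0 then \<tau>0 else \<tau>1) * (if k = 0 then \<upsilon>0 else \<upsilon>1)"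

lemmas vertex_defs = sg0_def sg1_def hh_def m0_def m1_def wt_def

lemma wt_nz: "wt j k \<noteq> 0"
  by (simp add: wt_def base_nz)

lemma sg_nz: "sg0 i \<noteq> 0" "sg1 i \<noteq> 0" "i \<noteq> i' \<Longrightarrow> sg0 i * sg1 i' - sg1 i * sg0 i' \<noteq> 0"
  using \<sigma>_nz exhaust_2'[of i] exhaust_2'[of i'] by (auto simp: sg0_def sg1_def mult.commute)

lemma hh_nz: "hh j k \<noteq> 0"
  using h_nz by (auto simp: hh_def add_eq_0_iff neg_eq_iff_add_eq_0)

lemma control: "c $ i $ j $ k = (wt j k) *s dd i j k"
proof -
  have eval: "tri_eval c (axis i 1) (axis j 1) (axis k 1) = c $ i $ j $ k"
    by (simp add: tri_eval_def axis_def if_distrib[of "\<lambda>x. x * _"] if_distrib[of "\<lambda>x. x *s _"]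
      if_distrib[of "\<lambda>x. _ * x"] sum_2' cong: if_cong) (use exhaust_2'[of i] exhaust_2'[of j] exhaust_2'[of k] in auto)
  have "tri_eval c (axis i 1) (axis j 1) (axis k 1) = (wt j k) *s dd i j k"
    using exhaust_2'[of i] exhaust_2'[of j] exhaust_2'[of k]
    by (elim disjE) (simp_all add: tri Let_def coord_eq_iff dd_def vertex_defs algebra_simps)
  then show ?thesis using eval by simp
qed

lemma s_line_dd: "s_line c j k = line_through (dd 0 j k) (dd 1 j k)"
  by (simp add: control line_through_scale wt_nz)

lemma t_line_dd: "t_line c i k = line_through (dd i 0 k) (dd i 1 k)"
  by (simp add: control line_through_scale wt_nz)

lemma u_line_dd: "u_line c i j = line_through (dd i j 0) (dd i j 1)"
  by (simp add: control line_through_scale wt_nz)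

declare boundary_line.simps [simp del]

lemma ruling_line:
  assumes "a \<noteq> 0"
  shows "line_through (pt \<sigma>00 \<sigma>01 a b0 b1) (pt \<sigma>10 \<sigma>11 a b0 b1) =
      {x. x \<noteq> 0 \<and> a * Z0 x = b0 * X0 x \<and> a * Z1 x = b1 * X1 x}" (is "?L = ?R")
    and "is_line (line_through (pt \<sigma>00 \<sigma>01 a b0 b1) (pt \<sigma>10 \<sigma>11 a b0 b1))"
proof -
  show "?L = ?R"
  proof
    show "?L \<subseteq> ?R" by (auto simp: line_through_iff algebra_simps)
    show "?R \<subseteq> ?L"
    proof
      fix x assume x: "x \<in> ?R"
      obtain s :: "complex ^ 2" where "s $ 0 * \<sigma>00 + s $ 1 * \<sigma>10 = X0 x / a" "s $ 0 * \<sigma>01 + s $ 1 * \<sigma>11 = X1 x / a"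
        using \<sigma>_surj by blast
      then have s: "X0 x = a * (s $ 0 * \<sigma>00 + s $ 1 * \<sigma>10)" "X1 x = a * (s $ 0 * \<sigma>01 + s $ 1 * \<sigma>11)"
        using assms by simp_all
      have "a * Z0 x = a * (b0 * (s $ 0 * \<sigma>00 + s $ 1 * \<sigma>10))" "a * Z1 x = a * (b1 * (s $ 0 * \<sigma>01 + s $ 1 * \<sigma>11))"
        using x by (simp_all add: s mult.left_commute)
      then have "Z0 x = b0 * (s $ 0 * \<sigma>00 + s $ 1 * \<sigma>10)" "Z1 x = b1 * (s $ 0 * \<sigma>01 + s $ 1 * \<sigma>11)"
        using assms by simp_all
      with s have "x = s $ 0 *s pt \<sigma>00 \<sigma>01 a b0 b1 + s $ 1 *s pt \<sigma>10 \<sigma>11 a b0 b1"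
        by (simp add: coord_eq_iff algebra_simps)
      then show "x \<in> ?L" using x by (auto simp: line_through_iff)
    qed
  qed
  show "is_line ?L"
  proof (rule is_line_line_through)
    fix k l assume *: "k *s pt \<sigma>00 \<sigma>01 a b0 b1 + l *s pt \<sigma>10 \<sigma>11 a b0 b1 = 0"
    then have "(k * \<sigma>00 + l * \<sigma>10) * a = 0" "(k * \<sigma>01 + l * \<sigma>11) * a = 0"
      by (simp_all add: coord_eq_iff algebra_simps)
    then have "k * \<sigma>00 + l * \<sigma>10 = 0" "k * \<sigma>01 + l * \<sigma>11 = 0" using assms by simp_all
    then have "k * (\<sigma>00 * \<sigma>11 - \<sigma>01 * \<sigma>10) = 0" "l * (\<sigma>00 * \<sigma>11 - \<sigma>01 * \<sigma>10) = 0" by algebra+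
    then show "k = 0 \<and> l = 0" using \<sigma>_nz by simp
  qed
qed

lemma s_line_eq: "s_line c j k = {x. x \<noteq> 0 \<and> hh j k * Z0 x = m0 j k * X0 x \<and> hh j k * Z1 x = m1 j k * X1 x}"
  and is_line_s: "is_line (s_line c j k)"
  unfolding s_line_dd dd_def using ruling_line[OF hh_nz[of j k], of "m0 j k" "m1 j k"]
  by (simp_all add: sg0_def sg1_def)

lemma in_s_line: "x \<in> s_line c j k \<Longrightarrow> \<exists>p q. x = pt p q (hh j k) (m0 j k) (m1 j k)"
  unfolding s_line_eq using hh_nz[of j k]
  by (intro exI[of _ "X0 x / hh j k"] exI[of _ "X1 x / hh j k"]) (auto simp: coord_eq_iff field_simps)

text \<open>Up to scaling, the only relation between the four columns is the one with equal
  coefficients, which is \<open>kernel\<close>. A relation between three columns is extended by the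
  coefficient 0, so all its coefficients are 0.\<close>

lemma square_indep:
  assumes "(j, k) \<noteq> (j', k')" "(j, k) \<noteq> (j'', k'')" "(j', k') \<noteq> (j'', k'')"
    and "x * hh j k + y * hh j' k' + z * hh j'' k'' = 0"
      "x * m0 j k + y * m0 j' k' + z * m0 j'' k'' = 0"
      "x * m1 j k + y * m1 j' k' + z * m1 j'' k'' = 0"
  shows "x = 0 \<and> y = 0 \<and> z = 0"
proof -
  have kernel: "a = d \<and> b = d \<and> e = d"
    if "a * h + b * (1 - h) + d * g - e * (1 + g) = 0" "a - b + (d - e) * \<kappa>0 = 0" "a - b + (d - e) * \<kappa>1 = 0" for a b d e
  proof -
    have "(d - e) * (\<kappa>0 - \<kappa>1) = 0" using that by algebra
    then have "e = d" using \<kappa>_nz by simp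
    with that show ?thesis by (simp add: algebra_simps)
  qed
  define A where "A u v = (if (u, v) = (j, k) then x else if (u, v) = (j', k') then y
      else if (u, v) = (j'', k'') then z else 0)" for u v :: 2
  note idx = exhaust_2'[of j] exhaust_2'[of k] exhaust_2'[of j'] exhaust_2'[of k'] exhaust_2'[of j''] exhaust_2'[of k'']
  have "A 0 0 * h + A 0 1 * (1 - h) + A 1 0 * g - A 1 1 * (1 + g) = 0"
    using assms(1-4) idx by (elim disjE) (simp_all add: A_def hh_def algebra_simps)
  moreover have "A 0 0 - A 0 1 + (A 1 0 - A 1 1) * \<kappa>0 = 0"
    using assms(1-3,5) idx by (elim disjE) (simp_all add: A_def m0_def algebra_simps)
  moreover have "A 0 0 - A 0 1 + (A 1 0 - A 1 1) * \<kappa>1 = 0"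
    using assms(1-3,6) idx by (elim disjE) (simp_all add: A_def m1_def algebra_simps)
  ultimately have "A 0 0 = A 1 0 \<and> A 0 1 = A 1 0 \<and> A 1 1 = A 1 0" by (rule kernel)
  then show ?thesis
    using assms(1-3) idx by (elim disjE) (simp_all add: A_def)
qed

lemma square_indep2:
  assumes "(j, k) \<noteq> (j', k')"
    and "x * hh j k + y * hh j' k' = 0" "x * m0 j k + y * m0 j' k' = 0" "x * m1 j k + y * m1 j' k' = 0"
  shows "x = 0 \<and> y = 0"
proof -
  obtain j'' k'' where "(j, k) \<noteq> (j'', k'')" "(j', k') \<noteq> (j'', k'')"
    by (metis prod.inject zero_neq_one)
  with square_indep[of j k j' k' j'' k'' x y 0] assms show ?thesis by simp
qed

lemma vertex_indep:
  assumes "(j, k) \<noteq> (j', k')" "(j, k) \<noteq> (j'', k'')" "(j', k') \<noteq> (j'', k'')"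
    "x *s dd i j k + y *s dd i j' k' + z *s dd i j'' k'' = 0"
  shows "x = 0 \<and> y = 0 \<and> z = 0"
proof (rule square_indep[OF assms(1-3)])
  have "sg0 i * (x * hh j k + y * hh j' k' + z * hh j'' k'') = 0"
     "sg0 i * (x * m0 j k + y * m0 j' k' + z * m0 j'' k'') = 0"
     "sg1 i * (x * m1 j k + y * m1 j' k' + z * m1 j'' k'') = 0"
    using assms(4) by (simp_all add: coord_eq_iff dd_def algebra_simps)
  then show "x * hh j k + y * hh j' k' + z * hh j'' k'' = 0"
     "x * m0 j k + y * m0 j' k' + z * m0 j'' k'' = 0"
     "x * m1 j k + y * m1 j' k' + z * m1 j'' k'' = 0"
    using sg_nz(1,2) by simp_all
qed

lemma vertex_indep2:
  assumes "(j, k) \<noteq> (j', k')" "x *s dd i j k + y *s dd i j' k' = 0"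
  shows "x = 0 \<and> y = 0"
proof -
  obtain j'' k'' where "(j, k) \<noteq> (j'', k'')" "(j', k') \<noteq> (j'', k'')"
    by (metis prod.inject zero_neq_one)
  with vertex_indep[of j k j' k' j'' k'' x i y 0] assms show ?thesis by simp
qed

lemma dd_nz: "dd i j k \<noteq> 0"
  using sg_nz(1)[of i] hh_nz[of j k] by (simp add: coord_eq_iff dd_def)

text \<open>The ratio of \<open>X0\<close> and \<open>X1\<close> identifies the plane, hence
  \<open>i\<close>; inside one plane any three vertices are independent.\<close>

lemma vertex_in_face:
  assumes "dd i j k = x *s dd i' j' k' + y *s dd i' j'' k''" "(j', k') \<noteq> (j'', k'')"
  shows "i = i' \<and> ((j, k) = (j', k') \<or> (j, k) = (j'', k''))"
proof
  show i: "i = i'"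
  proof (rule ccontr)
    assume "i \<noteq> i'"
    have "sg0 i * hh j k = sg0 i' * (x * hh j' k' + y * hh j'' k'')"
       "sg1 i * hh j k = sg1 i' * (x * hh j' k' + y * hh j'' k'')"
      using assms(1) by (simp_all add: coord_eq_iff dd_def algebra_simps)
    then have "hh j k * (sg0 i * sg1 i' - sg1 i * sg0 i') = 0" by algebra
    then show False using hh_nz sg_nz(3)[OF \<open>i \<noteq> i'\<close>] by simp
  qed
  show "(j, k) = (j', k') \<or> (j, k) = (j'', k'')"
  proof (rule ccontr)
    assume "\<not> ?thesis"
    moreover have "1 *s dd i j k + (- x) *s dd i j' k' + (- y) *s dd i j'' k'' = 0"
      using assms(1) i by (simp add: coord_eq_iff)
    ultimately show False using vertex_indep[of j k j' k' j'' k'' 1 i "- x" "- y"] assms(2) by auto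
  qed
qed

fun edge :: "parameter \<Rightarrow> 2 \<Rightarrow> 2 \<Rightarrow> (2 \<times> 2 \<times> 2) set" where
  "edge Par_s j k = {(0, j, k), (1, j, k)}"
| "edge Par_t i k = {(i, 0, k), (i, 1, k)}"
| "edge Par_u i j = {(i, j, 0), (i, j, 1)}"

lemma dd_in_line_through:
  "dd i j k \<in> line_through (dd i j k) q" "dd i j k \<in> line_through p (dd i j k)"
proof -
  have "dd i j k = 1 *s dd i j k + 0 *s q" "dd i j k = 0 *s p + 1 *s dd i j k" by simp_all
  then show "dd i j k \<in> line_through (dd i j k) q" "dd i j k \<in> line_through p (dd i j k)"
    unfolding line_through_iff using dd_nz by blast+
qed

text \<open>A boundary line is recovered from the vertices on it, so the distinctness of the twelve
  lines reduces to that of the edges of a cube.\<close>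

lemma vertex_on_boundary_line: "dd i j k \<in> boundary_line c p a b \<longleftrightarrow> (i, j, k) \<in> edge p a b"
proof
  assume *: "dd i j k \<in> boundary_line c p a b"
  show "(i, j, k) \<in> edge p a b"
  proof (cases p)
    case Par_s
    with * have "dd i j k \<in> s_line c a b" by simp
    then have eq: "sg0 i * (hh a b * m0 j k) = sg0 i * (m0 a b * hh j k)"
       "sg1 i * (hh a b * m1 j k) = sg1 i * (m1 a b * hh j k)"
      unfolding s_line_eq by (simp_all add: dd_def algebra_simps)
    have "(j, k) = (a, b)"
    proof (rule ccontr)
      assume "(j, k) \<noteq> (a, b)"
      from square_indep2[OF this, of "hh a b" "- hh j k"] eq sg_nz hh_nz show False
        by (simp add: algebra_simps)
    qed
    then show ?thesis using Par_s exhaust_2'[of i] by auto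
  next
    case Par_t
    with * obtain x y where "dd i j k = x *s dd a 0 b + y *s dd a 1 b"
      by (auto simp: t_line_dd line_through_iff)
    from vertex_in_face[OF this] Par_t show ?thesis by auto
  next
    case Par_u
    with * obtain x y where "dd i j k = x *s dd a b 0 + y *s dd a b 1"
      by (auto simp: u_line_dd line_through_iff)
    from vertex_in_face[OF this] Par_u show ?thesis by auto
  qed
next
  assume "(i, j, k) \<in> edge p a b"
  then show "dd i j k \<in> boundary_line c p a b"
    by (cases p) (auto simp: s_line_dd t_line_dd u_line_dd dd_in_line_through)
qed

lemma is_line_boundary_line: "is_line (boundary_line c p a b)"
proof (cases p)
  case Par_s
  then show ?thesis using is_line_s by simp
next
  case Par_t
  then show ?thesis
    unfolding Par_t t_line_dd by (intro is_line_line_through vertex_indep2) auto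
next
  case Par_u
  then show ?thesis
    unfolding Par_u u_line_dd by (intro is_line_line_through vertex_indep2) auto
qed

lemma edge_inj: "edge p a b = edge q a' b' \<Longrightarrow> (p, a, b) = (q, a', b')"
  by (cases p; cases q; simp only: edge.simps doubleton_eq_iff prod.inject; metis zero_neq_one)

lemma inj_boundary_line: "inj (\<lambda>(p, a, b). boundary_line c p a b)"
proof (rule injI)
  fix v w :: "parameter \<times> 2 \<times> 2"
  obtain p a b q a' b' where vw: "v = (p, a, b)" "w = (q, a', b')" by (metis surj_pair)
  assume "(case v of (p, a, b) \<Rightarrow> boundary_line c p a b) = (case w of (p, a, b) \<Rightarrow> boundary_line c p a b)"
  then have "boundary_line c p a b = boundary_line c q a' b'" by (simp add: vw)
  then have "edge p a b = edge q a' b'"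
    using vertex_on_boundary_line by (metis (no_types, lifting) subset_antisym subsetI surj_pair)
  then show "v = w" using edge_inj vw by blast
qed

lemma inj_boundary_surface: "inj (\<lambda>(p, i). boundary_surface c p i)"
proof -
  have S01: "Sigma_surf c 0 \<noteq> Sigma_surf c 1"
  proof -
    have "mk \<sigma>00 \<sigma>01 0 0 \<in> Sigma_surf c 0" "mk \<sigma>00 \<sigma>01 0 0 \<notin> Sigma_surf c 1"
      using \<sigma>_nz by (auto simp: surfs plane_def coord_eq_iff algebra_simps)
    then show ?thesis by auto
  qed
  \<comment> \<open>This point lies on the line \<open>X1 = Z1 = 0\<close>, which all T and Y
    surfaces contain; the point in \<open>TY\<close> then separates T from Y.\<close>
  have r: "mk 1 0 0 0 \<notin> Sigma_surf c i" "mk 1 0 0 0 \<in> T_surf c i" "mk 1 0 0 0 \<in> Y_surf c i" for i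
    using exhaust_2'[of i] \<sigma>_nz
    by (auto simp: surfs plane_def quad_def coord_eq_iff)
  have TY: "mk 1 1 0 0 \<in> T_surf c i" "mk 1 1 0 0 \<notin> Y_surf c i" for i
    using exhaust_2'[of i] \<kappa>_nz
    by (auto simp: surfs plane_def quad_def coord_eq_iff)
  have "mk 1 1 1 1 \<in> T_surf c 0" "mk 1 1 1 1 \<notin> T_surf c 1"
    using \<kappa>_nz by (auto simp: surfs quad_def coord_eq_iff)
  then have T01: "T_surf c 0 \<noteq> T_surf c 1" by metis
  have Y01: "Y_surf c 0 \<noteq> Y_surf c 1"
  proof
    assume eq: "Y_surf c 0 = Y_surf c 1"
    \<comment> \<open>Two points of the first Y surface with \<open>X0 = X1 = 1\<close>, one with
      \<open>Z0 = 0\<close> and one with \<open>Z1 = 0\<close>. If both were on the second surface,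
      both eigenvalues would be -1.\<close>
    define p where "p = mk 1 1 0 ((\<kappa>0 - \<kappa>1) / (\<kappa>0 * h - g))"
    define q where "q = mk 1 1 ((\<kappa>1 - \<kappa>0) / (\<kappa>1 * h - g)) 0"
    have "p \<in> Y_surf c 0" "q \<in> Y_surf c 0"
      using Y_nz by (simp_all add: surfs p_def q_def quad_def coord_eq_iff) (simp add: field_simps)
    then have "p \<in> Y_surf c 1" "q \<in> Y_surf c 1" using eq by simp_all
    then have "(\<kappa>0 * (1 - h) + 1 + g) * ((\<kappa>0 - \<kappa>1) / (\<kappa>0 * h - g)) + (\<kappa>0 - \<kappa>1) = 0"
       "- (\<kappa>1 * (1 - h) + 1 + g) * ((\<kappa>1 - \<kappa>0) / (\<kappa>1 * h - g)) + (\<kappa>0 - \<kappa>1) = 0"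
      by (simp_all add: surfs p_def q_def quad_def coord_eq_iff)
    then have "(\<kappa>0 - \<kappa>1) * (\<kappa>0 + 1) = 0" "(\<kappa>0 - \<kappa>1) * (\<kappa>1 + 1) = 0"
      using Y_nz by (simp_all add: field_simps)
    then show False using \<kappa>_nz by (auto simp: add_eq_0_iff2)
  qed
  show ?thesis
  proof (rule injI)
    fix v w :: "parameter \<times> 2"
    obtain p i q j where vw: "v = (p, i)" "w = (q, j)" by (metis surj_pair)
    assume "(case v of (p, i) \<Rightarrow> boundary_surface c p i) = (case w of (p, i) \<Rightarrow> boundary_surface c p i)"
    then have eq: "boundary_surface c p i = boundary_surface c q j" by (simp add: vw)
    have "p = q"
      using eq r[of i] r[of j] TY[of i] TY[of j] by (cases p; cases q) auto
    moreover have "i = j"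
      using eq S01 T01 Y01 exhaust_2'[of i] exhaust_2'[of j] unfolding \<open>p = q\<close>
      by (cases q) auto
    ultimately show "v = w" by (simp add: vw)
  qed
qed

lemma nondegenerate: "nondegenerate c"
proof -
  have "smooth_surface (boundary_surface c p i)" for p i
    using exhaust_2'[of i] \<sigma>_nz \<kappa>_nz Y_nz
    by (cases p) (auto simp only: surfs intro!: smooth_quad smooth_plane, auto)
  then show ?thesis
    unfolding nondegenerate_def using inj_boundary_surface is_line_boundary_line inj_boundary_line by blast
qed

end

section \<open>The two transversals and the intersections of opposite boundary surfaces\<close>

context normal_form
begin

definition r0 :: "pvec set" where "r0 = {x. x \<noteq> 0 \<and> X1 x = 0 \<and> Z1 x = 0}"
definition r1 :: "pvec set" where "r1 = {x. x \<noteq> 0 \<and> X0 x = 0 \<and> Z0 x = 0}"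
definition ell :: "pvec set" where "ell = {x. x \<noteq> 0 \<and> X0 x = 0 \<and> X1 x = 0}"

lemma r0_line: "r0 = line_through (mk 1 0 0 0) (mk 0 0 1 0)"
  by (auto simp: r0_def line_through_iff coord_eq_iff)

lemma r1_line: "r1 = line_through (mk 0 1 0 0) (mk 0 0 0 1)"
  by (auto simp: r1_def line_through_iff coord_eq_iff)

lemma ell_line: "ell = line_through (mk 0 0 1 0) (mk 0 0 0 1)"
  by (auto simp: ell_def line_through_iff coord_eq_iff)

lemma is_line_r0: "is_line r0" and is_line_r1: "is_line r1" and is_line_ell: "is_line ell"
  unfolding r0_line r1_line ell_line
  by (rule is_line_line_through; simp add: coord_eq_iff)+

lemma r0_neq_r1: "r0 \<noteq> r1"
proof -
  have "mk 1 0 0 0 \<in> r0" "mk 1 0 0 0 \<notin> r1" by (simp_all add: r0_def r1_def coord_eq_iff)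
  then show ?thesis by metis
qed

lemma r_meets_s_line: "r0 \<inter> s_line c j k \<noteq> {}" "r1 \<inter> s_line c j k \<noteq> {}"
proof -
  have "pt 1 0 (hh j k) (m0 j k) (m1 j k) \<in> r0 \<inter> s_line c j k"
    "pt 0 1 (hh j k) (m0 j k) (m1 j k) \<in> r1 \<inter> s_line c j k"
    using hh_nz[of j k] by (simp_all add: r0_def r1_def s_line_eq coord_eq_iff)
  then show "r0 \<inter> s_line c j k \<noteq> {}" "r1 \<inter> s_line c j k \<noteq> {}" by blast+
qed

text \<open>A transversal spanned by its points on \<open>s\<^sub>0\<^sub>0\<close> and \<open>s\<^sub>0\<^sub>1\<close> that lies on neither \<open>r\<^sub>0\<close>
  nor \<open>r\<^sub>1\<close> forces the two cross ratios of the points cut out on \<open>r\<^sub>0\<close> and \<open>r\<^sub>1\<close> by the four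
  lines to agree, which \<open>cross\<close> excludes.\<close>

lemma transversal_components:
  assumes r: "a * p0 = (g + (1 - h) * \<kappa>0) * u0" "b * q0 = (g - h * \<kappa>0) * u0"
      "a * p1 = (g + (1 - h) * \<kappa>1) * u1" "b * q1 = (g - h * \<kappa>1) * u1"
    and v: "a' * p0 = - (1 + g + (1 - h) * \<kappa>0) * v0" "b' * q0 = - (1 + g - h * \<kappa>0) * v0"
      "a' * p1 = - (1 + g + (1 - h) * \<kappa>1) * v1" "b' * q1 = - (1 + g - h * \<kappa>1) * v1"
    and nz: "u0 \<noteq> 0 \<or> u1 \<noteq> 0" "v0 \<noteq> 0 \<or> v1 \<noteq> 0" "p0 \<noteq> 0 \<or> p1 \<noteq> 0"
  shows "p0 = 0 \<and> q0 = 0 \<or> p1 = 0 \<and> q1 = 0"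
proof -
  \<comment> \<open>On \<open>r0\<close>, take the points of the first two lines as a basis. The
    point of the third line has coordinates \<open>x0\<close>, \<open>y0\<close>, and that of the
    fourth has \<open>- (1 + x0)\<close>, \<open>- (1 + y0)\<close>, so
    \<open>x0 * (1 + y0) / (y0 * (1 + x0))\<close> is the cross ratio. The index 1 belongs to
    \<open>r1\<close> in the same way.\<close>
  define x0 x1 y0 y1 where "x0 = g + (1 - h) * \<kappa>0" and "x1 = g + (1 - h) * \<kappa>1"
    and "y0 = g - h * \<kappa>0" and "y1 = g - h * \<kappa>1"
  have y: "y0 \<noteq> 0" "y1 \<noteq> 0" and x: "1 + x0 \<noteq> 0" "1 + x1 \<noteq> 0"
    using Y_nz by (auto simp: x0_def x1_def y0_def y1_def algebra_simps)
  \<comment> \<open>The difference of the two cross ratios with denominators cleared. Only its being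
    nonzero matters, so the factorization is stated up to sign.\<close>
  have "(1 + y0) * x0 * y1 * (1 + x1) - (1 + y1) * x1 * y0 * (1 + x0)
      = (\<kappa>1 - \<kappa>0) * (g * (1 + g) + h * (1 - h) * \<kappa>0 * \<kappa>1) \<or>
      (1 + y0) * x0 * y1 * (1 + x1) - (1 + y1) * x1 * y0 * (1 + x0)
      = (\<kappa>0 - \<kappa>1) * (g * (1 + g) + h * (1 - h) * \<kappa>0 * \<kappa>1)"
    unfolding x0_def x1_def y0_def y1_def by (simp add: algebra_simps)
  then have ratio: "(1 + y0) * x0 * y1 * (1 + x1) \<noteq> (1 + y1) * x1 * y0 * (1 + x0)"
    using \<kappa>_nz cross by auto
  have x01: "x0 \<noteq> x1" using \<kappa>_nz h_nz by (simp add: x0_def x1_def)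
  have r: "a * p0 = x0 * u0" "b * q0 = y0 * u0" "a * p1 = x1 * u1" "b * q1 = y1 * u1"
    using r by (simp_all add: x0_def x1_def y0_def y1_def)
  have v: "a' * p0 = - (1 + x0) * v0" "b' * q0 = - (1 + y0) * v0" "a' * p1 = - (1 + x1) * v1" "b' * q1 = - (1 + y1) * v1"
    using v by (simp_all add: x0_def x1_def y0_def y1_def add_diff_eq add.assoc)
  have b: "b \<noteq> 0" using r(2,4) nz(1) y by auto
  have a': "a' \<noteq> 0" using v(1,3) nz(2) x by (auto simp del: minus_add_distrib)
  have step0: "a * b' * y0 * (1 + x0) * u0 = b * a' * (1 + y0) * x0 * u0"
    using r(1,2) v(1,2) b by algebra
  have step1: "a * b' * y1 * (1 + x1) * u1 = b * a' * (1 + y1) * x1 * u1"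
    using r(3,4) v(3,4) b by algebra
  show ?thesis
  proof (cases "u0 = 0 \<or> u1 = 0")
    case False
    then have "a * b' * y0 * (1 + x0) = b * a' * (1 + y0) * x0" "a * b' * y1 * (1 + x1) = b * a' * (1 + y1) * x1"
      using step0 step1 by simp_all
    then have "(b * a') * ((1 + y0) * x0 * y1 * (1 + x1) - (1 + y1) * x1 * y0 * (1 + x0)) = 0" by algebra
    then show ?thesis using b a' ratio by simp
  next
    case True
    then show ?thesis
    proof
      \<comment> \<open>Here the point on the third line lies on \<open>r1\<close>. If
        \<open>p0\<close> were nonzero, the equations would give \<open>1 + y0 = 0\<close> and
        \<open>x1 = 0\<close>, so that both sides of \<open>ratio\<close> would vanish. The other
        case is symmetric.\<close>
      assume "u0 = 0"
      then have q0: "q0 = 0" using r(2) b by simp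
      have "p0 = 0"
      proof (rule ccontr)
        assume "p0 \<noteq> 0"
        then have "v0 \<noteq> 0" using v(1) a' by auto
        then have "1 + y0 = 0" using v(2) q0 by (auto simp del: minus_add_distrib)
        moreover have "a = 0" using r(1) \<open>u0 = 0\<close> \<open>p0 \<noteq> 0\<close> by simp
        then have "x1 = 0" using r(3) nz(1) \<open>u0 = 0\<close> by simp
        ultimately show False using ratio by simp
      qed
      then show ?thesis using q0 by simp
    next
      assume "u1 = 0"
      then have q1: "q1 = 0" using r(4) b by simp
      have "p1 = 0"
      proof (rule ccontr)
        assume "p1 \<noteq> 0"
        then have "v1 \<noteq> 0" using v(3) a' by auto
        then have "1 + y1 = 0" using v(4) q1 by (auto simp del: minus_add_distrib)
        moreover have "a = 0" using r(3) \<open>u1 = 0\<close> \<open>p1 \<noteq> 0\<close> by simp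
        then have "x0 = 0" using r(1) nz(1) \<open>u1 = 0\<close> by simp
        ultimately show False using ratio by simp
      qed
      then show ?thesis using q1 by simp
    qed
  qed
qed

lemma transversal_unique:
  assumes "is_line r" and meets: "\<And>j k. r \<inter> s_line c j k \<noteq> {}"
  shows "r = r0 \<or> r = r1"
proof -
  have "\<exists>p q. pt p q (hh j k) (m0 j k) (m1 j k) \<in> r" for j k
    using meets[of j k] in_s_line by blast
  then obtain P Q where w: "\<And>j k. pt (P j k) (Q j k) (hh j k) (m0 j k) (m1 j k) \<in> r" by metis
  have "0 \<notin> r" using assms(1) by (auto simp: is_line_def)
  then have nz: "P j k \<noteq> 0 \<or> Q j k \<noteq> 0" for j k
    using w[of j k] by (auto simp: pt_def mk_def)
  \<comment> \<open>The letters p, q, u, v stand for the points of the transversal on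
    \<open>s_{00}\<close>, \<open>s_{01}\<close>, \<open>s_{10}\<close>, \<open>s_{11}\<close>; the
    digits 0 and 1 mark the components along \<open>r0\<close> and \<open>r1\<close>.\<close>
  define p0 p1 q0 q1 u0 u1 v0 v1 where "p0 = P 0 0" and "p1 = Q 0 0" and "q0 = P 0 1" and "q1 = Q 0 1"
    and "u0 = P 1 0" and "u1 = Q 1 0" and "v0 = P 1 1" and "v1 = Q 1 1"
  let ?w0 = "mk (p0 * h) (p1 * h) p0 p1" and ?w1 = "mk (q0 * (1 - h)) (q1 * (1 - h)) (- q0) (- q1)"
  have w0: "?w0 \<in> r" using w[of 0 0] by (simp add: pt_def vertex_defs p0_def p1_def)
  have w1: "?w1 \<in> r" using w[of 0 1] by (simp add: pt_def vertex_defs q0_def q1_def)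
  have w2: "mk (u0 * g) (u1 * g) (u0 * \<kappa>0) (u1 * \<kappa>1) \<in> r"
    using w[of 1 0] by (simp add: pt_def vertex_defs u0_def u1_def)
  have w3: "mk (- (v0 * (1 + g))) (- (v1 * (1 + g))) (- (v0 * \<kappa>0)) (- (v1 * \<kappa>1)) \<in> r"
    using w[of 1 1] by (simp add: pt_def vertex_defs v0_def v1_def algebra_simps)
  have indep: "a = 0 \<and> b = 0" if "a *s ?w0 + b *s ?w1 = 0" for a b
  proof -
    have "a * (p0 * h) + b * (q0 * (1 - h)) = 0" "a * (p1 * h) + b * (q1 * (1 - h)) = 0"
       "a * p0 = b * q0" "a * p1 = b * q1"
      using that by (simp_all add: coord_eq_iff)
    then have "b * q0 = 0" "b * q1 = 0" "a * p0 = 0" "a * p1 = 0" by algebra+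
    then show ?thesis using nz[of 0 0] nz[of 0 1] by (auto simp: p0_def p1_def q0_def q1_def)
  qed
  have r: "r = line_through ?w0 ?w1"
    using is_line_eq_line_through[OF assms(1) w0 w1 indep] .
  obtain a b where "mk (u0 * g) (u1 * g) (u0 * \<kappa>0) (u1 * \<kappa>1) = a *s ?w0 + b *s ?w1"
    using w2 unfolding r line_through_iff by blast
  then have e2: "u0 * g = a * (p0 * h) + b * (q0 * (1 - h))" "u1 * g = a * (p1 * h) + b * (q1 * (1 - h))"
      "u0 * \<kappa>0 = a * p0 - b * q0" "u1 * \<kappa>1 = a * p1 - b * q1"
    by (simp_all add: coord_eq_iff)
  obtain a' b' where "mk (- (v0 * (1 + g))) (- (v1 * (1 + g))) (- (v0 * \<kappa>0)) (- (v1 * \<kappa>1)) = a' *s ?w0 + b' *s ?w1"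
    using w3 unfolding r line_through_iff by blast
  then have e3: "- (v0 * (1 + g)) = a' * (p0 * h) + b' * (q0 * (1 - h))"
      "- (v1 * (1 + g)) = a' * (p1 * h) + b' * (q1 * (1 - h))"
      "- (v0 * \<kappa>0) = a' * p0 - b' * q0" "- (v1 * \<kappa>1) = a' * p1 - b' * q1"
    by (simp_all add: coord_eq_iff)
  have "p0 = 0 \<and> q0 = 0 \<or> p1 = 0 \<and> q1 = 0"
  proof (rule transversal_components[of a p0 u0 b q0 p1 u1 q1 a' v0 b' v1])
    show "a * p0 = (g + (1 - h) * \<kappa>0) * u0" "b * q0 = (g - h * \<kappa>0) * u0" using e2(1,3) by algebra+
    show "a * p1 = (g + (1 - h) * \<kappa>1) * u1" "b * q1 = (g - h * \<kappa>1) * u1" using e2(2,4) by algebra+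
    show "a' * p0 = - (1 + g + (1 - h) * \<kappa>0) * v0" "b' * q0 = - (1 + g - h * \<kappa>0) * v0" using e3(1,3) by algebra+
    show "a' * p1 = - (1 + g + (1 - h) * \<kappa>1) * v1" "b' * q1 = - (1 + g - h * \<kappa>1) * v1" using e3(2,4) by algebra+
  qed (use nz[of 1 0] nz[of 1 1] nz[of 0 0] in \<open>simp_all add: u0_def u1_def v0_def v1_def p0_def p1_def\<close>)
  then show ?thesis
  proof
    assume "p0 = 0 \<and> q0 = 0"
    with \<open>0 \<notin> r\<close> w0 w1 have "?w0 \<in> r1" "?w1 \<in> r1" by (auto simp: r1_def)
    then have "r1 = line_through ?w0 ?w1" using is_line_eq_line_through[OF is_line_r1 _ _ indep] by blast
    then show ?thesis using r by simp
  next
    assume "p1 = 0 \<and> q1 = 0"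
    with \<open>0 \<notin> r\<close> w0 w1 have "?w0 \<in> r0" "?w1 \<in> r0" by (auto simp: r0_def)
    then have "r0 = line_through ?w0 ?w1" using is_line_eq_line_through[OF is_line_r0 _ _ indep] by blast
    then show ?thesis using r by simp
  qed
qed

lemma transversals: "{r. is_line r \<and> (\<forall>j k. r \<inter> s_line c j k \<noteq> {})} = {r0, r1}"
  using transversal_unique is_line_r0 is_line_r1 r_meets_s_line by blast

lemma Sigma_meet: "Sigma_surf c 0 \<inter> Sigma_surf c 1 = ell"
proof -
  have "X0 x = 0 \<and> X1 x = 0" if "\<sigma>01 * X0 x = \<sigma>00 * X1 x" "\<sigma>11 * X0 x = \<sigma>10 * X1 x" for x
  proof -
    have "(\<sigma>00 * \<sigma>11 - \<sigma>01 * \<sigma>10) * X0 x = 0" "(\<sigma>00 * \<sigma>11 - \<sigma>01 * \<sigma>10) * X1 x = 0"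
      using that by algebra+
    then show ?thesis using \<sigma>_nz by simp
  qed
  then show ?thesis by (auto simp: surfs plane_def ell_def)
qed

text \<open>\<open>yline\<close> is the line to which the map contracts the surface
  \<open>U0 = U1\<close>, and \<open>zline\<close> the one to which it contracts
  \<open>T0 = T1\<close>; on these surfaces the image depends on \<open>t\<close> and
  \<open>u\<close> only through a scalar factor.\<close>

definition yline :: "pvec set" where "yline = line_through (pt \<sigma>00 \<sigma>01 1 0 0) (pt \<sigma>10 \<sigma>11 1 0 0)"
definition zline :: "pvec set" where
  "zline = line_through (pt \<sigma>00 \<sigma>01 (h + g) (1 + \<kappa>0) (1 + \<kappa>1)) (pt \<sigma>10 \<sigma>11 (h + g) (1 + \<kappa>0) (1 + \<kappa>1))"

lemma yline_eq: "yline = {x. x \<noteq> 0 \<and> Z0 x = 0 \<and> Z1 x = 0}" and is_line_yline: "is_line yline"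
  unfolding yline_def using ruling_line[of 1 0 0] by simp_all

lemma zline_eq: "zline = {x. x \<noteq> 0 \<and> (h + g) * Z0 x = (1 + \<kappa>0) * X0 x \<and> (h + g) * Z1 x = (1 + \<kappa>1) * X1 x}"
  and is_line_zline: "is_line zline"
  unfolding zline_def by (rule ruling_line[OF h_nz(5)])+

text \<open>As \<kappa>0 and \<kappa>1 differ, the two equations are equivalent to
  \<open>X0 * Z1 = 0\<close> and \<open>X1 * Z0 = 0\<close>, and the four choices of factors are the
  four lines.\<close>

lemma T_meet: "T_surf c 0 \<inter> T_surf c 1 = ell \<union> r0 \<union> r1 \<union> yline"
proof -
  have "x0 * z1 = x1 * z0 \<and> \<kappa>0 * (x0 * z1) = \<kappa>1 * (x1 * z0) \<longleftrightarrow>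
      x0 = 0 \<and> x1 = 0 \<or> x1 = 0 \<and> z1 = 0 \<or> x0 = 0 \<and> z0 = 0 \<or> z0 = 0 \<and> z1 = 0" for x0 x1 z0 z1
  proof -
    have "a = b \<and> \<kappa>0 * a = \<kappa>1 * b \<longleftrightarrow> a = 0 \<and> b = 0" for a b
      using \<kappa>_nz by auto
    from this[of "x0 * z1" "x1 * z0"] show ?thesis by auto
  qed
  then show ?thesis
    by (auto simp: surfs quad_def ell_def r0_def r1_def yline_eq)
qed

lemma Y_meet: "Y_surf c 0 \<inter> Y_surf c 1 = ell \<union> r0 \<union> r1 \<union> zline"
proof -
  have key: "(\<kappa>0 * h - g) * (x0 * z1) + - (\<kappa>1 * h - g) * (x1 * z0) + (\<kappa>1 - \<kappa>0) * (x0 * x1) = 0 \<and>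
      (\<kappa>0 * (1 - h) + 1 + g) * (x0 * z1) + - (\<kappa>1 * (1 - h) + 1 + g) * (x1 * z0) + (\<kappa>0 - \<kappa>1) * (x0 * x1) = 0 \<longleftrightarrow>
      x0 = 0 \<and> x1 = 0 \<or> x1 = 0 \<and> z1 = 0 \<or> x0 = 0 \<and> z0 = 0 \<or>
      (h + g) * z0 = (1 + \<kappa>0) * x0 \<and> (h + g) * z1 = (1 + \<kappa>1) * x1" (is "?A = 0 \<and> ?B = 0 \<longleftrightarrow> ?R") for x0 x1 z0 z1
  proof
    assume AB: "?A = 0 \<and> ?B = 0"
    show ?R
    proof (cases "x0 = 0 \<or> x1 = 0")
      case True
      then show ?thesis using AB Y_nz by auto
    next
      case False
      \<comment> \<open>Eliminating \<open>x0 * z1\<close> from the two equations leaves a multiple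
        of \<open>x1\<close>, and eliminating \<open>x1 * z0\<close> leaves a multiple of
        \<open>x0\<close>.\<close>
      have "x1 * ((\<kappa>0 - \<kappa>1) * ((h + g) * z0 - (1 + \<kappa>0) * x0)) = 0"
        "x0 * ((\<kappa>0 - \<kappa>1) * ((h + g) * z1 - (1 + \<kappa>1) * x1)) = 0"
        using AB by algebra+
      then show ?thesis using False \<kappa>_nz by simp
    qed
  next
    assume R: ?R
    show "?A = 0 \<and> ?B = 0"
    proof (cases "(h + g) * z0 = (1 + \<kappa>0) * x0 \<and> (h + g) * z1 = (1 + \<kappa>1) * x1")
      case True
      then have "(h + g) * ?A = 0" "(h + g) * ?B = 0" by algebra+
      then show ?thesis using h_nz(5) by simp
    qed (use R in auto)
  qed
  show ?thesis
  proof (rule set_eqI)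
    fix x
    show "x \<in> Y_surf c 0 \<inter> Y_surf c 1 \<longleftrightarrow> x \<in> ell \<union> r0 \<union> r1 \<union> zline"
      unfolding surfs quad_def ell_def r0_def r1_def zline_eq Int_iff Un_iff mem_Collect_eq
      using key[of "X0 x" "Z1 x" "X1 x" "Z0 x"] by blast
  qed
qed

text \<open>The zero sum of the four vertices of a face puts the two lines in the position of
  \<open>meet_of_dependent\<close>. In \<open>t_meet\<close> the same relation is split the other
  way.\<close>

lemma u_meet: "u_line c i 0 \<inter> u_line c i 1 = proj_point (pt (sg0 i) (sg1 i) 1 0 0)"
proof -
  have "dd i 0 0 + dd i 0 1 = pt (sg0 i) (sg1 i) 1 0 0"
    by (simp add: coord_eq_iff dd_def vertex_defs algebra_simps)
  moreover have "u_line c i 0 \<inter> u_line c i 1 = proj_point (dd i 0 0 + dd i 0 1)"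
    unfolding u_line_dd
  proof (rule meet_of_dependent)
    show "dd i 0 0 + dd i 0 1 + dd i 1 0 + dd i 1 1 = 0"
      by (simp add: coord_eq_iff dd_def vertex_defs algebra_simps)
    show "x = 0 \<and> y = 0 \<and> z = 0" if "x *s dd i 0 0 + y *s dd i 0 1 + z *s dd i 1 0 = 0" for x y z
      using vertex_indep[OF _ _ _ that] by simp
  qed
  ultimately show ?thesis by simp
qed

lemma t_meet: "t_line c i 0 \<inter> t_line c i 1 = proj_point (pt (sg0 i) (sg1 i) (h + g) (1 + \<kappa>0) (1 + \<kappa>1))"
proof -
  have "dd i 0 0 + dd i 1 0 = pt (sg0 i) (sg1 i) (h + g) (1 + \<kappa>0) (1 + \<kappa>1)"
    by (simp add: coord_eq_iff dd_def vertex_defs algebra_simps)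
  moreover have "t_line c i 0 \<inter> t_line c i 1 = proj_point (dd i 0 0 + dd i 1 0)"
    unfolding t_line_dd
  proof (rule meet_of_dependent)
    show "dd i 0 0 + dd i 1 0 + dd i 0 1 + dd i 1 1 = 0"
      by (simp add: coord_eq_iff dd_def vertex_defs algebra_simps)
    show "x = 0 \<and> y = 0 \<and> z = 0" if "x *s dd i 0 0 + y *s dd i 1 0 + z *s dd i 0 1 = 0" for x y z
      using vertex_indep[OF _ _ _ that] by simp
  qed
  ultimately show ?thesis by simp
qed

lemma scaffold: "scaffold c"
  unfolding scaffold_def
proof (intro exI[of _ Par_s] conjI allI impI)
  fix q i assume "q \<noteq> Par_s"
  then show "is_quadric (boundary_surface c q i)"
    using exhaust_2'[of i] \<kappa>_nz Y_nz
    by (cases q) (auto simp only: surfs intro!: smooth_quad, auto)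
next
  have "is_plane (Sigma_surf c 0)" "is_plane (Sigma_surf c 1)"
    using \<sigma>_nz by (simp_all add: surfs smooth_plane del: One_nat_def)
  then show "is_plane (Sigma_surf c i)" for i by (metis exhaust_2')
next
  have "mk 0 0 1 0 \<in> r0 \<inter> ell" "mk 0 0 0 1 \<in> r1 \<inter> ell"
    by (simp_all add: r0_def r1_def ell_def coord_eq_iff)
  then have "r0 \<inter> ell \<noteq> {}" "r1 \<inter> ell \<noteq> {}" by blast+
  then show "\<exists>l r0 r1. Sigma_surf c 0 \<inter> Sigma_surf c 1 = l \<and> is_line l \<and>
           is_line r0 \<and> is_line r1 \<and> r0 \<noteq> r1 \<and>
           (\<forall>a b. s_line c a b \<inter> r0 \<noteq> {} \<and> s_line c a b \<inter> r1 \<noteq> {}) \<and>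
           r0 \<inter> l \<noteq> {} \<and> r1 \<inter> l \<noteq> {}"
    using Sigma_meet is_line_ell is_line_r0 is_line_r1 r0_neq_r1 r_meets_s_line
    by (intro exI[of _ ell] exI[of _ r0] exI[of _ r1]) (auto simp: Int_commute)
qed

lemma boundary_structure:
  "nondegenerate c \<and> scaffold c \<and>
       (\<exists>s r0 r1 y z.
          T_surf c 0 \<inter> T_surf c 1 = s \<union> r0 \<union> r1 \<union> y \<and>
          Y_surf c 0 \<inter> Y_surf c 1 = s \<union> r0 \<union> r1 \<union> z \<and>
          s = Sigma_surf c 0 \<inter> Sigma_surf c 1 \<and> is_line s \<and>
          r0 \<noteq> r1 \<and>
          {r. is_line r \<and> (\<forall>j k. r \<inter> s_line c j k \<noteq> {})} = {r0, r1} \<and>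
          (\<exists>p q. u_line c 0 0 \<inter> u_line c 0 1 = proj_point p \<and>
                 u_line c 1 0 \<inter> u_line c 1 1 = proj_point q \<and>
                 is_line y \<and> y = line_through p q) \<and>
          (\<exists>p q. t_line c 0 0 \<inter> t_line c 0 1 = proj_point p \<and>
                 t_line c 1 0 \<inter> t_line c 1 1 = proj_point q \<and>
                 is_line z \<and> z = line_through p q))"
proof (intro conjI nondegenerate scaffold, rule exI[of _ ell], rule exI[of _ r0], rule exI[of _ r1],
    rule exI[of _ yline], rule exI[of _ zline],
    intro conjI T_meet Y_meet Sigma_meet[symmetric] is_line_ell r0_neq_r1 transversals)
  show "\<exists>p q. u_line c 0 0 \<inter> u_line c 0 1 = proj_point p \<and>
                 u_line c 1 0 \<inter> u_line c 1 1 = proj_point q \<and>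
                 is_line yline \<and> yline = line_through p q"
    by (rule exI[of _ "pt (sg0 0) (sg1 0) 1 0 0"], rule exI[of _ "pt (sg0 1) (sg1 1) 1 0 0"])
      (simp add: u_meet is_line_yline, simp add: yline_def sg0_def sg1_def)
  show "\<exists>p q. t_line c 0 0 \<inter> t_line c 0 1 = proj_point p \<and>
                 t_line c 1 0 \<inter> t_line c 1 1 = proj_point q \<and>
                 is_line zline \<and> zline = line_through p q"
    by (rule exI[of _ "pt (sg0 0) (sg1 0) (h + g) (1 + \<kappa>0) (1 + \<kappa>1)"],
        rule exI[of _ "pt (sg0 1) (sg1 1) (h + g) (1 + \<kappa>0) (1 + \<kappa>1)"])
      (simp add: t_meet is_line_zline, simp add: zline_def sg0_def sg1_def)
qed

end

section \<open>The base point of a birational map of type (1,2,2)\<close>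

lemma homogeneous_1_linear:
  fixes F :: "4 mpoly"
  assumes "homogeneous 1 F"
  obtains w :: pvec where "\<And>x. mpoly_eval F (($) x) = (\<Sum>l\<in>UNIV. w $ l * x $ l)"
proof -
  have mono: "mono_eval m v = (\<Sum>l\<in>UNIV. of_nat (Poly_Mapping.lookup m l) * v l)" if "mono_deg m = 1" for m :: "4 \<Rightarrow>\<^sub>0 nat" and v
  proof -
    have "\<exists>a. Poly_Mapping.lookup m a = 1 \<and> (\<forall>b. a \<noteq> b \<longrightarrow> Poly_Mapping.lookup m b = 0)"
      using that unfolding mono_deg_UNIV by (simp add: sum_eq_1_iff sum_eq_Suc0_iff)
    then obtain a where a: "Poly_Mapping.lookup m a = 1" "\<And>b. a \<noteq> b \<Longrightarrow> Poly_Mapping.lookup m b = 0"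
      by blast
    then have "m = Poly_Mapping.single a 1"
      by (intro poly_mapping_eqI) (metis lookup_single_eq lookup_single_not_eq)
    then show ?thesis
      by (simp add: mono_eval_def lookup_single when_def if_distrib[of complex_of_nat] if_distrib[of "\<lambda>x. x * _"] cong: if_cong)
  qed
  show thesis
  proof (rule that)
    fix x :: pvec
    have "mpoly_eval F (($) x) = (\<Sum>m\<in>Poly_Mapping.keys F. Poly_Mapping.lookup F m *
        (\<Sum>l\<in>UNIV. of_nat (Poly_Mapping.lookup m l) * x $ l))"
      unfolding mpoly_eval_mono using assms mono by (intro sum.cong) (auto simp: homogeneous_iff)
    also have "\<dots> = (\<Sum>l\<in>UNIV. (\<chi> l. \<Sum>m\<in>Poly_Mapping.keys F. Poly_Mapping.lookup F m *
        of_nat (Poly_Mapping.lookup m l)) $ l * x $ l)"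
      unfolding sum_distrib_left
      by (subst sum.swap) (simp add: sum_distrib_right mult.assoc)
    finally show "mpoly_eval F (($) x) = (\<Sum>l\<in>UNIV. (\<chi> l. \<Sum>m\<in>Poly_Mapping.keys F. Poly_Mapping.lookup F m *
        of_nat (Poly_Mapping.lookup m l)) $ l * x $ l)" .
  qed
qed

lemma tri_eval_expand:
  "tri_eval c s t u =
    (s $ 0 * t $ 0 * u $ 0) *s c $ 0 $ 0 $ 0 + (s $ 0 * t $ 0 * u $ 1) *s c $ 0 $ 0 $ 1
  + (s $ 0 * t $ 1 * u $ 0) *s c $ 0 $ 1 $ 0 + (s $ 0 * t $ 1 * u $ 1) *s c $ 0 $ 1 $ 1
  + (s $ 1 * t $ 0 * u $ 0) *s c $ 1 $ 0 $ 0 + (s $ 1 * t $ 0 * u $ 1) *s c $ 1 $ 0 $ 1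
  + (s $ 1 * t $ 1 * u $ 0) *s c $ 1 $ 1 $ 0 + (s $ 1 * t $ 1 * u $ 1) *s c $ 1 $ 1 $ 1"
  by (simp add: tri_eval_def sum_2' add.assoc)

lemma polyfun_tri_eval:
  assumes "\<And>i. polyfun (\<lambda>z. s z $ i)" "\<And>i. polyfun (\<lambda>z. t z $ i)" "\<And>i. polyfun (\<lambda>z. u z $ i)"
  shows "polyfun (\<lambda>z. mpoly_eval F (($) (tri_eval c (s z) (t z) (u z))))"
proof (rule polyfun_mpoly_eval)
  fix l
  show "polyfun (\<lambda>z. tri_eval c (s z) (t z) (u z) $ l)"
    unfolding tri_eval_def sum_component vector_smult_component
    by (intro polyfun_sum polyfun_mult assms polyfun_const)
qed

lemma polyfun_segment: "polyfun (\<lambda>z. (p + z *s (q - p)) $ i)"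
  unfolding vector_add_component vector_smult_component
  by (intro polyfun_add polyfun_mult polyfun_const polyfun_id)

lemma vec2_eq_iff: "x = (y :: complex ^ 2) \<longleftrightarrow> x $ 0 = y $ 0 \<and> x $ 1 = y $ 1"
  by (simp add: vec_eq_iff all_2')

lemma rank_one_factor:
  assumes "r00 * r11 = r01 * (r10 :: complex)"
  obtains t u :: "complex ^ 2" where "r00 = t $ 0 * u $ 0" "r01 = t $ 0 * u $ 1" "r10 = t $ 1 * u $ 0" "r11 = t $ 1 * u $ 1"
proof (cases "r00 = 0 \<and> r01 = 0")
  case True
  then show ?thesis by (intro that[of "vec2 0 1" "vec2 r10 r11"]) simp_all
next
  case False
  define k where "k = (if r00 \<noteq> 0 then r10 / r00 else r11 / r01)"
  have "r10 = k * r00" "r11 = k * r01"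
    using False assms by (auto simp: k_def field_simps)
  then show ?thesis by (intro that[of "vec2 1 k" "vec2 r00 r01"]) simp_all
qed

lemma common_ratio:
  fixes b0 :: complex
  assumes "b0 * t1 = b1 * t0" "b0 * a1 = b1 * a0" "b0 \<noteq> 0 \<or> b1 \<noteq> 0"
  shows "t0 * a1 = t1 * a0"
proof -
  have "b0 * (t0 * a1 - t1 * a0) = 0" "b1 * (t0 * a1 - t1 * a0) = 0" using assms(1,2) by algebra+
  then show ?thesis using assms(3) by auto
qed

text \<open>With \<open>a\<close> proportional to \<open>t\<close> and \<open>b\<close> to
  \<open>u\<close>, the difference of the tensors \<open>a\<close> \<otimes> \<open>b\<close> and
  \<open>t\<close> \<otimes> \<open>u\<close> has rank at most one.\<close>

lemma secant_relation:
  fixes t0 :: complex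
  assumes "t0 * a1 = t1 * a0" "u0 * b1 = u1 * b0"
  shows "(a0 * b0 - t0 * u0) * (a1 * b1 - t1 * u1) = (a0 * b1 - t0 * u1) * (a1 * b0 - t1 * u0)"
  using assms by algebra

text \<open>Four points of a plane satisfy a relation \<open>\<rho>\<close>. If \<open>\<rho>\<close> had rank two, the line through \<open>\<rho>\<close> and
  a general point \<open>t \<otimes> u\<close> of the Segre quadric would meet the quadric in a second point with the same
  image, contradicting the existence of a rational inverse. So \<open>\<rho>\<close> has rank one and is a base point.\<close>

lemma bilinear_base_point:
  fixes v00 v01 v10 v11 :: pvec and B C :: "2 \<Rightarrow> 4 mpoly"
  defines "\<phi> \<equiv> \<lambda>(t :: complex ^ 2) (u :: complex ^ 2). (t $ 0 * u $ 0) *s v00 + (t $ 0 * u $ 1) *s v01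
      + (t $ 1 * u $ 0) *s v10 + (t $ 1 * u $ 1) *s v11"
  assumes B: "\<And>t u. mpoly_eval (B 0) (($) (\<phi> t u)) * t $ 1 = mpoly_eval (B 1) (($) (\<phi> t u)) * t $ 0"
    and C: "\<And>t u. mpoly_eval (C 0) (($) (\<phi> t u)) * u $ 1 = mpoly_eval (C 1) (($) (\<phi> t u)) * u $ 0"
    and BC: "mpoly_eval (B i) (($) (\<phi> t' u')) \<noteq> 0" "mpoly_eval (C j) (($) (\<phi> t' u')) \<noteq> 0"
    and det: "det4 v00 v01 v10 v11 = 0"
  shows "\<exists>t u. t \<noteq> 0 \<and> u \<noteq> 0 \<and> \<phi> t u = 0"
proof -
  obtain r00 r01 r10 r11 where r: "r00 *s v00 + r01 *s v01 + r10 *s v10 + r11 *s v11 = 0"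
      "\<not> (r00 = 0 \<and> r01 = 0 \<and> r10 = 0 \<and> r11 = 0)"
    using det4_eq_0_imp_relation[OF det] by blast
  show ?thesis
  proof (cases "r00 * r11 = r01 * r10")
    case True
    then obtain t u :: "complex ^ 2" where tu: "r00 = t $ 0 * u $ 0" "r01 = t $ 0 * u $ 1" "r10 = t $ 1 * u $ 0" "r11 = t $ 1 * u $ 1"
      by (rule rank_one_factor)
    then have "\<phi> t u = 0" using r(1) by (simp add: \<phi>_def)
    moreover have "t \<noteq> 0" "u \<noteq> 0" using r(2) tu by auto
    ultimately show ?thesis by blast
  next
    case False
    define \<delta> where "\<delta> = r00 * r11 - r01 * r10"
    have \<delta>: "\<delta> \<noteq> 0" using False by (simp add: \<delta>_def)
    \<comment> \<open>The coefficient of z in the determinant of \<open>t\<close> \<otimes>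
      \<open>u\<close> plus z times \<rho>. The constant term is zero and the leading one is
      \<delta>, so the second intersection with the quadric is at \<open>- q t u / \<delta>\<close>.
      A rational inverse forces it to coincide with the first, that is,
      \<open>q t u = 0\<close>.\<close>
    define q where "q t u = t $ 0 * u $ 0 * r11 + t $ 1 * u $ 1 * r00 - t $ 0 * u $ 1 * r10 - t $ 1 * u $ 0 * r01"
      for t u :: "complex ^ 2"
    have q0: "q t u = 0" if nz: "mpoly_eval (B i) (($) (\<phi> t u)) \<noteq> 0" "mpoly_eval (C j) (($) (\<phi> t u)) \<noteq> 0" for t u
    proof -
      define z where "z = - q t u / \<delta>"
      have z: "z * \<delta> + q t u = 0" using \<delta> by (simp add: z_def)
      have "(t $ 0 * u $ 0 + z * r00) * (t $ 1 * u $ 1 + z * r11) - (t $ 0 * u $ 1 + z * r01) * (t $ 1 * u $ 0 + z * r10)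
          = z * (z * \<delta> + q t u)"
        by (simp add: \<delta>_def q_def algebra_simps)
      then have "(t $ 0 * u $ 0 + z * r00) * (t $ 1 * u $ 1 + z * r11) = (t $ 0 * u $ 1 + z * r01) * (t $ 1 * u $ 0 + z * r10)"
        using z by simp
      then obtain a b :: "complex ^ 2" where ab: "t $ 0 * u $ 0 + z * r00 = a $ 0 * b $ 0" "t $ 0 * u $ 1 + z * r01 = a $ 0 * b $ 1"
         "t $ 1 * u $ 0 + z * r10 = a $ 1 * b $ 0" "t $ 1 * u $ 1 + z * r11 = a $ 1 * b $ 1"
        by (rule rank_one_factor)
      have e: "z * r00 = a $ 0 * b $ 0 - t $ 0 * u $ 0" "z * r01 = a $ 0 * b $ 1 - t $ 0 * u $ 1"
         "z * r10 = a $ 1 * b $ 0 - t $ 1 * u $ 0" "z * r11 = a $ 1 * b $ 1 - t $ 1 * u $ 1"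
        using ab by (simp_all add: eq_diff_eq add.commute)
      have "\<phi> a b = \<phi> t u + z *s (r00 *s v00 + r01 *s v01 + r10 *s v10 + r11 *s v11)"
        unfolding \<phi>_def ab[symmetric] by (simp add: vec_eq_iff algebra_simps)
      then have same: "\<phi> a b = \<phi> t u" using r(1) by simp
      have "t $ 0 * a $ 1 = t $ 1 * a $ 0"
        using common_ratio[OF B[of t u] B[of a b, unfolded same]] nz(1) exhaust_2'[of i] by auto
      moreover have "u $ 0 * b $ 1 = u $ 1 * b $ 0"
        using common_ratio[OF C[of t u] C[of a b, unfolded same]] nz(2) exhaust_2'[of j] by auto
      ultimately have "(z * r00) * (z * r11) - (z * r01) * (z * r10) = 0"
        unfolding e by (simp add: secant_relation)
      then have "z * z * \<delta> = 0" by (simp add: \<delta>_def algebra_simps)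
      then show ?thesis using \<delta> z by simp
    qed
    \<comment> \<open>The coefficients of \<open>q\<close> are those of the nonzero relation up to
      sign and order, so one of the four pairs of axis vectors serves.\<close>
    obtain t u where "q t u \<noteq> 0"
      using r(2) by (metis (no_types, lifting) q_def axis2_nth mult_1 mult_zero_left add_0 diff_zero
          mult_zero_right diff_0 neg_equal_0_iff_equal add.right_neutral)
    have "\<exists>z. mpoly_eval (B i) (($) (\<phi> (t' + z *s (t - t')) (u' + z *s (u - u')))) *
        mpoly_eval (C j) (($) (\<phi> (t' + z *s (t - t')) (u' + z *s (u - u')))) \<noteq> 0 \<and>
        q (t' + z *s (t - t')) (u' + z *s (u - u')) \<noteq> 0"
    proof (rule polyfun_no_zero_divisors[where a = 0 and b = 1])
      have "polyfun (\<lambda>z. mpoly_eval F (($) (\<phi> (t' + z *s (t - t')) (u' + z *s (u - u')))))" for F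
        unfolding \<phi>_def
        by (rule polyfun_mpoly_eval, simp, intro polyfun_add polyfun_minus polyfun_mult polyfun_const polyfun_id)
      then show "polyfun (\<lambda>z. mpoly_eval (B i) (($) (\<phi> (t' + z *s (t - t')) (u' + z *s (u - u')))) *
        mpoly_eval (C j) (($) (\<phi> (t' + z *s (t - t')) (u' + z *s (u - u')))))"
        by (intro polyfun_mult)
      show "polyfun (\<lambda>z. q (t' + z *s (t - t')) (u' + z *s (u - u')))"
        unfolding q_def by (intro polyfun_add polyfun_minus polyfun_mult polyfun_const polyfun_segment)
    qed (use BC \<open>q t u \<noteq> 0\<close> in simp_all)
    then show ?thesis using q0 by auto
  qed
qed

text \<open>The determinant is a polynomial in z that is nonzero at 0. The extra vector
  \<open>vec2 0 1\<close> accounts for the direction at infinity.\<close>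

lemma finite_directions:
  assumes "det4 a0 a1 a2 a3 \<noteq> 0"
  shows "finite ({vec2 1 z | z. det4 (a0 + z *s b0) (a1 + z *s b1) (a2 + z *s b2) (a3 + z *s b3) = 0} \<union> {vec2 0 1})"
proof -
  let ?f = "\<lambda>z. det4 (a0 + z *s b0) (a1 + z *s b1) (a2 + z *s b2) (a3 + z *s b3)"
  have "polyfun ?f"
    unfolding det4_expand
    by (simp, intro polyfun_add polyfun_minus polyfun_mult polyfun_const polyfun_id)
  then have "finite {z. ?f z = 0}"
    using assms by (intro polyfun_finite_zeros[of _ 0]) simp_all
  then have "finite (vec2 1 ` {z. ?f z = 0})" by simp
  then show ?thesis by (simp add: image_def Collect_disj_eq setcompr_eq_image)
qed

text \<open>The Pluecker pairing of two of the lines in direction s; it is nonzero iff these are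
  skew.\<close>

definition bracket :: "trilinear \<Rightarrow> 2 \<Rightarrow> 2 \<Rightarrow> 2 \<Rightarrow> 2 \<Rightarrow> complex" where
  "bracket c j k j' k' = det4 (c $ 0 $ j $ k) (c $ 1 $ j $ k) (c $ 0 $ j' $ k') (c $ 1 $ j' $ k')"

text \<open>A base point \<open>(t, u)\<close> of the slice \<open>s\<close> with
  \<open>t $ 0 = 1\<close> and \<open>t $ 1 = z\<close> is a relation, with coefficients
  \<open>s $ i * u $ k\<close>, between the four vectors
  \<open>c $ i $ 0 $ k + z *s c $ i $ 1 $ k\<close>; so z is a root of a fixed nonzero polynomial,
  and likewise for \<open>u\<close>. By the pigeonhole principle one pair serves infinitely many
  slices, and linearity in \<open>s\<close> extends it to all.\<close>

lemma constant_base_point: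
  assumes inv: "is_inverse c A B C"
    and dep: "\<And>s :: complex ^ 2. s \<noteq> 0 \<Longrightarrow> det4 (s $ 0 *s c $ 0 $ 0 $ 0 + s $ 1 *s c $ 1 $ 0 $ 0) (s $ 0 *s c $ 0 $ 0 $ 1 + s $ 1 *s c $ 1 $ 0 $ 1)
        (s $ 0 *s c $ 0 $ 1 $ 0 + s $ 1 *s c $ 1 $ 1 $ 0) (s $ 0 *s c $ 0 $ 1 $ 1 + s $ 1 *s c $ 1 $ 1 $ 1) = 0"
    and br: "bracket c 0 0 0 1 \<noteq> 0" "bracket c 0 0 1 0 \<noteq> 0"
  shows "\<exists>t u. t \<noteq> 0 \<and> u \<noteq> 0 \<and> (\<forall>s. tri_eval c s t u = 0)"
proof -
  let ?\<phi> = "tri_eval c"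
  have B: "mpoly_eval (B 0) (($) (?\<phi> s t u)) * t $ 1 = mpoly_eval (B 1) (($) (?\<phi> s t u)) * t $ 0" for s t u
    using inv unfolding is_inverse_def same_rational_map_def pair_eval_def by auto
  have C: "mpoly_eval (C 0) (($) (?\<phi> s t u)) * u $ 1 = mpoly_eval (C 1) (($) (?\<phi> s t u)) * u $ 0" for s t u
    using inv unfolding is_inverse_def same_rational_map_def pair_eval_def by auto
  have "\<exists>s t u. pair_eval B (?\<phi> s t u) \<noteq> 0" "\<exists>s t u. pair_eval C (?\<phi> s t u) \<noteq> 0"
    using inv unfolding is_inverse_def same_rational_map_def by auto
  then obtain i s1 t1 u1 j s2 t2 u2 where nz1: "mpoly_eval (B i) (($) (?\<phi> s1 t1 u1)) \<noteq> 0"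
      and nz2: "mpoly_eval (C j) (($) (?\<phi> s2 t2 u2)) \<noteq> 0"
    by (auto simp: pair_eval_def vec_eq_iff)
  let ?b = "\<lambda>s t u. mpoly_eval (B i) (($) (?\<phi> s t u))" and ?c = "\<lambda>s t u. mpoly_eval (C j) (($) (?\<phi> s t u))"
  have seg: "polyfun (\<lambda>z. mpoly_eval F (($) (?\<phi> (s + z *s (s' - s)) (t + z *s (t' - t)) (u + z *s (u' - u)))))"
    for F s s' t t' u u'
    by (intro polyfun_tri_eval polyfun_segment)
  obtain s3 t3 u3 where nz3: "?b s3 t3 u3 \<noteq> 0" "?c s3 t3 u3 \<noteq> 0"
    using polyfun_no_zero_divisors[OF seg[of "B i" s1 s2 t1 t2 u1 u2] seg[of "C j" s1 s2 t1 t2 u1 u2], of 0 1] nz1 nz2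
    by auto
  \<comment> \<open>The first coordinate of \<open>s\<close> must be nonzero for \<open>S z\<close>
    to run through distinct points of the projective line.\<close>
  have "\<exists>z. ?b (s3 + z *s (axis 0 1 - s3)) (t3 + z *s (t3 - t3)) (u3 + z *s (u3 - u3)) *
      ?c (s3 + z *s (axis 0 1 - s3)) (t3 + z *s (t3 - t3)) (u3 + z *s (u3 - u3)) \<noteq> 0 \<and>
      (s3 + z *s (axis 0 1 - s3)) $ 0 \<noteq> 0"
    by (rule polyfun_no_zero_divisors[where a = 0 and b = 1, OF polyfun_mult[OF seg seg] polyfun_segment])
      (use nz3 in simp_all)
  then obtain s t u where nz: "?b s t u \<noteq> 0" "?c s t u \<noteq> 0" "s $ 0 \<noteq> 0" by auto
  define S where "S z = s + z *s (axis 1 1)" for z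
  have S: "S z $ 0 = s $ 0" "S z $ 1 = s $ 1 + z" "S z \<noteq> 0" for z
    using nz(3) by (auto simp: S_def vec2_eq_iff)
  define Zs where "Zs = {z. ?b (S z) t u \<noteq> 0 \<and> ?c (S z) t u \<noteq> 0}"
  have "infinite Zs"
  proof -
    have S_seg: "S z = s + z *s ((s + axis 1 1) - s)" for z by (simp add: S_def)
    have "polyfun (\<lambda>z. mpoly_eval F (($) (?\<phi> (S z) t u)))" for F
      using seg[of F s "s + axis 1 1" t t u u] unfolding S_seg by simp
    then have "finite {z. ?b (S z) t u = 0}" "finite {z. ?c (S z) t u = 0}"
      using nz by (auto intro!: polyfun_finite_zeros[of _ 0] simp: S_def)
    moreover have "UNIV \<subseteq> Zs \<union> {z. ?b (S z) t u = 0} \<union> {z. ?c (S z) t u = 0}"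
      by (auto simp: Zs_def)
    ultimately show ?thesis
      by (metis finite_Un finite_subset infinite_UNIV_char_0)
  qed
  \<comment> \<open>The finitely many candidates for the two components. At z = 0 the determinants
    are \<open>bracket c 0 0 0 1\<close> and \<open>bracket c 0 0 1 0\<close>.\<close>
  define RT where "RT = {vec2 1 z | z. det4 (c $ 0 $ 0 $ 0 + z *s c $ 0 $ 1 $ 0) (c $ 1 $ 0 $ 0 + z *s c $ 1 $ 1 $ 0)
      (c $ 0 $ 0 $ 1 + z *s c $ 0 $ 1 $ 1) (c $ 1 $ 0 $ 1 + z *s c $ 1 $ 1 $ 1) = 0} \<union> {vec2 0 1}"
  define RU where "RU = {vec2 1 z | z. det4 (c $ 0 $ 0 $ 0 + z *s c $ 0 $ 0 $ 1) (c $ 1 $ 0 $ 0 + z *s c $ 1 $ 0 $ 1)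
      (c $ 0 $ 1 $ 0 + z *s c $ 0 $ 1 $ 1) (c $ 1 $ 1 $ 0 + z *s c $ 1 $ 1 $ 1) = 0} \<union> {vec2 0 1}"
  have fin: "finite (RT \<times> RU)"
    unfolding RT_def RU_def using br by (intro finite_cartesian_product finite_directions) (simp_all add: bracket_def)
  have base: "\<exists>tu\<in>RT \<times> RU. ?\<phi> (S z) (fst tu) (snd tu) = 0" if "z \<in> Zs" for z
  proof -
    have split: "?\<phi> (S z) t u = (t $ 0 * u $ 0) *s (S z $ 0 *s c $ 0 $ 0 $ 0 + S z $ 1 *s c $ 1 $ 0 $ 0)
      + (t $ 0 * u $ 1) *s (S z $ 0 *s c $ 0 $ 0 $ 1 + S z $ 1 *s c $ 1 $ 0 $ 1)
      + (t $ 1 * u $ 0) *s (S z $ 0 *s c $ 0 $ 1 $ 0 + S z $ 1 *s c $ 1 $ 1 $ 0)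
      + (t $ 1 * u $ 1) *s (S z $ 0 *s c $ 0 $ 1 $ 1 + S z $ 1 *s c $ 1 $ 1 $ 1)" for t u
      unfolding tri_eval_expand by (simp add: vec_eq_iff algebra_simps)
    have "\<exists>t u. t \<noteq> 0 \<and> u \<noteq> 0 \<and> ?\<phi> (S z) t u = 0"
      unfolding split
      by (rule bilinear_base_point[where B = B and C = C and i = i and j = j and t' = t and u' = u])
        (use B[of "S z"] C[of "S z"] that dep[OF S(3)] in \<open>simp_all add: split Zs_def\<close>)
    then obtain t u where tu: "t \<noteq> 0" "u \<noteq> 0" "?\<phi> (S z) t u = 0" by blast
    obtain k t' where t': "t = k *s t'" "k \<noteq> 0" "t' = vec2 0 1 \<or> t' $ 0 = 1 \<and> t' = vec2 1 (t' $ 1)"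
    proof (cases "t $ 0 = 0")
      case True
      then show ?thesis using tu(1) by (intro that[of "t $ 1" "vec2 0 1"]) (auto simp: vec2_eq_iff)
    next
      case False
      then show ?thesis by (intro that[of "t $ 0" "vec2 1 (t $ 1 / t $ 0)"]) (auto simp: vec2_eq_iff)
    qed
    obtain l u' where u': "u = l *s u'" "l \<noteq> 0" "u' = vec2 0 1 \<or> u' $ 0 = 1 \<and> u' = vec2 1 (u' $ 1)"
    proof (cases "u $ 0 = 0")
      case True
      then show ?thesis using tu(2) by (intro that[of "u $ 1" "vec2 0 1"]) (auto simp: vec2_eq_iff)
    next
      case False
      then show ?thesis by (intro that[of "u $ 0" "vec2 1 (u $ 1 / u $ 0)"]) (auto simp: vec2_eq_iff)
    qed
    have "(k * l) *s ?\<phi> (S z) t' u' = ?\<phi> (S z) t u"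
      unfolding tri_eval_expand t' u' by (simp add: vec_eq_iff algebra_simps)
    then have 0: "?\<phi> (S z) t' u' = 0" using tu(3) t'(2) u'(2) by simp
    have nz: "t' \<noteq> 0" "u' \<noteq> 0" using tu t' u' by auto
    have "t' \<in> RT"
    proof (cases "t' = vec2 0 1")
      case False
      then have t0: "t' $ 0 = 1" "t' = vec2 1 (t' $ 1)" using t'(3) by auto
      have "(S z $ 0 * u' $ 0) *s (c $ 0 $ 0 $ 0 + t' $ 1 *s c $ 0 $ 1 $ 0) + (S z $ 1 * u' $ 0) *s (c $ 1 $ 0 $ 0 + t' $ 1 *s c $ 1 $ 1 $ 0)
        + (S z $ 0 * u' $ 1) *s (c $ 0 $ 0 $ 1 + t' $ 1 *s c $ 0 $ 1 $ 1) + (S z $ 1 * u' $ 1) *s (c $ 1 $ 0 $ 1 + t' $ 1 *s c $ 1 $ 1 $ 1)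
        = ?\<phi> (S z) t' u'"
        unfolding tri_eval_expand by (simp add: vec_eq_iff algebra_simps t0(1))
      then have "det4 (c $ 0 $ 0 $ 0 + t' $ 1 *s c $ 0 $ 1 $ 0) (c $ 1 $ 0 $ 0 + t' $ 1 *s c $ 1 $ 1 $ 0)
         (c $ 0 $ 0 $ 1 + t' $ 1 *s c $ 0 $ 1 $ 1) (c $ 1 $ 0 $ 1 + t' $ 1 *s c $ 1 $ 1 $ 1) = 0"
        using 0 nz S nz by (intro det4_relation_imp_0) (auto simp: vec2_eq_iff \<open>s $ 0 \<noteq> 0\<close>)
      then show ?thesis unfolding RT_def using t0(2) by blast
    qed (simp add: RT_def)
    moreover have "u' \<in> RU"
    proof (cases "u' = vec2 0 1")
      case False
      then have u0: "u' $ 0 = 1" "u' = vec2 1 (u' $ 1)" using u'(3) by auto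
      have "(S z $ 0 * t' $ 0) *s (c $ 0 $ 0 $ 0 + u' $ 1 *s c $ 0 $ 0 $ 1) + (S z $ 1 * t' $ 0) *s (c $ 1 $ 0 $ 0 + u' $ 1 *s c $ 1 $ 0 $ 1)
        + (S z $ 0 * t' $ 1) *s (c $ 0 $ 1 $ 0 + u' $ 1 *s c $ 0 $ 1 $ 1) + (S z $ 1 * t' $ 1) *s (c $ 1 $ 1 $ 0 + u' $ 1 *s c $ 1 $ 1 $ 1)
        = ?\<phi> (S z) t' u'"
        unfolding tri_eval_expand by (simp add: vec_eq_iff algebra_simps u0(1))
      then have "det4 (c $ 0 $ 0 $ 0 + u' $ 1 *s c $ 0 $ 0 $ 1) (c $ 1 $ 0 $ 0 + u' $ 1 *s c $ 1 $ 0 $ 1)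
         (c $ 0 $ 1 $ 0 + u' $ 1 *s c $ 0 $ 1 $ 1) (c $ 1 $ 1 $ 0 + u' $ 1 *s c $ 1 $ 1 $ 1) = 0"
        using 0 nz S nz by (intro det4_relation_imp_0) (auto simp: vec2_eq_iff \<open>s $ 0 \<noteq> 0\<close>)
      then show ?thesis unfolding RU_def using u0(2) by blast
    qed (simp add: RU_def)
    ultimately show ?thesis using 0 by (intro bexI[of _ "(t', u')"]) auto
  qed
  obtain tu where tu: "tu \<in> RT \<times> RU" "infinite {z \<in> Zs. ?\<phi> (S z) (fst tu) (snd tu) = 0}"
    using pigeonhole_infinite_rel[OF \<open>infinite Zs\<close> fin, of "\<lambda>z tu. ?\<phi> (S z) (fst tu) (snd tu) = 0"] base by blast
  define t0 u0 where "t0 = fst tu" and "u0 = snd tu"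
  obtain z1 where z1: "?\<phi> (S z1) t0 u0 = 0" using tu(2) infinite_imp_nonempty unfolding t0_def u0_def by blast
  have "infinite ({z \<in> Zs. ?\<phi> (S z) t0 u0 = 0} - {z1})" using tu(2) by (simp add: t0_def u0_def)
  then obtain z2 where z2: "z2 \<noteq> z1" "?\<phi> (S z2) t0 u0 = 0" using infinite_imp_nonempty by blast
  have lin: "?\<phi> s' t0 u0 = s' $ 0 *s ?\<phi> (axis 0 1) t0 u0 + s' $ 1 *s ?\<phi> (axis 1 1) t0 u0" for s'
    unfolding tri_eval_expand by (simp add: vec_eq_iff algebra_simps)
  \<comment> \<open>Two distinct slices with the same base point already make both coefficients of
    the linear map in \<open>s\<close> vanish.\<close>
  have "(z2 - z1) *s ?\<phi> (axis 1 1) t0 u0 = ?\<phi> (S z2) t0 u0 - ?\<phi> (S z1) t0 u0"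
    unfolding lin[of "S z1"] lin[of "S z2"] by (simp add: S vec_eq_iff algebra_simps)
  then have 1: "?\<phi> (axis 1 1) t0 u0 = 0" using z1 z2 by simp
  then have "s $ 0 *s ?\<phi> (axis 0 1) t0 u0 = 0" using z1 lin[of "S z1"] S by simp
  then have "?\<phi> (axis 0 1) t0 u0 = 0" using nz(3) by (simp only: vec.scale_eq_0_iff) simp
  then have "?\<phi> s t0 u0 = 0" for s unfolding lin[of s] 1 by simp
  moreover have "t0 \<noteq> 0" "u0 \<noteq> 0" using tu(1) by (auto simp: t0_def u0_def RT_def RU_def vec2_eq_iff)
  ultimately show ?thesis by (intro exI[of _ t0] exI[of _ u0] conjI allI)
qed

section \<open>Reduction to the normal form\<close>

text \<open>With D and the two products in the role of the three products of complementary brackets,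
  the left side is the determinant of a symmetric 4 by 4 matrix with zero diagonal. It splits into
  the discriminant of K and the square of the expression that separates the two cross
  ratios.\<close>

lemma gram_identity:
  fixes h g T D :: complex
  shows "(D - (h\<^sup>2 * D - h * g * T + g\<^sup>2) * ((1 - h)\<^sup>2 * D + (1 - h) * (1 + g) * T + (1 + g)\<^sup>2)
      - (h\<^sup>2 * D - h * (1 + g) * T + (1 + g)\<^sup>2) * ((1 - h)\<^sup>2 * D + (1 - h) * g * T + g\<^sup>2))\<^sup>2
    - 4 * ((h\<^sup>2 * D - h * g * T + g\<^sup>2) * ((1 - h)\<^sup>2 * D + (1 - h) * (1 + g) * T + (1 + g)\<^sup>2))
      * ((h\<^sup>2 * D - h * (1 + g) * T + (1 + g)\<^sup>2) * ((1 - h)\<^sup>2 * D + (1 - h) * g * T + g\<^sup>2))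
    = (T\<^sup>2 - 4 * D) * (g * (1 + g) + h * (1 - h) * D)\<^sup>2"
  by algebra

text \<open>In the notation of the normal form, \<open>k1, \<dots>, k4\<close> are the entries of the matrix whose eigenvalues are
  \<open>\<kappa>0\<close> and \<open>\<kappa>1\<close>, and its eigenvectors are the two values of \<open>s\<close> whose planes contain the lines
  \<open>r\<^sub>0\<close> and \<open>r\<^sub>1\<close>.\<close>

lemma diagonalize:
  fixes p q A B :: pvec and a00 a01 a10 a11 b00 b01 b10 b11 :: pvec
  assumes basis: "det4 p q A B \<noteq> 0"
    and a: "a00 = h *s p + A" "a01 = (1 - h) *s p - A" "a10 = g *s p + k1 *s A + k2 *s B"
      "a11 = - (1 + g) *s p - k1 *s A - k2 *s B"
    and b: "b00 = h *s q + B" "b01 = (1 - h) *s q - B" "b10 = g *s q + k3 *s A + k4 *s B"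
      "b11 = - (1 + g) *s q - k3 *s A - k4 *s B"
    and T: "T = k1 + k4" and D: "D = k1 * k4 - k2 * k3"
    and k: "k2 \<noteq> 0" "k3 \<noteq> 0" and disc: "T\<^sup>2 - 4 * D \<noteq> 0"
  obtains M f0 f1 g0 g1 \<sigma>00 \<sigma>01 \<sigma>10 \<sigma>11 \<kappa>0 \<kappa>1 where
    "coords M f0 f1 g0 g1" "\<kappa>0 + \<kappa>1 = T" "\<kappa>0 * \<kappa>1 = D" "\<kappa>0 \<noteq> \<kappa>1"
    "\<sigma>00 \<noteq> 0" "\<sigma>01 \<noteq> 0" "\<sigma>10 \<noteq> 0" "\<sigma>11 \<noteq> 0" "\<sigma>00 * \<sigma>11 - \<sigma>01 * \<sigma>10 \<noteq> 0"
    "a00 = \<sigma>00 *s (h *s f0 + g0) + \<sigma>01 *s (h *s f1 + g1)"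
    "a01 = \<sigma>00 *s ((1 - h) *s f0 - g0) + \<sigma>01 *s ((1 - h) *s f1 - g1)"
    "a10 = \<sigma>00 *s (g *s f0 + \<kappa>0 *s g0) + \<sigma>01 *s (g *s f1 + \<kappa>1 *s g1)"
    "a11 = - (\<sigma>00 *s ((1 + g) *s f0 + \<kappa>0 *s g0) + \<sigma>01 *s ((1 + g) *s f1 + \<kappa>1 *s g1))"
    "b00 = \<sigma>10 *s (h *s f0 + g0) + \<sigma>11 *s (h *s f1 + g1)"
    "b01 = \<sigma>10 *s ((1 - h) *s f0 - g0) + \<sigma>11 *s ((1 - h) *s f1 - g1)"
    "b10 = \<sigma>10 *s (g *s f0 + \<kappa>0 *s g0) + \<sigma>11 *s (g *s f1 + \<kappa>1 *s g1)"
    "b11 = - (\<sigma>10 *s ((1 + g) *s f0 + \<kappa>0 *s g0) + \<sigma>11 *s ((1 + g) *s f1 + \<kappa>1 *s g1))"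
proof -
  define r where "r = csqrt (T\<^sup>2 - 4 * D)"
  have r2: "r * r = T * T - 4 * D" using power2_csqrt[of "T\<^sup>2 - 4 * D"] by (simp add: r_def power2_eq_square)
  have r: "r \<noteq> 0" using disc by (simp add: r_def)
  define \<kappa>0 \<kappa>1 where "\<kappa>0 = (T + r) / 2" and "\<kappa>1 = (T - r) / 2"
  have sum: "\<kappa>0 + \<kappa>1 = T" and diff: "\<kappa>0 - \<kappa>1 = r" by (simp_all add: \<kappa>0_def \<kappa>1_def field_simps)
  have "4 * (\<kappa>0 * \<kappa>1) = T * T - r * r" by (simp add: \<kappa>0_def \<kappa>1_def field_simps)
  then have prod: "\<kappa>0 * \<kappa>1 = D" using r2 by simp
  \<comment> \<open>The characteristic polynomial evaluated at \<open>k1\<close>. It makes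
    \<open>\<sigma>00\<close> and \<open>\<sigma>01\<close> nonzero because \<open>k2\<close> and
    \<open>k3\<close> are.\<close>
  have kk: "(k1 - \<kappa>1) * (\<kappa>0 - k1) = k2 * k3"
    using sum prod T D by algebra
  define n where "n = 1 / (k3 * r)"
  have n: "n * k3 * r = 1" using k r by (simp add: n_def)
  define \<sigma>00 \<sigma>01 where "\<sigma>00 = k1 - \<kappa>1" and "\<sigma>01 = \<kappa>0 - k1"
  have \<sigma>: "\<sigma>00 + \<sigma>01 = r" "\<sigma>00 * \<sigma>01 = k2 * k3" using diff kk by (simp_all add: \<sigma>00_def \<sigma>01_def)
  have \<kappa>\<sigma>: "\<kappa>0 = k1 + \<sigma>01" "\<kappa>1 = k1 - \<sigma>00" by (simp_all add: \<sigma>00_def \<sigma>01_def)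
  \<comment> \<open>\<open>k3 *s A + \<sigma>01 *s B\<close> and
    \<open>k3 *s A - \<sigma>00 *s B\<close> are eigenvectors of K for \<kappa>0 and \<kappa>1;
    \<open>f0\<close>, \<open>f1\<close> are the same combinations of \<open>p\<close>,
    \<open>q\<close>. The scalar \<open>n\<close> is chosen so that \<open>p\<close> and
    \<open>q\<close> get the coordinates \<open>\<sigma>00\<close>, \<open>\<sigma>01\<close> and
    \<open>k3\<close>, \<open>- k3\<close>.\<close>
  define f0 f1 where "f0 = (n * k3) *s p + (n * \<sigma>01) *s q" and "f1 = (n * k3) *s p - (n * \<sigma>00) *s q"
  define g0 g1 where "g0 = (n * k3) *s A + (n * \<sigma>01) *s B" and "g1 = (n * k3) *s A - (n * \<sigma>00) *s B"
  have "det4 f0 f1 g0 g1 = det4 (vec4 (n * k3) (n * \<sigma>01) 0 0) (vec4 (n * k3) (- (n * \<sigma>00)) 0 0)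
      (vec4 0 0 (n * k3) (n * \<sigma>01)) (vec4 0 0 (n * k3) (- (n * \<sigma>00))) * det4 p q A B"
    unfolding det4_combination[symmetric] by (simp add: f0_def f1_def g0_def g1_def)
  also have "det4 (vec4 (n * k3) (n * \<sigma>01) 0 0) (vec4 (n * k3) (- (n * \<sigma>00)) 0 0)
      (vec4 0 0 (n * k3) (n * \<sigma>01)) (vec4 0 0 (n * k3) (- (n * \<sigma>00))) = (n * k3 * n * (\<sigma>00 + \<sigma>01))\<^sup>2"
    unfolding det4_expand vec4_nth by (simp add: power2_eq_square algebra_simps)
  also have "n * k3 * n * (\<sigma>00 + \<sigma>01) = n" using n \<sigma>(1) by (simp add: mult_ac)
  finally have "det4 f0 f1 g0 g1 = n\<^sup>2 * det4 p q A B" .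
  moreover have "n \<noteq> 0" using k r by (simp add: n_def)
  ultimately have "det4 f0 f1 g0 g1 \<noteq> 0" using basis by simp
  then have "\<exists>M. coords M f0 f1 g0 g1"
  proof (rule det4_coordinates)
    fix M :: "complex ^ 4 ^ 4"
    assume "\<And>x. x = (M *v x) $ 0 *s f0 + (M *v x) $ 1 *s f1 + (M *v x) $ 2 *s g0 + (M *v x) $ 3 *s g1"
      "\<And>a b c d. M *v (a *s f0 + b *s f1 + c *s g0 + d *s g1) = vec4 a b c d"
    then have "coords M f0 f1 g0 g1" by (rule coords.intro)
    then show "\<exists>M. coords M f0 f1 g0 g1" ..
  qed
  then obtain M where "coords M f0 f1 g0 g1" ..
  moreover note sum prod
  moreover have "\<kappa>0 \<noteq> \<kappa>1" using diff r by (metis diff_self)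
  moreover have "\<sigma>00 \<noteq> 0" "\<sigma>01 \<noteq> 0" "k3 \<noteq> 0" "- k3 \<noteq> 0" using \<sigma>(2) k by auto
  moreover have "\<sigma>00 * (- k3) - \<sigma>01 * k3 \<noteq> 0"
  proof -
    have "\<sigma>00 * (- k3) - \<sigma>01 * k3 = - (k3 * r)" unfolding \<sigma>(1)[symmetric] by (simp add: algebra_simps)
    then show ?thesis using k r by simp
  qed
  moreover
  have pq: "p = \<sigma>00 *s f0 + \<sigma>01 *s f1" "A = \<sigma>00 *s g0 + \<sigma>01 *s g1"
     "q = k3 *s f0 - k3 *s f1" "B = k3 *s g0 - k3 *s g1"
  proof -
    have 1: "\<sigma>00 * (n * k3) + \<sigma>01 * (n * k3) = 1" "k3 * (n * \<sigma>01) + k3 * (n * \<sigma>00) = 1"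
      using n \<sigma>(1) by algebra+
    have "\<sigma>00 *s f0 + \<sigma>01 *s f1 = (\<sigma>00 * (n * k3) + \<sigma>01 * (n * k3)) *s p"
      "\<sigma>00 *s g0 + \<sigma>01 *s g1 = (\<sigma>00 * (n * k3) + \<sigma>01 * (n * k3)) *s A"
      "k3 *s f0 - k3 *s f1 = (k3 * (n * \<sigma>01) + k3 * (n * \<sigma>00)) *s q"
      "k3 *s g0 - k3 *s g1 = (k3 * (n * \<sigma>01) + k3 * (n * \<sigma>00)) *s B"
      unfolding f0_def f1_def g0_def g1_def by (simp_all add: vec_eq_iff algebra_simps)
    then show "p = \<sigma>00 *s f0 + \<sigma>01 *s f1" "A = \<sigma>00 *s g0 + \<sigma>01 *s g1"
       "q = k3 *s f0 - k3 *s f1" "B = k3 *s g0 - k3 *s g1" unfolding 1 by simp_all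
  qed
  have KA: "k1 *s A + k2 *s B = (\<sigma>00 * \<kappa>0) *s g0 + (\<sigma>01 * \<kappa>1) *s g1"
  proof -
    have "k1 * \<sigma>00 + k2 * k3 = \<sigma>00 * \<kappa>0" "k1 * \<sigma>01 - k2 * k3 = \<sigma>01 * \<kappa>1"
      using \<sigma>(2) \<kappa>\<sigma> by algebra+
    moreover have "k1 *s A + k2 *s B = (k1 * \<sigma>00 + k2 * k3) *s g0 + (k1 * \<sigma>01 - k2 * k3) *s g1"
      unfolding pq(2,4) by (simp add: vec_eq_iff algebra_simps)
    ultimately show ?thesis by simp
  qed
  have KB: "k3 *s A + k4 *s B = (k3 * \<kappa>0) *s g0 - (k3 * \<kappa>1) *s g1"
  proof -
    have "\<sigma>00 + k4 = \<kappa>0" "\<sigma>01 - k4 = - \<kappa>1" using sum T by (simp_all add: \<sigma>00_def \<sigma>01_def algebra_simps)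
    then have "k3 * (\<sigma>00 + k4) = k3 * \<kappa>0" "k3 * (\<sigma>01 - k4) = k3 * (- \<kappa>1)" by simp_all
    then have "k3 * \<sigma>00 + k4 * k3 = k3 * \<kappa>0" "k3 * \<sigma>01 - k4 * k3 = - k3 * \<kappa>1"
      by (simp_all add: algebra_simps)
    moreover have "k3 *s A + k4 *s B = (k3 * \<sigma>00 + k4 * k3) *s g0 + (k3 * \<sigma>01 - k4 * k3) *s g1"
      unfolding pq(2,4) by (simp add: vec_eq_iff algebra_simps)
    ultimately show ?thesis by (simp add: vec_eq_iff)
  qed
  have "a00 = \<sigma>00 *s (h *s f0 + g0) + \<sigma>01 *s (h *s f1 + g1)"
    "a01 = \<sigma>00 *s ((1 - h) *s f0 - g0) + \<sigma>01 *s ((1 - h) *s f1 - g1)"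
    "b00 = k3 *s (h *s f0 + g0) + (- k3) *s (h *s f1 + g1)"
    "b01 = k3 *s ((1 - h) *s f0 - g0) + (- k3) *s ((1 - h) *s f1 - g1)"
    unfolding a b pq by (simp_all add: vec_eq_iff algebra_simps)
  moreover have "a10 = \<sigma>00 *s (g *s f0 + \<kappa>0 *s g0) + \<sigma>01 *s (g *s f1 + \<kappa>1 *s g1)"
    "a11 = - (\<sigma>00 *s ((1 + g) *s f0 + \<kappa>0 *s g0) + \<sigma>01 *s ((1 + g) *s f1 + \<kappa>1 *s g1))"
  proof -
    have "a10 = g *s p + (k1 *s A + k2 *s B)" "a11 = - (1 + g) *s p - (k1 *s A + k2 *s B)"
      unfolding a by (simp_all add: vec_eq_iff)
    then show "a10 = \<sigma>00 *s (g *s f0 + \<kappa>0 *s g0) + \<sigma>01 *s (g *s f1 + \<kappa>1 *s g1)"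
      "a11 = - (\<sigma>00 *s ((1 + g) *s f0 + \<kappa>0 *s g0) + \<sigma>01 *s ((1 + g) *s f1 + \<kappa>1 *s g1))"
      unfolding KA pq(1) by (simp_all add: vec_eq_iff algebra_simps)
  qed
  moreover have "b10 = k3 *s (g *s f0 + \<kappa>0 *s g0) + (- k3) *s (g *s f1 + \<kappa>1 *s g1)"
    "b11 = - (k3 *s ((1 + g) *s f0 + \<kappa>0 *s g0) + (- k3) *s ((1 + g) *s f1 + \<kappa>1 *s g1))"
  proof -
    have "b10 = g *s q + (k3 *s A + k4 *s B)" "b11 = - (1 + g) *s q - (k3 *s A + k4 *s B)"
      unfolding b by (simp_all add: vec_eq_iff)
    then show "b10 = k3 *s (g *s f0 + \<kappa>0 *s g0) + (- k3) *s (g *s f1 + \<kappa>1 *s g1)"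
      "b11 = - (k3 *s ((1 + g) *s f0 + \<kappa>0 *s g0) + (- k3) *s ((1 + g) *s f1 + \<kappa>1 *s g1))"
      unfolding KB pq(3) by (simp_all add: vec_eq_iff algebra_simps)
  qed
  ultimately show thesis
    by (intro that[of M f0 f1 g0 g1 \<kappa>0 \<kappa>1 \<sigma>00 \<sigma>01 k3 "- k3"])
qed

text \<open>The determinant of a block matrix with scalar blocks h I and g I in the first column and
  blocks X, Y in the second is that of h Y - g X.\<close>

lemma block_det:
  fixes p q A B :: pvec
  shows "det4 (h *s p + x1 *s A + x2 *s B) (h *s q + x3 *s A + x4 *s B)
      (g *s p + y1 *s A + y2 *s B) (g *s q + y3 *s A + y4 *s B)
    = ((h * y1 - g * x1) * (h * y4 - g * x4) - (h * y2 - g * x2) * (h * y3 - g * x3)) * det4 p q A B"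
proof -
  have "det4 (h *s p + x1 *s A + x2 *s B) (h *s q + x3 *s A + x4 *s B)
      (g *s p + y1 *s A + y2 *s B) (g *s q + y3 *s A + y4 *s B)
    = det4 (vec4 h 0 x1 x2) (vec4 0 h x3 x4) (vec4 g 0 y1 y2) (vec4 0 g y3 y4) * det4 p q A B"
    unfolding det4_combination[symmetric] by simp
  also have "det4 (vec4 h 0 x1 x2) (vec4 0 h x3 x4) (vec4 g 0 y1 y2) (vec4 0 g y3 y4)
    = (h * y1 - g * x1) * (h * y4 - g * x4) - (h * y2 - g * x2) * (h * y3 - g * x3)"
    unfolding det4_expand vec4_nth by (simp add: algebra_simps)
  finally show ?thesis .
qed

text \<open>The vectors \<open>a\<close> and \<open>b\<close> stand for the control points with i =
  0 and i = 1, rescaled so that the base point gives the zero sums; \<alpha> and \<beta> are the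
  linear forms of the inverse. These forms dictate the coefficients of \<open>p\<close> and
  \<open>q\<close> in every vertex, and only a 2 by 2 matrix on the line \<alpha> = \<beta> = 0,
  spanned by \<open>A\<close> and \<open>B\<close>, remains free.\<close>

lemma reduce_to_coordinates:
  fixes a00 a01 a10 a11 b00 b01 b10 b11 wa wb :: pvec
  defines "\<alpha> \<equiv> \<lambda>x :: pvec. \<Sum>l\<in>UNIV. wa $ l * x $ l" and "\<beta> \<equiv> \<lambda>x :: pvec. \<Sum>l\<in>UNIV. wb $ l * x $ l"
  assumes sum: "a00 + a01 + a10 + a11 = 0" "b00 + b01 + b10 + b11 = 0"
    and \<alpha>: "\<alpha> a00 = e00" "\<alpha> a01 = e01" "\<alpha> a10 = e10" "\<alpha> a11 = e11" "\<alpha> b00 = 0" "\<alpha> b01 = 0" "\<alpha> b10 = 0" "\<alpha> b11 = 0"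
    and \<beta>: "\<beta> b00 = e00" "\<beta> b01 = e01" "\<beta> b10 = e10" "\<beta> b11 = e11" "\<beta> a00 = 0" "\<beta> a01 = 0" "\<beta> a10 = 0" "\<beta> a11 = 0"
    and e: "e00 \<noteq> 0" "e01 \<noteq> 0" "e10 \<noteq> 0" "e11 \<noteq> 0" "e00 * e11 - e01 * e10 \<noteq> 0"
    and T_nz: "det4 a00 b00 a01 b01 \<noteq> 0" "det4 a10 b10 a11 b11 \<noteq> 0"
    and Y_nz: "det4 a00 b00 a10 b10 \<noteq> 0" "det4 a01 b01 a11 b11 \<noteq> 0"
    and vert_nz: "det4 a00 a01 a10 b00 \<noteq> 0" "det4 b00 b01 b10 a00 \<noteq> 0"
    and gram: "(det4 a00 b00 a01 b01 * det4 a10 b10 a11 b11 - det4 a00 b00 a10 b10 * det4 a01 b01 a11 b11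
         - det4 a00 b00 a11 b11 * det4 a01 b01 a10 b10)\<^sup>2
       - 4 * (det4 a00 b00 a10 b10 * det4 a01 b01 a11 b11) * (det4 a00 b00 a11 b11 * det4 a01 b01 a10 b10) \<noteq> 0"
  obtains M f0 f1 g0 g1 \<sigma>00 \<sigma>01 \<sigma>10 \<sigma>11 h g \<kappa>0 \<kappa>1 where
    "coords M f0 f1 g0 g1"
    "\<sigma>00 \<noteq> 0" "\<sigma>01 \<noteq> 0" "\<sigma>10 \<noteq> 0" "\<sigma>11 \<noteq> 0" "\<sigma>00 * \<sigma>11 - \<sigma>01 * \<sigma>10 \<noteq> 0"
    "\<kappa>0 \<noteq> 0" "\<kappa>1 \<noteq> 0" "\<kappa>0 \<noteq> \<kappa>1"
    "h \<noteq> 0" "h \<noteq> 1" "g \<noteq> 0" "1 + g \<noteq> 0" "h + g \<noteq> 0"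
    "\<kappa>0 * h - g \<noteq> 0" "\<kappa>1 * h - g \<noteq> 0" "\<kappa>0 * (1 - h) + 1 + g \<noteq> 0" "\<kappa>1 * (1 - h) + 1 + g \<noteq> 0"
    "g * (1 + g) + h * (1 - h) * \<kappa>0 * \<kappa>1 \<noteq> 0"
    "a00 = \<sigma>00 *s (h *s f0 + g0) + \<sigma>01 *s (h *s f1 + g1)"
    "a01 = \<sigma>00 *s ((1 - h) *s f0 - g0) + \<sigma>01 *s ((1 - h) *s f1 - g1)"
    "a10 = \<sigma>00 *s (g *s f0 + \<kappa>0 *s g0) + \<sigma>01 *s (g *s f1 + \<kappa>1 *s g1)"
    "a11 = - (\<sigma>00 *s ((1 + g) *s f0 + \<kappa>0 *s g0) + \<sigma>01 *s ((1 + g) *s f1 + \<kappa>1 *s g1))"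
    "b00 = \<sigma>10 *s (h *s f0 + g0) + \<sigma>11 *s (h *s f1 + g1)"
    "b01 = \<sigma>10 *s ((1 - h) *s f0 - g0) + \<sigma>11 *s ((1 - h) *s f1 - g1)"
    "b10 = \<sigma>10 *s (g *s f0 + \<kappa>0 *s g0) + \<sigma>11 *s (g *s f1 + \<kappa>1 *s g1)"
    "b11 = - (\<sigma>10 *s ((1 + g) *s f0 + \<kappa>0 *s g0) + \<sigma>11 *s ((1 + g) *s f1 + \<kappa>1 *s g1))"
proof -
  have lin: "\<alpha> (x + y) = \<alpha> x + \<alpha> y" "\<alpha> (k *s x) = k * \<alpha> x" "\<alpha> (x - y) = \<alpha> x - \<alpha> y" "\<alpha> 0 = 0"
    "\<beta> (x + y) = \<beta> x + \<beta> y" "\<beta> (k *s x) = k * \<beta> x" "\<beta> (x - y) = \<beta> x - \<beta> y" "\<beta> 0 = 0" for x y k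
    by (simp_all add: \<alpha>_def \<beta>_def sum_4' algebra_simps)
  have e_sum: "e00 + e01 + e10 + e11 = 0"
    using arg_cong[OF sum(1), of \<alpha>] by (simp add: lin \<alpha>)
  define \<eta> where "\<eta> = e00 + e01"
  have e11: "e11 = - \<eta> - e10" using e_sum by (simp add: \<eta>_def) algebra
  have \<eta>: "\<eta> \<noteq> 0"
  proof
    assume "\<eta> = 0"
    then have "e01 = - e00" "e11 = - e10" using e11 by (simp_all add: \<eta>_def eq_neg_iff_add_eq_0 add.commute)
    then show False using e(5) by (simp add: mult.commute)
  qed
  define h g where "h = e00 / \<eta>" and "g = e10 / \<eta>"
  have hg: "e00 = \<eta> * h" "e01 = \<eta> * (1 - h)" "e10 = \<eta> * g" "e11 = - \<eta> * (1 + g)"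
  proof -
    show h: "e00 = \<eta> * h" and g: "e10 = \<eta> * g" using \<eta> by (simp_all add: h_def g_def)
    show "e01 = \<eta> * (1 - h)" unfolding right_diff_distrib h[symmetric] by (simp add: \<eta>_def)
    show "e11 = - \<eta> * (1 + g)" unfolding e11 g by (simp add: algebra_simps)
  qed
  have h_nz: "h \<noteq> 0" "h \<noteq> 1" "g \<noteq> 0" "1 + g \<noteq> 0" using e hg by auto
  have hg_nz: "h + g \<noteq> 0"
  proof
    assume "h + g = 0"
    moreover have "e00 * e11 - e01 * e10 = - \<eta> * \<eta> * (h + g)" unfolding hg by (simp add: algebra_simps)
    ultimately show False using e(5) by simp
  qed
  \<comment> \<open>\<open>p\<close> and \<open>q\<close> are dual to \<alpha> and \<beta> up to the
    factor \<eta>; subtracting \<open>h\<close> times them from the first vertices leaves vectors on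
    which both forms vanish.\<close>
  define p q A B where "p = a00 + a01" and "q = b00 + b01" and "A = a00 - h *s p" and "B = b00 - h *s q"
  have a: "a00 = h *s p + A" "a01 = (1 - h) *s p - A" and b: "b00 = h *s q + B" "b01 = (1 - h) *s q - B"
    by (simp_all add: A_def B_def p_def q_def vec_eq_iff algebra_simps)
  have ab: "a00 = h *s p + 1 *s A + 0 *s B" "a01 = (1 - h) *s p + (- 1) *s A + 0 *s B"
     "b00 = h *s q + 0 *s A + 1 *s B" "b01 = (1 - h) *s q + 0 *s A + (- 1) *s B"
    by (simp_all add: a b vec_eq_iff)
  define \<Delta> where "\<Delta> = det4 p q A B"
  have T0: "det4 a00 b00 a01 b01 = \<Delta>"
    unfolding ab block_det \<Delta>_def by (simp add: algebra_simps)
  then have \<Delta>: "\<Delta> \<noteq> 0" using T_nz by simp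
  have pq: "\<alpha> p = \<eta>" "\<alpha> q = 0" "\<beta> p = 0" "\<beta> q = \<eta>"
    by (simp_all add: p_def q_def lin \<alpha> \<beta> \<eta>_def)
  have "e00 - h * \<eta> = 0" using hg(1) by (simp add: mult.commute)
  then have AB: "\<alpha> A = 0" "\<alpha> B = 0" "\<beta> A = 0" "\<beta> B = 0"
    by (simp_all add: A_def B_def lin \<alpha> \<beta> pq)
  note \<alpha>pq = pq AB
  obtain x y k1 k2 where a10: "a10 = x *s p + y *s q + k1 *s A + k2 *s B"
    using \<Delta> unfolding \<Delta>_def by (rule det4_expansion)
  have "\<alpha> a10 = x * \<eta>" "\<beta> a10 = y * \<eta>" unfolding a10 lin \<alpha>pq by simp_all
  then have "x = g" "y = 0" using \<alpha> \<beta> hg \<eta> by simp_all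
  then have a10: "a10 = g *s p + k1 *s A + k2 *s B" using a10 by simp
  obtain x y k3 k4 where b10: "b10 = x *s p + y *s q + k3 *s A + k4 *s B"
    using \<Delta> unfolding \<Delta>_def by (rule det4_expansion)
  have "\<alpha> b10 = x * \<eta>" "\<beta> b10 = y * \<eta>" unfolding b10 lin \<alpha>pq by simp_all
  then have "x = 0" "y = g" using \<alpha> \<beta> hg \<eta> by simp_all
  then have b10: "b10 = g *s q + k3 *s A + k4 *s B" using b10 by simp
  have "a11 = - (p + a10)" "b11 = - (q + b10)"
    unfolding p_def q_def by (rule minus_unique[symmetric, OF sum(1)], rule minus_unique[symmetric, OF sum(2)])
  then have a11: "a11 = - (1 + g) *s p - k1 *s A - k2 *s B" and b11: "b11 = - (1 + g) *s q - k3 *s A - k4 *s B"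
    unfolding a10 b10 by (simp_all add: vec_eq_iff algebra_simps)
  have ab11: "a11 = (- (1 + g)) *s p + (- k1) *s A + (- k2) *s B" "b11 = (- (1 + g)) *s q + (- k3) *s A + (- k4) *s B"
    unfolding a11 b11 by (simp_all add: vec_eq_iff)
  define T D where "T = k1 + k4" and "D = k1 * k4 - k2 * k3"
  \<comment> \<open>After division by the square of \<Delta>, the three products of complementary
    brackets are D, P and R.\<close>
  define P R where "P = (h\<^sup>2 * D - h * g * T + g\<^sup>2) * ((1 - h)\<^sup>2 * D + (1 - h) * (1 + g) * T + (1 + g)\<^sup>2)"
    and "R = (h\<^sup>2 * D - h * (1 + g) * T + (1 + g)\<^sup>2) * ((1 - h)\<^sup>2 * D + (1 - h) * g * T + g\<^sup>2)"
  have dets: "det4 a10 b10 a11 b11 = D * \<Delta>"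
     "det4 a00 b00 a10 b10 = (h\<^sup>2 * D - h * g * T + g\<^sup>2) * \<Delta>"
     "det4 a01 b01 a11 b11 = ((1 - h)\<^sup>2 * D + (1 - h) * (1 + g) * T + (1 + g)\<^sup>2) * \<Delta>"
     "det4 a00 b00 a11 b11 = (h\<^sup>2 * D - h * (1 + g) * T + (1 + g)\<^sup>2) * \<Delta>"
     "det4 a01 b01 a10 b10 = ((1 - h)\<^sup>2 * D + (1 - h) * g * T + g\<^sup>2) * \<Delta>"
    unfolding ab a10 b10 ab11 block_det \<Delta>_def[symmetric]
    by (rule arg_cong[where f = "\<lambda>x. x * \<Delta>"]; simp add: T_def D_def power2_eq_square algebra_simps)+
  have "(\<Delta> * (D * \<Delta>) - P * \<Delta>\<^sup>2 - R * \<Delta>\<^sup>2)\<^sup>2 - 4 * (P * \<Delta>\<^sup>2) * (R * \<Delta>\<^sup>2) \<noteq> 0"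
    using gram unfolding T0 dets P_def R_def by (simp add: power2_eq_square mult_ac)
  moreover have "(\<Delta> * (D * \<Delta>) - P * \<Delta>\<^sup>2 - R * \<Delta>\<^sup>2)\<^sup>2 - 4 * (P * \<Delta>\<^sup>2) * (R * \<Delta>\<^sup>2)
      = \<Delta> ^ 4 * ((D - P - R)\<^sup>2 - 4 * P * R)" by algebra
  ultimately have "(D - P - R)\<^sup>2 - 4 * P * R \<noteq> 0" by auto
  then have "(T\<^sup>2 - 4 * D) * (g * (1 + g) + h * (1 - h) * D)\<^sup>2 \<noteq> 0"
    unfolding P_def R_def gram_identity .
  then have disc: "T\<^sup>2 - 4 * D \<noteq> 0" and cross: "g * (1 + g) + h * (1 - h) * D \<noteq> 0" by auto
  have k: "k2 \<noteq> 0" "k3 \<noteq> 0"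
  proof -
    \<comment> \<open>If \<open>k2\<close> vanished, \<open>a10\<close> would lie on the line
      through \<open>a00\<close> and \<open>a01\<close>; the coefficients come from
      \<open>p = a00 + a01\<close> and \<open>A = a00 - h *s p\<close>.\<close>
    have "det4 a00 a01 a10 b00 = 0" if "k2 = 0"
    proof (rule det4_relation_imp_0[of "g + (1 - h) * k1" _ "g - h * k1" _ "- 1" _ 0])
      show "(g + (1 - h) * k1) *s a00 + (g - h * k1) *s a01 + (- 1) *s a10 + 0 *s b00 = 0"
        unfolding a10 a that by (simp add: vec_eq_iff algebra_simps)
    qed simp
    then show "k2 \<noteq> 0" using vert_nz by blast
    have "det4 b00 b01 b10 a00 = 0" if "k3 = 0"
    proof (rule det4_relation_imp_0[of "g + (1 - h) * k4" _ "g - h * k4" _ "- 1" _ 0])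
      show "(g + (1 - h) * k4) *s b00 + (g - h * k4) *s b01 + (- 1) *s b10 + 0 *s a00 = 0"
        unfolding b10 b that by (simp add: vec_eq_iff algebra_simps)
    qed simp
    then show "k3 \<noteq> 0" using vert_nz by blast
  qed
  show thesis
  proof (rule diagonalize[OF \<Delta>[unfolded \<Delta>_def] a a10 a11 b b10 b11 T_def D_def k disc])
    fix M f0 f1 g0 g1 \<kappa>0 \<kappa>1 \<sigma>00 \<sigma>01 \<sigma>10 \<sigma>11
    assume co: "coords M f0 f1 g0 g1" and \<kappa>: "\<kappa>0 + \<kappa>1 = T" "\<kappa>0 * \<kappa>1 = D" "\<kappa>0 \<noteq> \<kappa>1"
      and \<sigma>: "\<sigma>00 \<noteq> 0" "\<sigma>01 \<noteq> 0" "\<sigma>10 \<noteq> 0" "\<sigma>11 \<noteq> 0" "\<sigma>00 * \<sigma>11 - \<sigma>01 * \<sigma>10 \<noteq> 0"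
      and pts: "a00 = \<sigma>00 *s (h *s f0 + g0) + \<sigma>01 *s (h *s f1 + g1)"
        "a01 = \<sigma>00 *s ((1 - h) *s f0 - g0) + \<sigma>01 *s ((1 - h) *s f1 - g1)"
        "a10 = \<sigma>00 *s (g *s f0 + \<kappa>0 *s g0) + \<sigma>01 *s (g *s f1 + \<kappa>1 *s g1)"
        "a11 = - (\<sigma>00 *s ((1 + g) *s f0 + \<kappa>0 *s g0) + \<sigma>01 *s ((1 + g) *s f1 + \<kappa>1 *s g1))"
        "b00 = \<sigma>10 *s (h *s f0 + g0) + \<sigma>11 *s (h *s f1 + g1)"
        "b01 = \<sigma>10 *s ((1 - h) *s f0 - g0) + \<sigma>11 *s ((1 - h) *s f1 - g1)"
        "b10 = \<sigma>10 *s (g *s f0 + \<kappa>0 *s g0) + \<sigma>11 *s (g *s f1 + \<kappa>1 *s g1)"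
        "b11 = - (\<sigma>10 *s ((1 + g) *s f0 + \<kappa>0 *s g0) + \<sigma>11 *s ((1 + g) *s f1 + \<kappa>1 *s g1))"
    have "D \<noteq> 0" using T_nz(2) dets(1) by auto
    then have \<kappa>nz: "\<kappa>0 \<noteq> 0" "\<kappa>1 \<noteq> 0" using \<kappa>(2) by auto
    \<comment> \<open>The brackets see only symmetric functions of the eigenvalues, but a nonzero
      product makes both factors nonzero.\<close>
    have "(\<kappa>0 * h - g) * (\<kappa>1 * h - g) = h\<^sup>2 * D - h * g * T + g\<^sup>2"
      unfolding \<kappa>(1,2)[symmetric] by (simp add: power2_eq_square algebra_simps)
    moreover have "h\<^sup>2 * D - h * g * T + g\<^sup>2 \<noteq> 0" using Y_nz(1) dets(2) by auto
    ultimately have Y0: "\<kappa>0 * h - g \<noteq> 0" "\<kappa>1 * h - g \<noteq> 0" by auto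
    have "(\<kappa>0 * (1 - h) + 1 + g) * (\<kappa>1 * (1 - h) + 1 + g) = (1 - h)\<^sup>2 * D + (1 - h) * (1 + g) * T + (1 + g)\<^sup>2"
      unfolding \<kappa>(1,2)[symmetric] by (simp add: power2_eq_square algebra_simps)
    moreover have "(1 - h)\<^sup>2 * D + (1 - h) * (1 + g) * T + (1 + g)\<^sup>2 \<noteq> 0" using Y_nz(2) dets(3) by auto
    ultimately have Y1: "\<kappa>0 * (1 - h) + 1 + g \<noteq> 0" "\<kappa>1 * (1 - h) + 1 + g \<noteq> 0" by auto
    have cr: "g * (1 + g) + h * (1 - h) * \<kappa>0 * \<kappa>1 \<noteq> 0"
      using cross unfolding \<kappa>(2)[symmetric] by (simp add: mult.assoc)
    show thesis
      by (rule that[OF co \<sigma> \<kappa>nz \<kappa>(3) h_nz hg_nz Y0 Y1 cr pts])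
  qed
qed

text \<open>The three points with first index 1 lie on the plane where the form \<alpha> of the
  inverse vanishes. Hence this is a fixed multiple of the value of \<alpha> at
  \<open>c $ 0 $ j $ k\<close>, but it is a polynomial in the coefficients and can be used before
  the inverse is known.\<close>

definition face_det :: "trilinear \<Rightarrow> 2 \<Rightarrow> 2 \<Rightarrow> complex" where
  "face_det c j k = det4 (c $ 1 $ 0 $ 0) (c $ 1 $ 0 $ 1) (c $ 1 $ 1 $ 0) (c $ 0 $ j $ k)"

lemma det4_scale: "det4 (x *s a) (y *s b) (z *s c) (w *s d) = x * y * z * w * det4 a b c d"
  unfolding det4_expand by (simp add: algebra_simps)

section \<open>The open set\<close>

definition hom_poly :: "nat \<Rightarrow> (trilinear \<Rightarrow> complex) \<Rightarrow> bool" where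
  "hom_poly d f \<longleftrightarrow> (\<exists>p :: (2 \<times> 2 \<times> 2 \<times> 4) mpoly. homogeneous d p \<and>
     (\<forall>c. mpoly_eval p (\<lambda>(i, j, k, l). c $ i $ j $ k $ l) = f c))"

lemma hom_polyI:
  fixes p :: "(2 \<times> 2 \<times> 2 \<times> 4) mpoly"
  assumes "homogeneous d p" "\<And>c. mpoly_eval p (\<lambda>(i, j, k, l). c $ i $ j $ k $ l) = f c"
  shows "hom_poly d f"
  unfolding hom_poly_def by (rule exI[of _ p]) (simp add: assms)

lemma hom_polyE:
  assumes "hom_poly d f"
  obtains p :: "(2 \<times> 2 \<times> 2 \<times> 4) mpoly"
  where "homogeneous d p" "\<And>c. mpoly_eval p (\<lambda>(i, j, k, l). c $ i $ j $ k $ l) = f c"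
  using assms unfolding hom_poly_def by (elim exE conjE) simp

lemma hom_poly_coord: "hom_poly 1 (\<lambda>c. c $ i $ j $ k $ l)"
  by (rule hom_polyI[OF homogeneous_var[of "(i, j, k, l)"]]) simp

lemma hom_poly_add: "hom_poly d f \<Longrightarrow> hom_poly d g \<Longrightarrow> hom_poly d (\<lambda>c. f c + g c)"
  by (elim hom_polyE, rule hom_polyI[OF homogeneous_add]) (assumption | simp)+

lemma hom_poly_minus: "hom_poly d f \<Longrightarrow> hom_poly d g \<Longrightarrow> hom_poly d (\<lambda>c. f c - g c)"
  by (elim hom_polyE, rule hom_polyI[OF homogeneous_minus]) (assumption | simp)+

lemma hom_poly_mult: "hom_poly d f \<Longrightarrow> hom_poly e g \<Longrightarrow> hom_poly (d + e) (\<lambda>c. f c * g c)"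
  by (elim hom_polyE, rule hom_polyI[OF homogeneous_mult]) (assumption | simp)+

lemma hom_poly_scale: "hom_poly d f \<Longrightarrow> hom_poly d (\<lambda>c. a * f c)"
  by (elim hom_polyE, rule hom_polyI[OF homogeneous_cst_mult[where c = a]]) (assumption | simp)+

lemma hom_poly_minor:
  "hom_poly d f1 \<Longrightarrow> hom_poly d f2 \<Longrightarrow> hom_poly d f3 \<Longrightarrow> hom_poly d f4 \<Longrightarrow>
     hom_poly (d + d) (\<lambda>c. f1 c * f2 c - f3 c * f4 c)"
  by (intro hom_poly_minus hom_poly_mult)

lemma hom_poly_det4:
  "hom_poly 4 (\<lambda>c. det4 (c $ i0 $ j0 $ k0) (c $ i1 $ j1 $ k1) (c $ i2 $ j2 $ k2) (c $ i3 $ j3 $ k3))"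
proof -
  have "hom_poly ((1 + 1) + (1 + 1)) (\<lambda>c. det4 (c $ i0 $ j0 $ k0) (c $ i1 $ j1 $ k1) (c $ i2 $ j2 $ k2) (c $ i3 $ j3 $ k3))"
    unfolding det4_expand by (intro hom_poly_add hom_poly_minus[where d = "(1 + 1) + (1 + 1)"]
        hom_poly_mult[where d = "1 + 1" and e = "1 + 1"] hom_poly_minor hom_poly_coord)
  moreover have "(1 + 1) + (1 + 1) = (4 :: nat)" by simp
  ultimately show ?thesis by (simp only:)
qed

lemma zariski_open_hom_poly:
  assumes "hom_poly d f"
  shows "zariski_open {c. c \<noteq> 0 \<and> f c \<noteq> 0}"
proof -
  obtain p :: "(2 \<times> 2 \<times> 2 \<times> 4) mpoly" where "homogeneous d p"
      "\<And>c. mpoly_eval p (\<lambda>(i, j, k, l). c $ i $ j $ k $ l) = f c"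
    by (rule hom_polyE[OF assms]) (rule that)
  then show ?thesis unfolding zariski_open_def by (intro exI[of _ "{p}"]) auto
qed

text \<open>The Gram determinant of the Pluecker vectors of the four lines \<open>s\<^sub>j\<^sub>k\<close>; it is nonzero iff the
  lines have exactly two common transversals.\<close>

definition gram :: "trilinear \<Rightarrow> complex" where
  "gram c = (bracket c 0 0 0 1 * bracket c 1 0 1 1 - bracket c 0 0 1 0 * bracket c 0 1 1 1
      - bracket c 0 0 1 1 * bracket c 0 1 1 0)\<^sup>2
    - 4 * (bracket c 0 0 1 0 * bracket c 0 1 1 1) * (bracket c 0 0 1 1 * bracket c 0 1 1 0)"

text \<open>The brackets exclude zero coordinates of the base point and singular T and Y surfaces.
  The face determinants and their minor control \<open>h\<close>, \<open>g\<close> and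
  \<open>h + g\<close>; the first one together with the other \<open>det4\<close> excludes that K is
  triangular. \<open>gram\<close> makes the eigenvalues and the cross ratios distinct.\<close>

definition generic :: "trilinear \<Rightarrow> complex" where
  "generic c = bracket c 0 0 0 1 * bracket c 1 0 1 1 * (bracket c 0 0 1 0 * bracket c 0 1 1 1)
     * (face_det c 0 0 * face_det c 0 1 * (face_det c 1 0 * face_det c 1 1)
     * (face_det c 0 0 * face_det c 1 1 - face_det c 0 1 * face_det c 1 0))
     * det4 (c $ 0 $ 0 $ 0) (c $ 0 $ 0 $ 1) (c $ 0 $ 1 $ 0) (c $ 1 $ 0 $ 0) * gram c"

lemma hom_poly_generic: "\<exists>d. hom_poly d generic"
proof -
  have br: "hom_poly 4 (\<lambda>c. bracket c j k j' k')" for j k j' k'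
    unfolding bracket_def by (rule hom_poly_det4)
  have fd: "hom_poly 4 (\<lambda>c. face_det c j k)" for j k
    unfolding face_det_def by (rule hom_poly_det4)
  have gr: "hom_poly ((4 + 4) + (4 + 4)) gram"
    unfolding gram_def power2_eq_square mult.assoc[of 4]
    by (intro hom_poly_minus[where d = "(4 + 4) + (4 + 4)"] hom_poly_scale
        hom_poly_mult[where d = "4 + 4" and e = "4 + 4"] hom_poly_minus[where d = "4 + 4"] hom_poly_mult[where d = 4 and e = 4] br)
  show ?thesis
    unfolding generic_def[abs_def]
    by (rule exI, (rule hom_poly_mult hom_poly_minor br fd hom_poly_det4 gr)+)
qed

section \<open>Maps of type (1,2,2) in the open set\<close>

lemma tri_eval_axis: "tri_eval c (axis i 1) (axis j 1) (axis k 1) = c $ i $ j $ k"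
  using exhaust_2'[of i] exhaust_2'[of j] exhaust_2'[of k]
  by (elim disjE) (simp_all add: tri_eval_expand)

lemma det4_last_linear: "det4 a b c (x *s v - y *s w) = x * det4 a b c v - y * det4 a b c w"
  unfolding det4_expand by (simp add: algebra_simps)

lemma generic_normal_form:
  assumes gen: "generic c \<noteq> 0" and bir: "birational_of_type 1 2 2 c"
  obtains M f0 f1 g0 g1 \<tau>0 \<tau>1 \<upsilon>0 \<upsilon>1 \<sigma>00 \<sigma>01 \<sigma>10 \<sigma>11 h g \<kappa>0 \<kappa>1
  where "normal_form M f0 f1 g0 g1 c \<tau>0 \<tau>1 \<upsilon>0 \<upsilon>1 \<sigma>00 \<sigma>01 \<sigma>10 \<sigma>11 h g \<kappa>0 \<kappa>1"
proof -
  have br: "bracket c 0 0 0 1 \<noteq> 0" "bracket c 1 0 1 1 \<noteq> 0" "bracket c 0 0 1 0 \<noteq> 0" "bracket c 0 1 1 1 \<noteq> 0"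
    and fd: "face_det c 0 0 \<noteq> 0" "face_det c 0 1 \<noteq> 0" "face_det c 1 0 \<noteq> 0" "face_det c 1 1 \<noteq> 0"
      "face_det c 0 0 * face_det c 1 1 - face_det c 0 1 * face_det c 1 0 \<noteq> 0"
    and vert: "det4 (c $ 0 $ 0 $ 0) (c $ 0 $ 0 $ 1) (c $ 0 $ 1 $ 0) (c $ 1 $ 0 $ 0) \<noteq> 0"
    and gr: "gram c \<noteq> 0"
    using gen unfolding generic_def by simp_all
  obtain A B C where inv: "is_inverse c A B C" and homA: "homogeneous 1 (A 0)" "homogeneous 1 (A 1)"
    using bir unfolding birational_of_type_def by blast
  obtain wa where wa: "\<And>x. mpoly_eval (A 0) (($) x) = (\<Sum>l\<in>UNIV. wa $ l * x $ l)"
    by (rule homogeneous_1_linear[OF homA(1)]) (rule that)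
  obtain wb where wb: "\<And>x. mpoly_eval (A 1) (($) x) = (\<Sum>l\<in>UNIV. wb $ l * x $ l)"
    by (rule homogeneous_1_linear[OF homA(2)]) (rule that)
  define \<alpha> where "\<alpha> x = (\<Sum>l\<in>UNIV. wa $ l * x $ l)" for x :: pvec
  define \<beta> where "\<beta> x = (\<Sum>l\<in>UNIV. wb $ l * x $ l)" for x :: pvec
  have lin: "\<alpha> (x + y) = \<alpha> x + \<alpha> y" "\<alpha> (k *s x) = k * \<alpha> x" "\<alpha> (x - y) = \<alpha> x - \<alpha> y" "\<alpha> 0 = 0"
    "\<beta> (x + y) = \<beta> x + \<beta> y" "\<beta> (k *s x) = k * \<beta> x" "\<beta> (x - y) = \<beta> x - \<beta> y" "\<beta> 0 = 0" for x y k
    by (simp_all add: \<alpha>_def \<beta>_def sum_4' algebra_simps)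
  have AB: "\<alpha> (tri_eval c s t u) * s $ 1 = \<beta> (tri_eval c s t u) * s $ 0" for s t u
    using inv unfolding is_inverse_def same_rational_map_def pair_eval_def wa[symmetric] wb[symmetric] \<alpha>_def \<beta>_def
    by auto
  have \<beta>0: "\<beta> (c $ 0 $ j $ k) = 0" and \<alpha>1: "\<alpha> (c $ 1 $ j $ k) = 0" for j k
    using AB[of "axis 0 1" "axis j 1" "axis k 1"] AB[of "axis 1 1" "axis j 1" "axis k 1"]
    by (simp_all add: tri_eval_axis)
  \<comment> \<open>At the axis parameters one form vanishes on each face. The parameter (1, 1)
    compares the other values, so that the two opposite faces carry the same numbers
    \<open>H j k\<close>.\<close>
  have "tri_eval c (vec2 1 1) t u = tri_eval c (axis 0 1) t u + tri_eval c (axis 1 1) t u" for t u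
    by (simp add: tri_eval_expand vec_eq_iff)
  then have \<beta>1: "\<beta> (c $ 1 $ j $ k) = \<alpha> (c $ 0 $ j $ k)" for j k
    using AB[of "vec2 1 1" "axis j 1" "axis k 1"] by (simp add: tri_eval_axis lin \<alpha>1 \<beta>0)
  define H where "H j k = \<alpha> (c $ 0 $ j $ k)" for j k
  have "wa \<noteq> 0"
  proof
    assume "wa = 0"
    then have "\<alpha> x = 0" for x by (simp add: \<alpha>_def)
    then have "\<alpha> (tri_eval c s t u) = 0 \<and> \<beta> (tri_eval c s t u) = 0" for s t u
      unfolding tri_eval_expand lin by (simp add: \<beta>0 \<beta>1)
    then have "pair_eval A (tri_eval c s t u) = 0" for s t u
      by (simp add: vec2_eq_iff pair_eval_def wa wb \<alpha>_def \<beta>_def)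
    then show False using inv unfolding is_inverse_def same_rational_map_def by auto
  qed
  have kernel: "det4 (c $ 1 $ 0 $ 0) (c $ 1 $ 0 $ 1) (c $ 1 $ 1 $ 0) x = 0" if "\<alpha> x = 0" for x
    by (rule det4_left_kernel[OF _ \<open>wa \<noteq> 0\<close>]) (use \<alpha>1 that in \<open>auto simp: \<alpha>_def\<close>)
  have H: "H j k \<noteq> 0" if "face_det c j k \<noteq> 0" for j k
    using that kernel[of "c $ 0 $ j $ k"] by (auto simp: face_det_def H_def)
  \<comment> \<open>\<open>H 0 0 *s c $ 0 $ j $ k - H j k *s c $ 0 $ 0 $ 0\<close> lies in the plane
    \<alpha> = 0, so \<open>face_det\<close> is proportional to \<open>H\<close>.\<close>
  have HF: "H 0 0 * face_det c j k = H j k * face_det c 0 0" for j k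
    using kernel[of "H 0 0 *s c $ 0 $ j $ k - H j k *s c $ 0 $ 0 $ 0"]
    by (simp add: lin det4_last_linear face_det_def H_def)
  have "H 0 0 * H 0 0 * (face_det c 0 0 * face_det c 1 1 - face_det c 0 1 * face_det c 1 0) =
      face_det c 0 0 * face_det c 0 0 * (H 0 0 * H 1 1 - H 0 1 * H 1 0)"
    using HF[of 0 1] HF[of 1 0] HF[of 1 1] by algebra
  then have detH: "H 0 0 * H 1 1 - H 0 1 * H 1 0 \<noteq> 0"
    using fd H[of 0 0] by auto
  have "\<exists>t u. t \<noteq> 0 \<and> u \<noteq> 0 \<and> (\<forall>s. tri_eval c s t u = 0)"
  proof (rule constant_base_point[OF inv _ br(1,3)])
    fix s :: "complex ^ 2" assume s: "s \<noteq> 0"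
    \<comment> \<open>The equation of the plane that contains the image of the slice
      \<open>s\<close>.\<close>
    let ?w = "s $ 1 *s wa - s $ 0 *s wb"
    have w: "(\<Sum>l\<in>UNIV. ?w $ l * x $ l) = s $ 1 * \<alpha> x - s $ 0 * \<beta> x" for x
      by (simp add: \<alpha>_def \<beta>_def sum_4' algebra_simps)
    have "?w \<noteq> 0"
    proof
      assume "?w = 0"
      then have "s $ 1 * \<alpha> x - s $ 0 * \<beta> x = 0" for x using w[of x] by simp
      from this[of "c $ 0 $ 0 $ 0"] this[of "c $ 1 $ 0 $ 0"] have "s $ 1 * H 0 0 = 0" "s $ 0 * H 0 0 = 0"
        by (simp_all add: \<beta>0 \<beta>1 \<alpha>1 H_def)
      then show False using s H[OF fd(1)] by (simp add: vec2_eq_iff)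
    qed
    then show "det4 (s $ 0 *s c $ 0 $ 0 $ 0 + s $ 1 *s c $ 1 $ 0 $ 0) (s $ 0 *s c $ 0 $ 0 $ 1 + s $ 1 *s c $ 1 $ 0 $ 1)
        (s $ 0 *s c $ 0 $ 1 $ 0 + s $ 1 *s c $ 1 $ 1 $ 0) (s $ 0 *s c $ 0 $ 1 $ 1 + s $ 1 *s c $ 1 $ 1 $ 1) = 0"
      by (rule det4_left_kernel[rotated]) (auto simp only: w lin \<beta>0 \<beta>1 \<alpha>1 insert_iff empty_iff, simp_all)
  qed
  then obtain t u where tu: "t \<noteq> 0" "u \<noteq> 0" and base: "\<And>s. tri_eval c s t u = 0" by blast
  have sum0: "(t $ 0 * u $ 0) *s c $ i $ 0 $ 0 + (t $ 0 * u $ 1) *s c $ i $ 0 $ 1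
      + (t $ 1 * u $ 0) *s c $ i $ 1 $ 0 + (t $ 1 * u $ 1) *s c $ i $ 1 $ 1 = 0" for i
    using base[of "axis i 1"] exhaust_2'[of i] unfolding tri_eval_expand by (elim disjE) simp_all
  have t_nz: "t $ 0 \<noteq> 0" "t $ 1 \<noteq> 0" and u_nz: "u $ 0 \<noteq> 0" "u $ 1 \<noteq> 0"
  proof -
    \<comment> \<open>If a coordinate of the base point were 0, only two terms of
      \<open>sum0\<close> would remain, and two control points would be proportional.\<close>
    have rel: "bracket c j k j' k' = 0" if "x *s c $ 0 $ j $ k + y *s c $ 0 $ j' $ k' = 0" "x \<noteq> 0 \<or> y \<noteq> 0" for j k j' k' x y
      unfolding bracket_def by (rule det4_relation_imp_0[of x _ 0 _ y _ 0]) (use that in auto)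
    show "t $ 0 \<noteq> 0"
    proof
      assume "t $ 0 = 0"
      then show False using rel[of "t $ 1 * u $ 0" 1 0 "t $ 1 * u $ 1" 1 1] sum0[of 0] br(2) tu
        by (auto simp: vec2_eq_iff)
    qed
    show "t $ 1 \<noteq> 0"
    proof
      assume "t $ 1 = 0"
      then show False using rel[of "t $ 0 * u $ 0" 0 0 "t $ 0 * u $ 1" 0 1] sum0[of 0] br(1) tu
        by (auto simp: vec2_eq_iff)
    qed
    show "u $ 0 \<noteq> 0"
    proof
      assume "u $ 0 = 0"
      then show False using rel[of "t $ 0 * u $ 1" 0 1 "t $ 1 * u $ 1" 1 1] sum0[of 0] br(4) tu
        by (auto simp: vec2_eq_iff)
    qed
    show "u $ 1 \<noteq> 0"
    proof
      assume "u $ 1 = 0"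
      then show False using rel[of "t $ 0 * u $ 0" 0 0 "t $ 1 * u $ 0" 1 0] sum0[of 0] br(3) tu
        by (auto simp: vec2_eq_iff)
    qed
  qed
  define W where "W = t $ 0 * t $ 1 * u $ 0 * u $ 1"
  have W: "W \<noteq> 0" using t_nz u_nz by (simp add: W_def)
  let ?d = "\<lambda>i j k. (t $ j * u $ k) *s c $ i $ j $ k"
  have db: "det4 (?d 0 j k) (?d 1 j k) (?d 0 j' k') (?d 1 j' k') = (t $ j * u $ k * (t $ j' * u $ k'))\<^sup>2 * bracket c j k j' k'"
    for j k j' k'
    unfolding det4_scale bracket_def by (simp add: power2_eq_square mult_ac)
  have db_nz: "det4 (?d 0 j k) (?d 1 j k) (?d 0 j' k') (?d 1 j' k') \<noteq> 0" if "bracket c j k j' k' \<noteq> 0" for j k j' k'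
    using that t_nz u_nz exhaust_2'[of j] exhaust_2'[of k] exhaust_2'[of j'] exhaust_2'[of k'] unfolding db by auto
  have gram_d: "(det4 (?d 0 0 0) (?d 1 0 0) (?d 0 0 1) (?d 1 0 1) * det4 (?d 0 1 0) (?d 1 1 0) (?d 0 1 1) (?d 1 1 1)
        - det4 (?d 0 0 0) (?d 1 0 0) (?d 0 1 0) (?d 1 1 0) * det4 (?d 0 0 1) (?d 1 0 1) (?d 0 1 1) (?d 1 1 1)
        - det4 (?d 0 0 0) (?d 1 0 0) (?d 0 1 1) (?d 1 1 1) * det4 (?d 0 0 1) (?d 1 0 1) (?d 0 1 0) (?d 1 1 0))\<^sup>2
      - 4 * (det4 (?d 0 0 0) (?d 1 0 0) (?d 0 1 0) (?d 1 1 0) * det4 (?d 0 0 1) (?d 1 0 1) (?d 0 1 1) (?d 1 1 1))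
        * (det4 (?d 0 0 0) (?d 1 0 0) (?d 0 1 1) (?d 1 1 1) * det4 (?d 0 0 1) (?d 1 0 1) (?d 0 1 0) (?d 1 1 0)) \<noteq> 0"
  proof -
    \<comment> \<open>In each of the three products of complementary brackets every vertex
      \<open>(j, k)\<close> occurs once, so the scaling contributes the same factor
      \<open>W ^ 4\<close> to all of them.\<close>
    have pairs: "(t $ j * u $ k * (t $ j' * u $ k'))\<^sup>2 * x * ((t $ m * u $ n * (t $ m' * u $ n'))\<^sup>2 * y) = W ^ 4 * (x * y)"
      if "t $ j * u $ k * (t $ j' * u $ k') * (t $ m * u $ n * (t $ m' * u $ n')) = W\<^sup>2" for j k j' k' m n m' n' x y
    proof -
      have "(t $ j * u $ k * (t $ j' * u $ k'))\<^sup>2 * x * ((t $ m * u $ n * (t $ m' * u $ n'))\<^sup>2 * y)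
          = (t $ j * u $ k * (t $ j' * u $ k') * (t $ m * u $ n * (t $ m' * u $ n')))\<^sup>2 * (x * y)"
        by (simp add: power2_eq_square mult_ac)
      then show ?thesis unfolding that by (simp flip: power_mult)
    qed
    have q: "det4 (?d 0 0 0) (?d 1 0 0) (?d 0 0 1) (?d 1 0 1) * det4 (?d 0 1 0) (?d 1 1 0) (?d 0 1 1) (?d 1 1 1)
        = W ^ 4 * (bracket c 0 0 0 1 * bracket c 1 0 1 1)"
      and p: "det4 (?d 0 0 0) (?d 1 0 0) (?d 0 1 0) (?d 1 1 0) * det4 (?d 0 0 1) (?d 1 0 1) (?d 0 1 1) (?d 1 1 1)
        = W ^ 4 * (bracket c 0 0 1 0 * bracket c 0 1 1 1)"
      and r: "det4 (?d 0 0 0) (?d 1 0 0) (?d 0 1 1) (?d 1 1 1) * det4 (?d 0 0 1) (?d 1 0 1) (?d 0 1 0) (?d 1 1 0)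
        = W ^ 4 * (bracket c 0 0 1 1 * bracket c 0 1 1 0)"
      unfolding db by (rule pairs; simp add: W_def power2_eq_square mult_ac)+
    have "(W ^ 4 * Q - W ^ 4 * P - W ^ 4 * R)\<^sup>2 - 4 * (W ^ 4 * P) * (W ^ 4 * R) = (W ^ 4)\<^sup>2 * ((Q - P - R)\<^sup>2 - 4 * P * R)" for P Q R
      by algebra
    then show ?thesis unfolding q p r using gr W by (simp add: gram_def)
  qed
  show thesis
  proof (rule reduce_to_coordinates[of "?d 0 0 0" "?d 0 0 1" "?d 0 1 0" "?d 0 1 1" "?d 1 0 0" "?d 1 0 1" "?d 1 1 0" "?d 1 1 1"
        wa "t $ 0 * u $ 0 * H 0 0" "t $ 0 * u $ 1 * H 0 1" "t $ 1 * u $ 0 * H 1 0" "t $ 1 * u $ 1 * H 1 1" wb,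
        OF sum0 sum0, folded \<alpha>_def \<beta>_def, unfolded lin \<alpha>1 \<beta>0 \<beta>1 H_def[symmetric] mult_zero_right])
    show "t $ 0 * u $ 0 * H 0 0 * (t $ 1 * u $ 1 * H 1 1) - t $ 0 * u $ 1 * H 0 1 * (t $ 1 * u $ 0 * H 1 0) \<noteq> 0"
    proof -
      have "t $ 0 * u $ 0 * H 0 0 * (t $ 1 * u $ 1 * H 1 1) - t $ 0 * u $ 1 * H 0 1 * (t $ 1 * u $ 0 * H 1 0)
          = W * (H 0 0 * H 1 1 - H 0 1 * H 1 0)" by (simp add: W_def algebra_simps)
      then show ?thesis using W detH by simp
    qed
    show "det4 (?d 0 0 0) (?d 0 0 1) (?d 0 1 0) (?d 1 0 0) \<noteq> 0" "det4 (?d 1 0 0) (?d 1 0 1) (?d 1 1 0) (?d 0 0 0) \<noteq> 0"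
      unfolding det4_scale using vert fd(1) t_nz u_nz by (simp_all add: face_det_def)
    fix M f0 f1 g0 g1 \<sigma>00 \<sigma>01 \<sigma>10 \<sigma>11 h g \<kappa>0 \<kappa>1
    assume co: "coords M f0 f1 g0 g1"
      and nz: "\<sigma>00 \<noteq> 0" "\<sigma>01 \<noteq> 0" "\<sigma>10 \<noteq> 0" "\<sigma>11 \<noteq> 0" "\<sigma>00 * \<sigma>11 - \<sigma>01 * \<sigma>10 \<noteq> 0"
        "\<kappa>0 \<noteq> 0" "\<kappa>1 \<noteq> 0" "\<kappa>0 \<noteq> \<kappa>1"
        "h \<noteq> 0" "h \<noteq> 1" "g \<noteq> 0" "1 + g \<noteq> 0" "h + g \<noteq> 0"
        "\<kappa>0 * h - g \<noteq> 0" "\<kappa>1 * h - g \<noteq> 0" "\<kappa>0 * (1 - h) + 1 + g \<noteq> 0" "\<kappa>1 * (1 - h) + 1 + g \<noteq> 0"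
        "g * (1 + g) + h * (1 - h) * \<kappa>0 * \<kappa>1 \<noteq> 0"
      and pts: "?d 0 0 0 = \<sigma>00 *s (h *s f0 + g0) + \<sigma>01 *s (h *s f1 + g1)"
        "?d 0 0 1 = \<sigma>00 *s ((1 - h) *s f0 - g0) + \<sigma>01 *s ((1 - h) *s f1 - g1)"
        "?d 0 1 0 = \<sigma>00 *s (g *s f0 + \<kappa>0 *s g0) + \<sigma>01 *s (g *s f1 + \<kappa>1 *s g1)"
        "?d 0 1 1 = - (\<sigma>00 *s ((1 + g) *s f0 + \<kappa>0 *s g0) + \<sigma>01 *s ((1 + g) *s f1 + \<kappa>1 *s g1))"
        "?d 1 0 0 = \<sigma>10 *s (h *s f0 + g0) + \<sigma>11 *s (h *s f1 + g1)"
        "?d 1 0 1 = \<sigma>10 *s ((1 - h) *s f0 - g0) + \<sigma>11 *s ((1 - h) *s f1 - g1)"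
        "?d 1 1 0 = \<sigma>10 *s (g *s f0 + \<kappa>0 *s g0) + \<sigma>11 *s (g *s f1 + \<kappa>1 *s g1)"
        "?d 1 1 1 = - (\<sigma>10 *s ((1 + g) *s f0 + \<kappa>0 *s g0) + \<sigma>11 *s ((1 + g) *s f1 + \<kappa>1 *s g1))"
    interpret coords M f0 f1 g0 g1 by (rule co)
    \<comment> \<open>The reciprocals as weights move the base point to \<open>T0 = T1\<close>,
      \<open>U0 = U1\<close>.\<close>
    have "normal_form M f0 f1 g0 g1 c (1 / t $ 0) (1 / t $ 1) (1 / u $ 0) (1 / u $ 1) \<sigma>00 \<sigma>01 \<sigma>10 \<sigma>11 h g \<kappa>0 \<kappa>1"
    proof unfold_locales
      fix s t' u' :: "complex ^ 2"
      define T0 T1 U0 U1 where "T0 = t' $ 0 * (1 / t $ 0)" and "T1 = t' $ 1 * (1 / t $ 1)"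
        and "U0 = u' $ 0 * (1 / u $ 0)" and "U1 = u' $ 1 * (1 / u $ 1)"
      have tu': "t' $ 0 = T0 * t $ 0" "t' $ 1 = T1 * t $ 1" "u' $ 0 = U0 * u $ 0" "u' $ 1 = U1 * u $ 1"
        using t_nz u_nz by (simp_all add: T0_def T1_def U0_def U1_def)
      have "tri_eval c s t' u' = (s $ 0 * (T0 * U0)) *s ?d 0 0 0 + (s $ 0 * (T0 * U1)) *s ?d 0 0 1
          + (s $ 0 * (T1 * U0)) *s ?d 0 1 0 + (s $ 0 * (T1 * U1)) *s ?d 0 1 1
          + (s $ 1 * (T0 * U0)) *s ?d 1 0 0 + (s $ 1 * (T0 * U1)) *s ?d 1 0 1
          + (s $ 1 * (T1 * U0)) *s ?d 1 1 0 + (s $ 1 * (T1 * U1)) *s ?d 1 1 1"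
        unfolding tri_eval_expand tu' vector_smult_assoc by (simp add: mult_ac)
      also have "\<dots> = (let S0 = s $ 0 * \<sigma>00 + s $ 1 * \<sigma>10; S1 = s $ 0 * \<sigma>01 + s $ 1 * \<sigma>11;
           H = T0 * (h * U0 + (1 - h) * U1) + T1 * (g * U0 - (1 + g) * U1)
         in mk (S0 * H) (S1 * H) (S0 * ((U0 - U1) * (T0 + \<kappa>0 * T1))) (S1 * ((U0 - U1) * (T0 + \<kappa>1 * T1))))"
        unfolding pts Let_def mk_def by (simp add: vec_eq_iff algebra_simps)
      finally show "tri_eval c s t' u' =
        (let S0 = s $ 0 * \<sigma>00 + s $ 1 * \<sigma>10; S1 = s $ 0 * \<sigma>01 + s $ 1 * \<sigma>11;
           T0 = t' $ 0 * (1 / t $ 0); T1 = t' $ 1 * (1 / t $ 1); U0 = u' $ 0 * (1 / u $ 0); U1 = u' $ 1 * (1 / u $ 1);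
           H = T0 * (h * U0 + (1 - h) * U1) + T1 * (g * U0 - (1 + g) * U1)
         in mk (S0 * H) (S1 * H) (S0 * ((U0 - U1) * (T0 + \<kappa>0 * T1))) (S1 * ((U0 - U1) * (T0 + \<kappa>1 * T1))))"
        unfolding Let_def T0_def T1_def U0_def U1_def .
    qed (use nz t_nz u_nz in simp_all)
    then show thesis by (rule that)
  qed (use H fd t_nz u_nz db_nz br gram_d in simp_all)
qed

section \<open>A map of type (1,2,2) in the open set\<close>

text \<open>On a line through \<open>p\<close> and a point with \<open>r\<close> nonzero, a common
  factor has no zeros and is constant. Such points are dense on every line through \<open>q\<close>,
  so it is constant everywhere and a unit.\<close>

lemma no_common_factor_lines:
  fixes F G :: "4 mpoly" and p :: pvec and r :: "pvec \<Rightarrow> complex"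
  assumes r: "\<And>x y. polyfun (\<lambda>z. r (x + z *s (y - x)))" "r q \<noteq> 0"
    and line: "\<And>x z. r x \<noteq> 0 \<Longrightarrow>
      \<not> (mpoly_eval F (($) (p + z *s (x - p))) = 0 \<and> mpoly_eval G (($) (p + z *s (x - p))) = 0)"
  shows "no_common_factor F G"
  unfolding no_common_factor_def
proof (intro allI impI)
  fix h assume "h dvd F \<and> h dvd G"
  then obtain F' G' where F: "F = h * F'" and G: "G = h * G'" by (auto elim!: dvdE)
  define H where "H x = mpoly_eval h (($) x)" for x :: pvec
  have nz: "H (p + z *s (x - p)) \<noteq> 0" if "r x \<noteq> 0" for x z
    using line[OF that, of z] by (auto simp: F G H_def)
  have const: "H x = H p" if "r x \<noteq> 0" for x
  proof -
    have "polyfun (\<lambda>z. H (p + z *s (x - p)))" unfolding H_def by (rule polyfun_line)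
    from polyfun_zero_free_const[OF this nz[OF that], of 1 0] show ?thesis by simp
  qed
  have H_const: "H x = H p" for x
  proof (rule ccontr)
    assume "H x \<noteq> H p"
    then have "\<exists>z. H (x + z *s (q - x)) - H p \<noteq> 0 \<and> r (x + z *s (q - x)) \<noteq> 0"
      using r(2) unfolding H_def
      by (intro polyfun_no_zero_divisors[where a = 0 and b = 1] polyfun_minus[OF polyfun_line polyfun_const] r(1)) simp_all
    then show False using const by auto
  qed
  have "mpoly_eval h v = H p" for v
  proof -
    have "(($) (\<chi> i. v i)) = v" by (simp add: fun_eq_iff)
    then show ?thesis using H_const[of "\<chi> i. v i"] unfolding H_def by simp
  qed
  moreover have "H p \<noteq> 0" using nz[OF r(2), of 0] by simp
  ultimately show "h dvd 1" by (rule mpoly_const_unit)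
qed

lemma no_common_factor_products:
  fixes F G :: "4 mpoly"
  assumes "\<And>x. mpoly_eval F (($) x) = 0 \<Longrightarrow> mpoly_eval G (($) x) = 0 \<Longrightarrow>
      x $ 0 * x $ 3 = 0 \<and> x $ 1 * (a * x $ 0 + b * x $ 2) = 0"
    and ab: "a + b = 1" "b \<noteq> 0"
  shows "no_common_factor F G"
proof (rule no_common_factor_lines)
  \<comment> \<open>Common zeros lie on one of two planes and also on one of two others. All four
    linear forms are 1 at \<open>?p\<close>, so the value at \<open>x\<close> determines where the
    line meets a plane; \<open>?r x\<close> being nonzero says that the two pairs of planes are met
    at different points.\<close>
  let ?l = "\<lambda>x :: pvec. a * x $ 0 + b * x $ 2" and ?p = "vec4 1 1 1 1 :: pvec"
  let ?r = "\<lambda>x. (x $ 0 - x $ 1) * (x $ 0 - ?l x) * ((x $ 3 - x $ 1) * (x $ 3 - ?l x))"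
  show "polyfun (\<lambda>z. ?r (x + z *s (y - x)))" for x y
    by (intro polyfun_mult polyfun_minus polyfun_add polyfun_const polyfun_segment)
  show "?r (vec4 0 1 (1 / b) 0) \<noteq> 0" using ab by simp
  show "\<not> (mpoly_eval F (($) (?p + z *s (x - ?p))) = 0 \<and> mpoly_eval G (($) (?p + z *s (x - ?p))) = 0)"
    if "?r x \<noteq> 0" for x z
  proof
    assume "mpoly_eval F (($) (?p + z *s (x - ?p))) = 0 \<and> mpoly_eval G (($) (?p + z *s (x - ?p))) = 0"
    then have "(?p + z *s (x - ?p)) $ 0 * (?p + z *s (x - ?p)) $ 3 = 0 \<and>
        (?p + z *s (x - ?p)) $ 1 * (a * (?p + z *s (x - ?p)) $ 0 + b * (?p + z *s (x - ?p)) $ 2) = 0"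
      using assms(1) by blast
    then have *: "(1 + z * (x $ 0 - 1)) * (1 + z * (x $ 3 - 1)) = 0"
      "(1 + z * (x $ 1 - 1)) * (a * (1 + z * (x $ 0 - 1)) + b * (1 + z * (x $ 2 - 1))) = 0"
      unfolding vector_add_component vector_smult_component vector_minus_component vec4_nth by (rule conjunct1, rule conjunct2)
    have "a * (1 + z * (x $ 0 - 1)) + b * (1 + z * (x $ 2 - 1)) = (a + b) + z * (?l x - (a + b))"
      by (simp add: algebra_simps)
    then have l: "(1 + z * (x $ 1 - 1)) * (1 + z * (?l x - 1)) = 0" using * ab by simp
    have differ: "u = v" if "1 + z * (u - 1) = 0" "1 + z * (v - 1) = 0" for u v :: complex
    proof -
      have "z * (u - v) = 0" using that by algebra
      moreover have "z \<noteq> 0" using that by auto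
      ultimately show ?thesis by simp
    qed
    show False
      using *(1) l \<open>?r x \<noteq> 0\<close> differ[of "x $ 0" "x $ 1"] differ[of "x $ 0" "?l x"]
        differ[of "x $ 3" "x $ 1"] differ[of "x $ 3" "?l x"] by auto
  qed
qed

lemma no_common_factor_linear:
  fixes F G :: "4 mpoly"
  assumes "\<And>x. mpoly_eval F (($) x) = 0 \<Longrightarrow> mpoly_eval G (($) x) = 0 \<Longrightarrow> x $ 0 = 0 \<and> x $ 1 = 0"
  shows "no_common_factor F G"
proof (rule no_common_factor_lines)
  let ?p = "vec4 1 0 0 0 :: pvec"
  show "polyfun (\<lambda>z. (x + z *s (y - x)) $ 1)" for x y :: pvec
    by (rule polyfun_segment)
  show "vec4 0 1 0 0 $ 1 \<noteq> (0 :: complex)" by simp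
  show "\<not> (mpoly_eval F (($) (?p + z *s (x - ?p))) = 0 \<and> mpoly_eval G (($) (?p + z *s (x - ?p))) = 0)"
    if "x $ 1 \<noteq> 0" for x z
    using assms[of "?p + z *s (x - ?p)"] that by auto
qed

text \<open>The normal form with \<open>h = 2\<close>, \<open>g = 1\<close>, \<open>\<kappa> = (1, -1)\<close>, base point \<open>(1, 1)\<close> and
  \<open>\<sigma> = (1, 1; 1, -1)\<close>.\<close>

definition ex_h :: "2 \<Rightarrow> 2 \<Rightarrow> real" where
  "ex_h j k = (if j = 0 then if k = 0 then 2 else - 1 else if k = 0 then 1 else - 2)"

definition ex_sign :: "2 \<Rightarrow> real" where "ex_sign i = (if i = 0 then 1 else - 1)"

definition ex_map :: trilinear where
  "ex_map = trilinear_of_control (\<lambda>i j k. ex_h j k) (\<lambda>i j k. ex_sign i)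
      (\<lambda>i j k. ex_sign k / ex_h j k) (\<lambda>i j k. ex_sign i * ex_sign j * ex_sign k / ex_h j k)"

lemma ex_map_nth:
  "ex_map $ 0 $ 0 $ 0 = vec4 2 2 1 1" "ex_map $ 0 $ 0 $ 1 = vec4 (- 1) (- 1) (- 1) (- 1)"
  "ex_map $ 0 $ 1 $ 0 = vec4 1 1 1 (- 1)" "ex_map $ 0 $ 1 $ 1 = vec4 (- 2) (- 2) (- 1) 1"
  "ex_map $ 1 $ 0 $ 0 = vec4 2 (- 2) 1 (- 1)" "ex_map $ 1 $ 0 $ 1 = vec4 (- 1) 1 (- 1) 1"
  "ex_map $ 1 $ 1 $ 0 = vec4 1 (- 1) 1 1" "ex_map $ 1 $ 1 $ 1 = vec4 (- 2) 2 (- 1) (- 1)"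
  by (simp_all add: ex_map_def trilinear_of_control_def control_point_def ex_h_def ex_sign_def vec4_eq_iff)

lemma generic_ex_map: "generic ex_map \<noteq> 0"
  unfolding generic_def gram_def bracket_def face_det_def ex_map_nth det4_expand vec4_nth by simp

lemma tri_eval_ex_map:
  "tri_eval ex_map s t u =
     (let p = s $ 0 + s $ 1; q = s $ 0 - s $ 1; w = u $ 0 - u $ 1;
          H = 2 * t $ 0 * u $ 0 - t $ 0 * u $ 1 + t $ 1 * u $ 0 - 2 * t $ 1 * u $ 1
      in vec4 (p * H) (q * H) (p * w * (t $ 0 + t $ 1)) (q * w * (t $ 0 - t $ 1)))"
  unfolding tri_eval_expand ex_map_nth Let_def by (simp add: vec4_eq_iff algebra_simps)

definition ex_A :: "2 \<Rightarrow> 4 mpoly" where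
  "ex_A i = (if i = 0 then var 0 + var 1 else var 0 - var 1)"

text \<open>On the image, \<open>x $ 1 * x $ 2\<close> and \<open>x $ 0 * x $ 3\<close> have a
  common factor and cofactors \<open>t $ 0 + t $ 1\<close> and \<open>t $ 0 - t $ 1\<close>; their
  sum and difference recover \<open>t\<close>.\<close>

definition ex_B :: "2 \<Rightarrow> 4 mpoly" where
  "ex_B i = (if i = 0 then var 1 * var 2 + var 0 * var 3 else var 1 * var 2 - var 0 * var 3)"

text \<open>With \<open>h + g = 3\<close> and eigenvalues 1 and -1, the line \<open>zline\<close>
  has the equations \<open>3 * Z0 = 2 * X0\<close> and \<open>Z1 = 0\<close>. Both products used
  here vanish on it, and on the image they are proportional to \<open>u $ 0 - u $ 1\<close> and
  \<open>- (u $ 0 + u $ 1)\<close>.\<close>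

definition ex_C :: "2 \<Rightarrow> 4 mpoly" where
  "ex_C i = (if i = 0 then var 0 * var 3 - var 1 * lin (vec4 (- 2) 0 3 0)
     else - (var 0 * var 3) - var 1 * lin (vec4 (- 2) 0 3 0))"

lemma ex_eval:
  "pair_eval ex_A x = vec2 (x $ 0 + x $ 1) (x $ 0 - x $ 1)"
  "pair_eval ex_B x = vec2 (x $ 1 * x $ 2 + x $ 0 * x $ 3) (x $ 1 * x $ 2 - x $ 0 * x $ 3)"
  "pair_eval ex_C x = vec2 (x $ 0 * x $ 3 - x $ 1 * (3 * x $ 2 - 2 * x $ 0)) (- (x $ 0 * x $ 3) - x $ 1 * (3 * x $ 2 - 2 * x $ 0))"
  by (simp_all add: pair_eval_def ex_A_def ex_B_def ex_C_def vec2_eq_iff mpoly_eval_lin sum_4')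

lemma same_rational_map_scale:
  assumes "\<And>x. g x = k x *s h x" "k x0 \<noteq> 0" "h x0 \<noteq> 0"
  shows "same_rational_map g h"
proof -
  have "g x0 \<noteq> 0" using assms by simp
  moreover have "g x $ i * h x $ j = g x $ j * h x $ i" for x i j
    unfolding assms(1) by simp
  ultimately show ?thesis unfolding same_rational_map_def using assms(3) by blast
qed

lemma is_inverse_ex_map: "is_inverse ex_map ex_A ex_B ex_C"
  unfolding is_inverse_def
proof (intro conjI)
  define H where "H t u = 2 * t $ 0 * u $ 0 - t $ 0 * u $ 1 + t $ 1 * u $ 0 - 2 * t $ 1 * u $ 1" for t u :: "complex ^ 2"
  define p q where "p s = s $ 0 + s $ 1" and "q s = s $ 0 - s $ 1" for s :: "complex ^ 2"
  have \<phi>: "tri_eval ex_map s t u = vec4 (p s * H t u) (q s * H t u) (p s * q u * (t $ 0 + t $ 1)) (q s * q u * (t $ 0 - t $ 1))"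
    for s t u by (simp add: tri_eval_ex_map Let_def H_def p_def q_def)
  let ?e = "vec2 1 0"
  have e: "H ?e ?e = 2" "p ?e = 1" "q ?e = 1" "?e \<noteq> 0" by (simp_all add: H_def p_def q_def vec2_eq_iff)
  have "pair_eval ex_A (tri_eval ex_map s t u) = (2 * H t u) *s s" for s t u
    by (simp add: ex_eval \<phi> vec2_eq_iff p_def q_def algebra_simps)
  then show "same_rational_map (\<lambda>(s, t, u). pair_eval ex_A (tri_eval ex_map s t u)) (\<lambda>(s, t, u). s)"
    by (intro same_rational_map_scale[where k = "\<lambda>(s, t, u). 2 * H t u" and ?x0.0 = "(?e, ?e, ?e)"])
      (auto simp: e simp del: vec2_nth)
  have "pair_eval ex_B (tri_eval ex_map s t u) = (2 * p s * q s * q u * H t u) *s t" for s t u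
    by (simp add: ex_eval \<phi> vec2_eq_iff algebra_simps)
  then show "same_rational_map (\<lambda>(s, t, u). pair_eval ex_B (tri_eval ex_map s t u)) (\<lambda>(s, t, u). t)"
    by (intro same_rational_map_scale[where k = "\<lambda>(s, t, u). 2 * p s * q s * q u * H t u" and ?x0.0 = "(?e, ?e, ?e)"])
      (auto simp: e simp del: vec2_nth)
  have "pair_eval ex_C (tri_eval ex_map s t u) = (2 * p s * q s * H t u * (t $ 0 - t $ 1)) *s u" for s t u
  proof -
    have key: "3 * (p s * q u * (t $ 0 + t $ 1)) - 2 * (p s * H t u) = p s * ((t $ 1 - t $ 0) * (u $ 0 + u $ 1))"
      by (simp add: H_def q_def algebra_simps)
    have qu: "q u = u $ 0 - u $ 1" by (simp add: q_def)
    show ?thesis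
      unfolding ex_eval \<phi> vec4_nth key unfolding qu by (simp add: vec2_eq_iff algebra_simps)
  qed
  then show "same_rational_map (\<lambda>(s, t, u). pair_eval ex_C (tri_eval ex_map s t u)) (\<lambda>(s, t, u). u)"
    by (intro same_rational_map_scale[where k = "\<lambda>(s, t, u). 2 * p s * q s * H t u * (t $ 0 - t $ 1)" and ?x0.0 = "(?e, ?e, ?e)"])
      (auto simp: e)
  have "tri_eval ex_map (pair_eval ex_A x) (pair_eval ex_B x) (pair_eval ex_C x)
      = (8 * (x $ 0 * x $ 0) * x $ 1 * x $ 3) *s x" for x
    unfolding ex_eval \<phi> H_def p_def q_def by (simp add: vec4_eq_iff algebra_simps)
  then show "same_rational_map (\<lambda>x. tri_eval ex_map (pair_eval ex_A x) (pair_eval ex_B x) (pair_eval ex_C x)) (\<lambda>x. x)"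
    by (rule same_rational_map_scale[where ?x0.0 = "vec4 1 1 1 1"]) (simp_all add: vec4_eq_iff)
qed

lemma birational_ex_map: "birational_of_type 1 2 2 ex_map"
  unfolding birational_of_type_def
proof (intro exI conjI allI)
  show "is_inverse ex_map ex_A ex_B ex_C" by (rule is_inverse_ex_map)
  have quad: "homogeneous 2 (p * q)" if "homogeneous 1 p" "homogeneous 1 q" for p q :: "4 mpoly"
    using homogeneous_mult[OF that] by (simp add: numeral_2_eq_2)
  show "homogeneous 1 (ex_A i)" for i
    unfolding ex_A_def by (simp add: homogeneous_add homogeneous_minus homogeneous_var del: One_nat_def)
  show "homogeneous 2 (ex_B i)" for i
    unfolding ex_B_def by (simp add: homogeneous_add homogeneous_minus quad homogeneous_var del: One_nat_def)
  show "homogeneous 2 (ex_C i)" for i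
    unfolding ex_C_def
    by (simp add: homogeneous_minus homogeneous_uminus quad homogeneous_lin homogeneous_var del: One_nat_def)
  show "no_common_factor (ex_A 0) (ex_A 1)"
    by (rule no_common_factor_linear) (simp add: ex_A_def)
  show "no_common_factor (ex_B 0) (ex_B 1)"
    by (rule no_common_factor_products[where a = 0 and b = 1]) (simp_all add: ex_B_def)
  show "no_common_factor (ex_C 0) (ex_C 1)"
    by (rule no_common_factor_products[where a = "- 2" and b = 3]) (simp_all add: ex_C_def mpoly_eval_lin sum_4' algebra_simps)
qed

theorem proposition5p2:
  shows "\<exists>U. zariski_open U \<and>
    (\<exists>w x y z. trilinear_of_control w x y z \<in> U \<and>
       birational_of_type 1 2 2 (trilinear_of_control w x y z)) \<and>
    (\<forall>c\<in>U. birational_of_type 1 2 2 c \<longrightarrow>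
       nondegenerate c \<and> scaffold c \<and>
       (\<exists>s r0 r1 y z.
          T_surf c 0 \<inter> T_surf c 1 = s \<union> r0 \<union> r1 \<union> y \<and>
          Y_surf c 0 \<inter> Y_surf c 1 = s \<union> r0 \<union> r1 \<union> z \<and>
          s = Sigma_surf c 0 \<inter> Sigma_surf c 1 \<and> is_line s \<and>
          r0 \<noteq> r1 \<and>
          {r. is_line r \<and> (\<forall>j k. r \<inter> s_line c j k \<noteq> {})} = {r0, r1} \<and>
          (\<exists>p q. u_line c 0 0 \<inter> u_line c 0 1 = proj_point p \<and>
                 u_line c 1 0 \<inter> u_line c 1 1 = proj_point q \<and>
                 is_line y \<and> y = line_through p q) \<and>
          (\<exists>p q. t_line c 0 0 \<inter> t_line c 0 1 = proj_point p \<and>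
                 t_line c 1 0 \<inter> t_line c 1 1 = proj_point q \<and>
                 is_line z \<and> z = line_through p q)))"
\<comment> \<open>Generality is witnessed by the nonvanishing of one form; \<open>ex_map\<close>,
  with real control points, shows that this open set meets the locus.\<close>
proof (intro exI[of _ "{c. c \<noteq> 0 \<and> generic c \<noteq> 0}"] conjI ballI impI)
  show "zariski_open {c. c \<noteq> 0 \<and> generic c \<noteq> 0}"
    using hom_poly_generic zariski_open_hom_poly by blast
  have "ex_map \<noteq> 0"
    using ex_map_nth(1) by (auto simp: vec4_eq_iff)
  then have "ex_map \<in> {c. c \<noteq> 0 \<and> generic c \<noteq> 0}" using generic_ex_map by simp
  with birational_ex_map show "\<exists>w x y z. trilinear_of_control w x y z \<in> {c. c \<noteq> 0 \<and> generic c \<noteq> 0} \<and>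
       birational_of_type 1 2 2 (trilinear_of_control w x y z)"
    unfolding ex_map_def by blast
next
  fix c assume "c \<in> {c. c \<noteq> 0 \<and> generic c \<noteq> 0}" and bir: "birational_of_type 1 2 2 c"
  then have gen: "generic c \<noteq> 0" by simp
  show "nondegenerate c"
    by (rule generic_normal_form[OF gen bir]) (rule normal_form.nondegenerate)
  show "scaffold c"
    by (rule generic_normal_form[OF gen bir]) (rule normal_form.scaffold)
  show "\<exists>s r0 r1 y z.
          T_surf c 0 \<inter> T_surf c 1 = s \<union> r0 \<union> r1 \<union> y \<and>
          Y_surf c 0 \<inter> Y_surf c 1 = s \<union> r0 \<union> r1 \<union> z \<and>
          s = Sigma_surf c 0 \<inter> Sigma_surf c 1 \<and> is_line s \<and>
          r0 \<noteq> r1 \<and>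
          {r. is_line r \<and> (\<forall>j k. r \<inter> s_line c j k \<noteq> {})} = {r0, r1} \<and>
          (\<exists>p q. u_line c 0 0 \<inter> u_line c 0 1 = proj_point p \<and>
                 u_line c 1 0 \<inter> u_line c 1 1 = proj_point q \<and>
                 is_line y \<and> y = line_through p q) \<and>
          (\<exists>p q. t_line c 0 0 \<inter> t_line c 0 1 = proj_point p \<and>
                 t_line c 1 0 \<inter> t_line c 1 1 = proj_point q \<and>
                 is_line z \<and> z = line_through p q)"
    by (rule generic_normal_form[OF gen bir], drule normal_form.boundary_structure) (elim conjE)
qed

end
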